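(* Let $(\Gamma_k)_{k\in\mathbb{N}}$ be a sequence of countable discrete groups such that $\inf_{k\in\mathbb{N}}\Lambda_{cb}(\Gamma_k)>1$ and define $\Gamma:=\bigoplus_k\Gamma_k$. Then the map $\mathrm{Sub}(\Gamma)\to[0,+\infty]$, $G\mapsto\Lambda_{cb}(G)$, is not continuous. If moreover $\Gamma_k$ is weakly amenable for all $k$, then the set of weakly amenable subgroups of $\Gamma$ is not closed in $\mathrm{Sub}(\Gamma)$.
   Context: For a countable discrete group $\Gamma$, $\mathrm{Sub}(\Gamma)$ is the set of subgroups of $\Gamma$, viewed as a (closed) subspace of $\{0,1\}^\Gamma$ with the product topology via characteristic functions. For a group $G$, $\Lambda_{cb}(G):=\Lambda_{cb}(\mathrm{L}(G))$ is the Cowling–Haagerup constant of its group von Neumann algebra, and $G$ is weakly amenable if $\Lambda_{cb}(G)<+\infty$. For a von Neumann algebra $A$ with faithful normal state $\varphi$, $\Lambda_{cb}(A)$ is the infimum of all $C>0$ such that for all $x_1,\dots,x_k$ in the unit ball of $A$ and all $\varepsilon>0$ there is a $\sigma$-weakly continuous finite rank linear map $\Phi:A\to A$ with $\|\Phi(x_j)-x_j\|_{2,\varphi}<\varepsilon$ for all $j$ and $\|\Phi\|_{cb}\le C$ ($+\infty$ if no such $C$ exists); here $\|x\|_{2,\varphi}=\varphi(x^*x)^{1/2}$, $\|\Phi\|_{cb}=\sup_n\|\mathrm{id}_{M_n(\mathbb{C})}\otimes\Phi\|$, and the value does not depend on $\varphi$. *)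

theory Defs
  imports "HOL-Analysis.Analysis" "HOL-Algebra.Product_Groups"
begin

text \<open>
  Hilbert spaces are realised as \<open>\<ell>\<^sup>2(X)\<close> for a set \<open>X\<close>. Vectors vanish outside \<open>X\<close> and operators
  vanish outside \<open>\<ell>\<^sup>2(X)\<close>, so that HOL equality of vectors and of operators is the intended one.
\<close>

type_synonym 'x vec = "'x \<Rightarrow> complex"
type_synonym 'x operator = "'x vec \<Rightarrow> 'x vec"

definition ell2 :: "'x set \<Rightarrow> 'x vec set" where
  "ell2 X = {f. (\<forall>x. x \<notin> X \<longrightarrow> f x = 0) \<and> (\<lambda>x. (cmod (f x))\<^sup>2) summable_on X}"

definition l2_inner :: "'x set \<Rightarrow> 'x vec \<Rightarrow> 'x vec \<Rightarrow> complex" where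
  "l2_inner X f g = (\<Sum>\<^sub>\<infinity>x\<in>X. f x * cnj (g x))"

definition l2_norm :: "'x set \<Rightarrow> 'x vec \<Rightarrow> real" where
  "l2_norm X f = sqrt (\<Sum>\<^sub>\<infinity>x\<in>X. (cmod (f x))\<^sup>2)"

definition bounded_ops :: "'x set \<Rightarrow> 'x operator set" where
  "bounded_ops X = {T.
     (\<forall>f. f \<notin> ell2 X \<longrightarrow> T f = (\<lambda>x. 0)) \<and>
     (\<forall>f\<in>ell2 X. T f \<in> ell2 X) \<and>
     (\<forall>f\<in>ell2 X. \<forall>g\<in>ell2 X. T (\<lambda>x. f x + g x) = (\<lambda>x. T f x + T g x)) \<and>
     (\<forall>c. \<forall>f\<in>ell2 X. T (\<lambda>x. c * f x) = (\<lambda>x. c * T f x)) \<and>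
     (\<exists>C. \<forall>f\<in>ell2 X. l2_norm X (T f) \<le> C * l2_norm X f)}"

definition op_norm :: "'x set \<Rightarrow> 'x operator \<Rightarrow> real" where
  "op_norm X T = (SUP f\<in>{f \<in> ell2 X. l2_norm X f \<le> 1}. l2_norm X (T f))"

definition op_adjoint :: "'x set \<Rightarrow> 'x operator \<Rightarrow> 'x operator" where
  "op_adjoint X T = (THE S. S \<in> bounded_ops X \<and>
     (\<forall>f\<in>ell2 X. \<forall>g\<in>ell2 X. l2_inner X (T f) g = l2_inner X f (S g)))"

definition commutant :: "'x set \<Rightarrow> 'x operator set \<Rightarrow> 'x operator set" where
  "commutant X S = {T \<in> bounded_ops X. \<forall>s\<in>S. T \<circ> s = s \<circ> T}"

text \<open>
  The \<open>\<sigma>\<close>-weak topology on \<open>B(\<ell>\<^sup>2(X))\<close> is the initial topology for the functionals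
  \<open>T \<mapsto> \<Sum>n. \<langle>T \<xi>\<^sub>n, \<eta>\<^sub>n\<rangle>\<close> with square-summable \<open>(\<xi>\<^sub>n)\<close> and \<open>(\<eta>\<^sub>n)\<close>.
\<close>

definition square_summable_seq :: "'x set \<Rightarrow> (nat \<Rightarrow> 'x vec) \<Rightarrow> bool" where
  "square_summable_seq X \<xi> \<longleftrightarrow> (\<forall>n. \<xi> n \<in> ell2 X) \<and> summable (\<lambda>n. (l2_norm X (\<xi> n))\<^sup>2)"

definition sigma_weak_topology :: "'x set \<Rightarrow> 'x operator topology" where
  "sigma_weak_topology X = topology_generated_by
     {{T \<in> bounded_ops X. (\<Sum>n. l2_inner X (T (\<xi> n)) (\<eta> n)) \<in> U} | \<xi> \<eta> U.
        square_summable_seq X \<xi> \<and> square_summable_seq X \<eta> \<and> open U}"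

definition sigma_weakly_continuous ::
    "'x set \<Rightarrow> 'x operator set \<Rightarrow> ('x operator \<Rightarrow> 'x operator) \<Rightarrow> bool" where
  "sigma_weakly_continuous X A \<Phi> \<longleftrightarrow>
     continuous_map (subtopology (sigma_weak_topology X) A) (subtopology (sigma_weak_topology X) A) \<Phi>"

definition linear_map_on :: "'x operator set \<Rightarrow> ('x operator \<Rightarrow> 'x operator) \<Rightarrow> bool" where
  "linear_map_on A \<Phi> \<longleftrightarrow>
     (\<forall>S\<in>A. \<Phi> S \<in> A) \<and>
     (\<forall>S\<in>A. \<forall>T\<in>A. \<Phi> (\<lambda>f x. S f x + T f x) = (\<lambda>f x. \<Phi> S f x + \<Phi> T f x)) \<and>
     (\<forall>c::complex. \<forall>T\<in>A. \<Phi> (\<lambda>f x. c * T f x) = (\<lambda>f x. c * \<Phi> T f x))"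

definition finite_rank_on :: "'x operator set \<Rightarrow> ('x operator \<Rightarrow> 'x operator) \<Rightarrow> bool" where
  "finite_rank_on A \<Phi> \<longleftrightarrow>
     (\<exists>B. finite B \<and> B \<subseteq> A \<and>
       (\<forall>T\<in>A. \<exists>c :: 'x operator \<Rightarrow> complex. \<Phi> T = (\<lambda>f x. \<Sum>S\<in>B. c S * S f x)))"

text \<open>
  An \<open>n \<times> n\<close> matrix of operators on \<open>\<ell>\<^sup>2(X)\<close> acts on \<open>\<ell>\<^sup>2(X)\<^sup>n\<close>, identified with
  \<open>\<ell>\<^sup>2({0,\<dots>,n-1} \<times> X)\<close>; \<open>id \<otimes> \<Phi>\<close> applies \<open>\<Phi>\<close> to every matrix entry.
\<close>

definition matrix_op :: "nat \<Rightarrow> (nat \<Rightarrow> nat \<Rightarrow> 'x operator) \<Rightarrow> (nat \<times> 'x) operator" where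
  "matrix_op n m = (\<lambda>\<xi> (i, x). if i < n then (\<Sum>j<n. m i j (\<lambda>y. \<xi> (j, y)) x) else 0)"

definition matrix_norm :: "'x set \<Rightarrow> nat \<Rightarrow> (nat \<Rightarrow> nat \<Rightarrow> 'x operator) \<Rightarrow> real" where
  "matrix_norm X n m = op_norm ({..<n} \<times> X) (matrix_op n m)"

definition cb_norm ::
    "'x set \<Rightarrow> 'x operator set \<Rightarrow> ('x operator \<Rightarrow> 'x operator) \<Rightarrow> ennreal" where
  "cb_norm X A \<Phi> =
     (SUP n\<in>{1..}. SUP m\<in>{m. (\<forall>i<n. \<forall>j<n. m i j \<in> A) \<and> matrix_norm X n m \<le> 1}.
        ennreal (matrix_norm X n (\<lambda>i j. \<Phi> (m i j))))"

definition norm2 :: "'x set \<Rightarrow> ('x operator \<Rightarrow> complex) \<Rightarrow> 'x operator \<Rightarrow> real" where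
  "norm2 X \<phi> T = sqrt (Re (\<phi> (op_adjoint X T \<circ> T)))"

text \<open>
  The constant of a von Neumann algebra \<open>A\<close> on \<open>\<ell>\<^sup>2(X)\<close> with respect to a faithful normal
  state \<open>\<phi>\<close>; the infimum of the empty set is \<open>\<infinity>\<close>.
\<close>

definition Lambda_cb_vN ::
    "'x set \<Rightarrow> 'x operator set \<Rightarrow> ('x operator \<Rightarrow> complex) \<Rightarrow> ennreal" where
  "Lambda_cb_vN X A \<phi> = Inf {ennreal C | C :: real. C > 0 \<and>
     (\<forall>F. finite F \<and> F \<subseteq> {T \<in> A. op_norm X T \<le> 1} \<longrightarrow>
       (\<forall>\<epsilon>>0. \<exists>\<Phi>. linear_map_on A \<Phi> \<and> sigma_weakly_continuous X A \<Phi> \<and> finite_rank_on A \<Phi> \<and>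
          (\<forall>T\<in>F. norm2 X \<phi> (\<lambda>f x. \<Phi> T f x - T f x) < \<epsilon>) \<and> cb_norm X A \<Phi> \<le> ennreal C))}"

definition left_regular :: "('a, 'b) monoid_scheme \<Rightarrow> 'a \<Rightarrow> 'a operator" where
  "left_regular G g = (\<lambda>f x.
     if f \<in> ell2 (carrier G) \<and> x \<in> carrier G then f (inv\<^bsub>G\<^esub> g \<otimes>\<^bsub>G\<^esub> x) else 0)"

definition group_vN :: "('a, 'b) monoid_scheme \<Rightarrow> 'a operator set" where
  "group_vN G = commutant (carrier G) (commutant (carrier G) (left_regular G ` carrier G))"

definition group_trace :: "('a, 'b) monoid_scheme \<Rightarrow> 'a operator \<Rightarrow> complex" where
  "group_trace G T =
     (let \<delta> = (\<lambda>x. if x = \<one>\<^bsub>G\<^esub> then 1 else 0) in l2_inner (carrier G) (T \<delta>) \<delta>)"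

text \<open>
  The constant of a von Neumann algebra does not depend on the faithful normal state; for a group
  von Neumann algebra the canonical trace is used.
\<close>

definition Lambda_cb :: "('a, 'b) monoid_scheme \<Rightarrow> ennreal" where
  "Lambda_cb G = Lambda_cb_vN (carrier G) (group_vN G) (group_trace G)"

definition weakly_amenable :: "('a, 'b) monoid_scheme \<Rightarrow> bool" where
  "weakly_amenable G \<longleftrightarrow> Lambda_cb G < \<infinity>"

text \<open>The topology induced by \<open>{0,1}\<^sup>\<Gamma>\<close> through characteristic functions.\<close>

definition Sub_topology :: "('a, 'b) monoid_scheme \<Rightarrow> 'a set topology" where
  "Sub_topology G = pullback_topology {H. subgroup H G} (\<lambda>H. \<lambda>g\<in>carrier G. g \<in> H)
     (product_topology (\<lambda>_. discrete_topology (UNIV :: bool set)) (carrier G))"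

end

theory Submission
  imports Defs
begin

text \<open>
  The constant \<open>\<Lambda>\<^sub>c\<^sub>b\<close> is governed by Schur multipliers: \<open>\<Lambda>\<^sub>c\<^sub>b(G) \<le> C\<close> as soon as the constant function
  \<open>1\<close> is a pointwise limit of finitely supported functions \<open>\<phi>\<close> on \<open>G\<close> whose kernels
  \<open>\<phi>(s t\<^sup>-\<^sup>1)\<close> are Schur multipliers of completely bounded norm at most \<open>C\<close>, and this approximation
  property holds if \<open>\<Lambda>\<^sub>c\<^sub>b(G) < C\<close>. For the first implication one uses the Fourier multiplier
  \<open>\<lambda>(g) \<mapsto> \<phi>(g) \<lambda>(g)\<close>. For the second one averages a map \<open>\<Phi>\<close> to \<open>\<phi>(g) = \<langle>\<Phi>(\<lambda>(g)) \<delta>\<^sub>1, \<delta>\<^sub>g\<rangle>\<close>; finite rank makes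
  \<open>\<phi>\<close> square summable, and the tail of a square summable function has small multiplier norm.

  Multiplier norms only involve finite matrices, so products and injective homomorphisms are easy
  to handle. If \<open>1\<close> is not approximable with constant \<open>a\<close> on \<open>G\<close> and with constant \<open>b\<close> on \<open>H\<close>, then
  the tensor product of two separating functionals shows that it is not approximable with constant
  \<open>ab\<close> on \<open>G \<times> H\<close>. Hence if \<open>\<Lambda>\<^sub>c\<^sub>b(\<Gamma>\<^sub>k) > c > 1\<close> for all \<open>k\<close>, the full sum is not weakly amenable, while it
  is the limit of its finite partial sums. The first claim needs less: the single summands converge
  to the trivial subgroup, whose constant is at most \<open>1\<close>.
\<close>

section \<open>Schur multipliers\<close>

text \<open>Von Neumann algebras enter only through the two implications between
  \<open>Lambda_cb\<close> and \<open>multiplier_approx\<close>. These do not match exactly: cutting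
  a square summable function down to a finite set costs an arbitrarily small amount of norm, so
  passing from \<open>Lambda_cb\<close> to multipliers consumes a strict inequality. The hypothesis
  affords this, since a real number c fits strictly between 1 and the infimum of the constants. On
  direct sums no exact value of the constant is computed: c fails for each summand, so c^n fails for
  n summands, and every finite constant is eventually exceeded. The difficulty lies in the product
  step, because an approximating function on G x H need not be a product of functions on G and H.
  Applying the functional on H first leaves a function on G whose multiplier norm must be bounded.
  This works because a multiplier on G x H, tested in the G variable against a contractive matrix
  and two vectors, becomes a multiplier on H, which in turn rests on the contractivity of Kronecker
  products.\<close>

definition form_bound :: "'i set \<Rightarrow> ('i \<Rightarrow> 'i \<Rightarrow> complex) \<Rightarrow> real \<Rightarrow> bool" where
  "form_bound I x C \<longleftrightarrow> (\<forall>u v. cmod (\<Sum>i\<in>I. \<Sum>j\<in>I. x i j * u i * v j)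
     \<le> C * L2_set (\<lambda>i. cmod (u i)) I * L2_set (\<lambda>j. cmod (v j)) I)"

text \<open>
  The family \<open>p\<close> may repeat points of \<open>X\<close>, so the bound automatically holds for all matrix
  amplifications: this is the completely bounded norm of the Schur multiplier \<open>k\<close>.
\<close>

definition schur_bound :: "'x set \<Rightarrow> ('x \<Rightarrow> 'x \<Rightarrow> complex) \<Rightarrow> real \<Rightarrow> bool" where
  "schur_bound X k C \<longleftrightarrow> (\<forall>(I :: nat set) p x. finite I \<and> p ` I \<subseteq> X \<and> form_bound I x 1 \<longrightarrow>
     form_bound I (\<lambda>i j. k (p i) (p j) * x i j) C)"

lemma form_boundD:
  assumes "form_bound I x C"
  shows "cmod (\<Sum>i\<in>I. \<Sum>j\<in>I. x i j * u i * v j)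
     \<le> C * L2_set (\<lambda>i. cmod (u i)) I * L2_set (\<lambda>j. cmod (v j)) I"
  using assms unfolding form_bound_def by blast

lemma form_bound_mono:
  assumes "form_bound I x C" "C \<le> D"
  shows "form_bound I x D"
  unfolding form_bound_def
proof (intro allI)
  fix u v
  have "C * L2_set (\<lambda>i. cmod (u i)) I * L2_set (\<lambda>j. cmod (v j)) I
      \<le> D * L2_set (\<lambda>i. cmod (u i)) I * L2_set (\<lambda>j. cmod (v j)) I"
    using assms(2) by (intro mult_right_mono) auto
  then show "cmod (\<Sum>i\<in>I. \<Sum>j\<in>I. x i j * u i * v j)
      \<le> D * L2_set (\<lambda>i. cmod (u i)) I * L2_set (\<lambda>j. cmod (v j)) I"
    using form_boundD[OF assms(1)] order_trans by blast
qed

lemma form_bound_cmult: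
  assumes "form_bound I x C"
  shows "form_bound I (\<lambda>i j. a * x i j) (cmod a * C)"
  unfolding form_bound_def
proof (intro allI)
  fix u v
  have "(\<Sum>i\<in>I. \<Sum>j\<in>I. a * x i j * u i * v j) = a * (\<Sum>i\<in>I. \<Sum>j\<in>I. x i j * u i * v j)"
    by (simp add: sum_distrib_left mult.assoc)
  then show "cmod (\<Sum>i\<in>I. \<Sum>j\<in>I. a * x i j * u i * v j)
      \<le> cmod a * C * L2_set (\<lambda>i. cmod (u i)) I * L2_set (\<lambda>j. cmod (v j)) I"
    using mult_left_mono[OF form_boundD[OF assms], of "cmod a" u v] by (simp add: norm_mult mult.assoc)
qed

lemma form_bound_add:
  assumes "form_bound I x C" "form_bound I y D"
  shows "form_bound I (\<lambda>i j. x i j + y i j) (C + D)"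
  unfolding form_bound_def
proof (intro allI)
  fix u v
  have "(\<Sum>i\<in>I. \<Sum>j\<in>I. (x i j + y i j) * u i * v j)
      = (\<Sum>i\<in>I. \<Sum>j\<in>I. x i j * u i * v j) + (\<Sum>i\<in>I. \<Sum>j\<in>I. y i j * u i * v j)"
    by (simp add: sum.distrib distrib_right)
  then show "cmod (\<Sum>i\<in>I. \<Sum>j\<in>I. (x i j + y i j) * u i * v j)
      \<le> (C + D) * L2_set (\<lambda>i. cmod (u i)) I * L2_set (\<lambda>j. cmod (v j)) I"
    using form_boundD[OF assms(1), of u v] form_boundD[OF assms(2), of u v]
      norm_triangle_ineq[of "\<Sum>i\<in>I. \<Sum>j\<in>I. x i j * u i * v j" "\<Sum>i\<in>I. \<Sum>j\<in>I. y i j * u i * v j"]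
    by (simp add: distrib_right)
qed

lemma L2_set_reindex:
  assumes "bij_betw h I J"
  shows "L2_set f J = L2_set (f \<circ> h) I"
  unfolding L2_set_def using sum.reindex_bij_betw[OF assms, of "\<lambda>j. (f j)\<^sup>2"] by simp

lemma form_bound_reindex:
  assumes h: "bij_betw h I J" and "form_bound I (\<lambda>i i'. y (h i) (h i')) C"
  shows "form_bound J y C"
  unfolding form_bound_def
proof (intro allI)
  fix u v
  have "(\<Sum>j\<in>J. \<Sum>j'\<in>J. y j j' * u j * v j') = (\<Sum>i\<in>I. \<Sum>i'\<in>I. y (h i) (h i') * u (h i) * v (h i'))"
    by (subst sum.reindex_bij_betw[OF h, symmetric],
        subst sum.reindex_bij_betw[OF h, symmetric]) simp
  then show "cmod (\<Sum>j\<in>J. \<Sum>j'\<in>J. y j j' * u j * v j')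
      \<le> C * L2_set (\<lambda>i. cmod (u i)) J * L2_set (\<lambda>j. cmod (v j)) J"
    using form_boundD[OF assms(2), of "u \<circ> h" "v \<circ> h"] by (simp add: L2_set_reindex[OF h] o_def)
qed

lemma L2_set_sq: "(L2_set f A)\<^sup>2 = (\<Sum>i\<in>A. (f i)\<^sup>2)"
  by (simp add: L2_set_def sum_nonneg)

text \<open>Testing against the conjugate of \<open>x v\<close> gives
  \<open>|x v|^2 \<le> C |x v| |v|\<close>, and one factor cancels. With
  \<open>form_bound_opI\<close> this identifies the bilinear bound with the Euclidean operator norm
  bound; leaving out conjugates in \<open>form_bound\<close> is harmless since all \<open>u\<close>
  are allowed.\<close>

lemma form_bound_op:
  assumes "form_bound I x C" "0 \<le> C"
  shows "L2_set (\<lambda>i. cmod (\<Sum>j\<in>I. x i j * v j)) I \<le> C * L2_set (\<lambda>j. cmod (v j)) I"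
proof -
  define w where "w i = (\<Sum>j\<in>I. x i j * v j)" for i
  let ?W = "L2_set (\<lambda>i. cmod (w i)) I"
  have "(\<Sum>j\<in>I. x i j * cnj (w i) * v j) = cnj (w i) * w i" for i
    unfolding w_def[of i] sum_distrib_left by (intro sum.cong) simp_all
  then have "(\<Sum>i\<in>I. \<Sum>j\<in>I. x i j * cnj (w i) * v j) = (\<Sum>i\<in>I. cnj (w i) * w i)"
    by simp
  also have "\<dots> = of_real (\<Sum>i\<in>I. (cmod (w i))\<^sup>2)"
    unfolding of_real_sum by (intro sum.cong) (simp_all only: complex_norm_square mult.commute)
  finally have "cmod (\<Sum>i\<in>I. \<Sum>j\<in>I. x i j * cnj (w i) * v j) = ?W\<^sup>2"
    by (simp only: norm_of_real L2_set_sq[symmetric]) simp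
  with form_boundD[OF assms(1), of "\<lambda>i. cnj (w i)" v]
  have "?W\<^sup>2 \<le> C * ?W * L2_set (\<lambda>j. cmod (v j)) I" by simp
  then have "?W * ?W \<le> ?W * (C * L2_set (\<lambda>j. cmod (v j)) I)"
    by (simp add: power2_eq_square mult_ac)
  moreover have "0 \<le> ?W" by simp
  ultimately have "?W \<le> C * L2_set (\<lambda>j. cmod (v j)) I"
    using assms(2) by (cases "?W = 0") (auto simp: mult_le_cancel_left)
  then show ?thesis by (simp add: w_def)
qed

lemma cmod_sum_mult_le:
  "cmod (\<Sum>i\<in>I. u i * w i) \<le> L2_set (\<lambda>i. cmod (u i)) I * L2_set (\<lambda>i. cmod (w i)) I"
proof -
  have "cmod (\<Sum>i\<in>I. u i * w i) \<le> (\<Sum>i\<in>I. \<bar>cmod (u i)\<bar> * \<bar>cmod (w i)\<bar>)"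
    by (rule order_trans[OF norm_sum]) (simp add: norm_mult)
  also have "\<dots> \<le> L2_set (\<lambda>i. cmod (u i)) I * L2_set (\<lambda>i. cmod (w i)) I"
    by (rule L2_set_mult_ineq)
  finally show ?thesis .
qed

lemma form_bound_opI:
  assumes "\<And>v. L2_set (\<lambda>i. cmod (\<Sum>j\<in>I. x i j * v j)) I \<le> C * L2_set (\<lambda>j. cmod (v j)) I"
  shows "form_bound I x C"
  unfolding form_bound_def
proof (intro allI)
  fix u v
  let ?w = "\<lambda>i. \<Sum>j\<in>I. x i j * v j"
  have "(\<Sum>i\<in>I. \<Sum>j\<in>I. x i j * u i * v j) = (\<Sum>i\<in>I. u i * ?w i)"
    unfolding sum_distrib_left by (intro sum.cong) simp_all
  then have "cmod (\<Sum>i\<in>I. \<Sum>j\<in>I. x i j * u i * v j)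
      \<le> L2_set (\<lambda>i. cmod (u i)) I * L2_set (\<lambda>i. cmod (?w i)) I"
    by (simp only: cmod_sum_mult_le)
  also have "\<dots> \<le> L2_set (\<lambda>i. cmod (u i)) I * (C * L2_set (\<lambda>j. cmod (v j)) I)"
    by (rule mult_left_mono[OF assms]) simp
  finally show "cmod (\<Sum>i\<in>I. \<Sum>j\<in>I. x i j * u i * v j)
      \<le> C * L2_set (\<lambda>i. cmod (u i)) I * L2_set (\<lambda>j. cmod (v j)) I" by (simp add: mult_ac)
qed

text \<open>Cauchy-Schwarz over the copies \<open>r\<close>: acting separately on each copy does not
  increase the norm of \<open>x\<close>. It serves for kernels that factor through inner products of
  vectors indexed by \<open>r\<close>, as in \<open>schur_bound_ell2\<close>.\<close>

lemma form_bound_amplify: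
  assumes "form_bound I x C" "0 \<le> C"
  shows "cmod (\<Sum>r\<in>R. \<Sum>i\<in>I. \<Sum>j\<in>I. x i j * U i r * V j r)
    \<le> C * sqrt (\<Sum>r\<in>R. \<Sum>i\<in>I. (cmod (U i r))\<^sup>2) * sqrt (\<Sum>r\<in>R. \<Sum>j\<in>I. (cmod (V j r))\<^sup>2)"
proof -
  let ?u = "\<lambda>r. L2_set (\<lambda>i. cmod (U i r)) I" and ?v = "\<lambda>r. L2_set (\<lambda>i. cmod (V i r)) I"
  have "cmod (\<Sum>r\<in>R. \<Sum>i\<in>I. \<Sum>j\<in>I. x i j * U i r * V j r) \<le> (\<Sum>r\<in>R. C * ?u r * ?v r)"
    by (rule sum_norm_le) (rule form_boundD[OF assms(1)])
  also have "\<dots> = C * (\<Sum>r\<in>R. \<bar>?u r\<bar> * \<bar>?v r\<bar>)"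
    by (simp add: sum_distrib_left mult.assoc)
  also have "\<dots> \<le> C * (L2_set ?u R * L2_set ?v R)"
    by (rule mult_left_mono[OF L2_set_mult_ineq assms(2)])
  also have "\<dots> = C * sqrt (\<Sum>r\<in>R. \<Sum>i\<in>I. (cmod (U i r))\<^sup>2) * sqrt (\<Sum>r\<in>R. \<Sum>j\<in>I. (cmod (V j r))\<^sup>2)"
    unfolding L2_set_def[of _ R] by (simp add: L2_set_sq mult.assoc)
  finally show ?thesis .
qed

lemma form_bound_cong:
  assumes "form_bound I x C" "\<And>i j. i \<in> I \<Longrightarrow> j \<in> I \<Longrightarrow> x i j = y i j"
  shows "form_bound I y C"
proof -
  have "(\<Sum>i\<in>I. \<Sum>j\<in>I. x i j * u i * v j) = (\<Sum>i\<in>I. \<Sum>j\<in>I. y i j * u i * v j)" for u v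
    by (intro sum.cong refl) (simp add: assms(2))
  then show ?thesis
    using assms(1) unfolding form_bound_def by simp
qed

text \<open>The Kronecker product is \<open>z\<close> in the second coordinate, with result
  \<open>w\<close>, followed by \<open>x\<close> in the first, and each of the two is a contraction
  on every slice.\<close>

lemma form_bound_kronecker:
  assumes x: "form_bound I x 1" and z: "form_bound J z 1"
  shows "form_bound (I \<times> J) (\<lambda>p q. x (fst p) (fst q) * z (snd p) (snd q)) 1"
proof (rule form_bound_opI)
  fix v :: "'a \<times> 'b \<Rightarrow> complex"
  define w where "w j k = (\<Sum>l\<in>J. z k l * v (j, l))" for j k
  have sq: "(L2_set (\<lambda>p. cmod (h p)) (I \<times> J))\<^sup>2 = (\<Sum>j\<in>I. \<Sum>l\<in>J. (cmod (h (j, l)))\<^sup>2)"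
    for h :: "'a \<times> 'b \<Rightarrow> complex"
    unfolding L2_set_sq by (simp only: sum.cartesian_product case_prod_unfold prod.collapse)
  have inner: "(\<Sum>q\<in>I \<times> J. x i (fst q) * z k (snd q) * v q) = (\<Sum>j\<in>I. x i j * w j k)" for i k
  proof -
    have "(\<Sum>q\<in>I \<times> J. x i (fst q) * z k (snd q) * v q) = (\<Sum>j\<in>I. \<Sum>l\<in>J. x i j * z k l * v (j, l))"
      by (simp only: sum.cartesian_product case_prod_unfold prod.collapse)
    also have "\<dots> = (\<Sum>j\<in>I. x i j * w j k)"
      unfolding w_def sum_distrib_left by (simp only: mult.assoc)
    finally show ?thesis .
  qed
  have "(L2_set (\<lambda>p. cmod (\<Sum>q\<in>I \<times> J. x (fst p) (fst q) * z (snd p) (snd q) * v q)) (I \<times> J))\<^sup>2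
      = (\<Sum>i\<in>I. \<Sum>k\<in>J. (cmod (\<Sum>j\<in>I. x i j * w j k))\<^sup>2)"
    unfolding sq fst_conv snd_conv inner ..
  also have "\<dots> = (\<Sum>k\<in>J. (L2_set (\<lambda>i. cmod (\<Sum>j\<in>I. x i j * w j k)) I)\<^sup>2)"
    unfolding L2_set_sq by (rule sum.swap)
  also have "\<dots> \<le> (\<Sum>k\<in>J. (L2_set (\<lambda>j. cmod (w j k)) I)\<^sup>2)"
    using form_bound_op[OF x] by (intro sum_mono power_mono) auto
  also have "\<dots> = (\<Sum>j\<in>I. (L2_set (\<lambda>k. cmod (w j k)) J)\<^sup>2)"
    unfolding L2_set_sq by (rule sum.swap)
  also have "\<dots> \<le> (\<Sum>j\<in>I. (L2_set (\<lambda>l. cmod (v (j, l))) J)\<^sup>2)"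
    using form_bound_op[OF z] unfolding w_def by (intro sum_mono power_mono) auto
  also have "\<dots> = (L2_set (\<lambda>q. cmod (v q)) (I \<times> J))\<^sup>2"
    unfolding sq by (simp only: L2_set_sq)
  finally show "L2_set (\<lambda>p. cmod (\<Sum>q\<in>I \<times> J. x (fst p) (fst q) * z (snd p) (snd q) * v q)) (I \<times> J)
      \<le> 1 * L2_set (\<lambda>q. cmod (v q)) (I \<times> J)"
    unfolding mult_1 by (rule power2_le_imp_le) simp
qed

section \<open>Schur multipliers on a set: change of index set and permanence properties\<close>

lemma schur_boundI:
  assumes "\<And>(I :: nat set) p x. finite I \<Longrightarrow> (\<And>i. i \<in> I \<Longrightarrow> p i \<in> X) \<Longrightarrow> form_bound I x 1
    \<Longrightarrow> form_bound I (\<lambda>i j. k (p i) (p j) * x i j) C"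
  shows "schur_bound X k C"
  unfolding schur_bound_def using assms by (simp add: image_subset_iff)

text \<open>A definition cannot quantify over index types, hence the sets of naturals in
  \<open>schur_bound\<close>. Enumerating \<open>I\<close> and dividing \<open>x\<close> by
  \<open>A\<close> carries the bound to every finite index set, in particular to products and to
  \<open>bool\<close>.\<close>

lemma schur_boundD:
  assumes k: "schur_bound X k C" and I: "finite I" and p: "\<And>i. i \<in> I \<Longrightarrow> p i \<in> X"
    and x: "form_bound I x A" and A: "0 < A"
  shows "form_bound I (\<lambda>i j. k (p i) (p j) * x i j) (C * A)"
proof -
  obtain h where h: "bij_betw h {0..<card I} I"
    using ex_bij_betw_nat_finite[OF I] by blast
  define g where "g = inv_into {0..<card I} h"
  have g: "bij_betw g I {0..<card I}"
    unfolding g_def by (rule bij_betw_inv_into[OF h])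
  have hg: "h (g i) = i" if "i \<in> I" for i
    unfolding g_def using h that by (simp add: bij_betw_inv_into_right)
  let ?y = "\<lambda>m n. of_real (1 / A) * x (h m) (h n)"
  have "form_bound I (\<lambda>i j. of_real (1 / A) * x i j) 1"
    using form_bound_cmult[OF x, of "of_real (1 / A)"] A by (simp add: norm_divide)
  then have "form_bound I (\<lambda>i j. ?y (g i) (g j)) 1"
    by (rule form_bound_cong) (simp only: hg)
  then have "form_bound {0..<card I} ?y 1"
    by (rule form_bound_reindex[OF g])
  moreover have "(p \<circ> h) ` {0..<card I} \<subseteq> X"
    using h p by (auto simp: bij_betw_def)
  ultimately have "form_bound {0..<card I} (\<lambda>m n. k ((p \<circ> h) m) ((p \<circ> h) n) * ?y m n) C"
    using k unfolding schur_bound_def by blast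
  from form_bound_cmult[OF this, of "of_real A"]
  have "form_bound {0..<card I} (\<lambda>m n. of_real A * (k ((p \<circ> h) m) ((p \<circ> h) n) * ?y m n)) (C * A)"
    using A by (simp add: mult.commute)
  then have "form_bound {0..<card I} (\<lambda>m n. k (p (h m)) (p (h n)) * x (h m) (h n)) (C * A)"
    by (rule form_bound_cong) (use A in simp)
  then show ?thesis
    by (rule form_bound_reindex[OF h])
qed

lemma schur_boundD1:
  assumes "schur_bound X k C" "finite I" "\<And>i. i \<in> I \<Longrightarrow> p i \<in> X" "form_bound I x 1"
  shows "form_bound I (\<lambda>i j. k (p i) (p j) * x i j) C"
  using schur_boundD[OF assms zero_less_one] by simp

lemma schur_bound_mono:
  assumes "schur_bound X k C" "C \<le> D"
  shows "schur_bound X k D"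
  by (intro schur_boundI form_bound_mono[OF _ assms(2)] schur_boundD1[OF assms(1)])

lemma schur_bound_add:
  assumes "schur_bound X k C" "schur_bound X l D"
  shows "schur_bound X (\<lambda>s t. k s t + l s t) (C + D)"
  unfolding distrib_right
  by (rule schur_boundI, unfold distrib_right)
    (intro form_bound_add schur_boundD1[OF assms(1)] schur_boundD1[OF assms(2)])

lemma schur_bound_cmult:
  assumes "schur_bound X k C"
  shows "schur_bound X (\<lambda>s t. a * k s t) (cmod a * C)"
  by (rule schur_boundI, unfold mult.assoc) (intro form_bound_cmult schur_boundD1[OF assms])

text \<open>Multiplication by \<open>l\<close> comes first; its result has norm at most
  \<open>D\<close>, and \<open>0 < D\<close> allows it to be rescaled before \<open>k\<close> is
  applied.\<close>

lemma schur_bound_mult: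
  assumes k: "schur_bound X k C" and l: "schur_bound X l D" and D: "0 < D"
  shows "schur_bound X (\<lambda>s t. k s t * l s t) (C * D)"
  by (rule schur_boundI, unfold mult.assoc) (intro schur_boundD[OF k] schur_boundD1[OF l] D)

lemma schur_bound_pullback:
  assumes "schur_bound Y k C" "\<And>x. x \<in> X \<Longrightarrow> h x \<in> Y"
  shows "schur_bound X (\<lambda>s t. k (h s) (h t)) C"
  by (rule schur_boundI) (intro schur_boundD1[OF assms(1)] assms(2))

lemma schur_bound_cong:
  assumes "schur_bound X k C" "\<And>s t. s \<in> X \<Longrightarrow> t \<in> X \<Longrightarrow> k s t = l s t"
  shows "schur_bound X l C"
proof (rule schur_boundI)
  fix I :: "nat set" and p x
  assume I: "finite I" and p: "\<And>i. i \<in> I \<Longrightarrow> p i \<in> X" and x: "form_bound I x 1"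
  show "form_bound I (\<lambda>i j. l (p i) (p j) * x i j) C"
  proof (rule form_bound_cong[OF schur_boundD1[OF assms(1) I p x]])
    fix i j assume "i \<in> I" "j \<in> I"
    with assms(2)[OF p p] show "k (p i) (p j) * x i j = l (p i) (p j) * x i j"
      by simp
  qed
qed

lemma schur_bound_const: "schur_bound X (\<lambda>s t. a) (cmod a)"
  using form_bound_cmult[where C = 1] by (intro schur_boundI) simp

text \<open>A single matrix unit detects one entry of the kernel. Indexing by \<open>bool\<close>
  rather than by points of \<open>X\<close> keeps the two indices apart even for
  \<open>s = t\<close>.\<close>

lemma schur_bound_le:
  assumes k: "schur_bound X k C" and st: "s \<in> X" "t \<in> X"
  shows "cmod (k s t) \<le> C"
proof -
  define p where "p i = (if i then s else t)" for i :: bool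
  define x :: "bool \<Rightarrow> bool \<Rightarrow> complex" where "x i j = of_bool (i \<and> \<not> j)" for i j
  have "form_bound UNIV x 1"
    by (rule form_bound_opI) (simp add: x_def UNIV_bool L2_set_def)
  from schur_boundD[OF k _ _ this, of p]
  have "form_bound UNIV (\<lambda>i j. k (p i) (p j) * x i j) C"
    using st by (simp add: p_def)
  from form_boundD[OF this, of "of_bool" "\<lambda>j. of_bool (\<not> j)"] show ?thesis
    by (simp add: UNIV_bool x_def p_def L2_set_def)
qed

section \<open>Approximation by finitely supported multipliers\<close>

text \<open>The argument \<open>s t^-1\<close> belongs to the left regular representation: operators
  in \<open>group_vN G\<close> have matrix entries that depend on \<open>s t^-1\<close> alone, see
  \<open>group_vN_coefficient\<close>.\<close>

definition multiplier_kernel :: "('a, 'b) monoid_scheme \<Rightarrow> ('a \<Rightarrow> complex) \<Rightarrow> 'a \<Rightarrow> 'a \<Rightarrow> complex" where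
  "multiplier_kernel G \<phi> s t = \<phi> (s \<otimes>\<^bsub>G\<^esub> inv\<^bsub>G\<^esub> t)"

text \<open>Weak amenability in terms of Herz-Schur multipliers, with constant \<open>C\<close>.
  Convergence is demanded only at points; together with the uniform bound it yields convergence in
  the 2-norm in \<open>Lambda_cb_le\<close>.\<close>

definition multiplier_approx :: "('a, 'b) monoid_scheme \<Rightarrow> real \<Rightarrow> bool" where
  "multiplier_approx G C \<longleftrightarrow> (\<forall>F \<epsilon>. finite F \<and> F \<subseteq> carrier G \<and> \<epsilon> > 0 \<longrightarrow>
     (\<exists>\<phi>. finite {g \<in> carrier G. \<phi> g \<noteq> 0} \<and> (\<forall>g\<in>F. cmod (\<phi> g - 1) < \<epsilon>) \<and>
       schur_bound (carrier G) (multiplier_kernel G \<phi>) C))"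

lemma multiplier_approxD:
  assumes "multiplier_approx G C" "finite F" "F \<subseteq> carrier G" "\<epsilon> > 0"
  obtains \<phi> where "finite {g \<in> carrier G. \<phi> g \<noteq> 0}" "\<And>g. g \<in> F \<Longrightarrow> cmod (\<phi> g - 1) < \<epsilon>"
    "schur_bound (carrier G) (multiplier_kernel G \<phi>) C"
proof -
  have "\<exists>\<phi>. finite {g \<in> carrier G. \<phi> g \<noteq> 0} \<and> (\<forall>g\<in>F. cmod (\<phi> g - 1) < \<epsilon>) \<and>
       schur_bound (carrier G) (multiplier_kernel G \<phi>) C"
    by (rule assms(1)[unfolded multiplier_approx_def, rule_format]) (intro conjI assms(2-4))
  then show thesis by (elim exE conjE) (rule that; simp)
qed

lemma multiplier_approxI:
  assumes "\<And>F \<epsilon>. finite F \<Longrightarrow> F \<subseteq> carrier G \<Longrightarrow> \<epsilon> > 0 \<Longrightarrow>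
     \<exists>\<phi>. finite {g \<in> carrier G. \<phi> g \<noteq> 0} \<and> (\<forall>g\<in>F. cmod (\<phi> g - 1) < \<epsilon>) \<and>
       schur_bound (carrier G) (multiplier_kernel G \<phi>) C"
  shows "multiplier_approx G C"
  using assms unfolding multiplier_approx_def by blast

lemma multiplier_approx_mono:
  assumes "multiplier_approx G C" "C \<le> D"
  shows "multiplier_approx G D"
proof (rule multiplier_approxI)
  fix F and \<epsilon> :: real
  assume "finite F" "F \<subseteq> carrier G" "\<epsilon> > 0"
  then obtain \<phi> where "finite {g \<in> carrier G. \<phi> g \<noteq> 0}" "\<And>g. g \<in> F \<Longrightarrow> cmod (\<phi> g - 1) < \<epsilon>"
    "schur_bound (carrier G) (multiplier_kernel G \<phi>) C"
    by (rule multiplier_approxD[OF assms(1)]) (rule that)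
  then show "\<exists>\<phi>. finite {g \<in> carrier G. \<phi> g \<noteq> 0} \<and> (\<forall>g\<in>F. cmod (\<phi> g - 1) < \<epsilon>) \<and>
       schur_bound (carrier G) (multiplier_kernel G \<phi>) D"
    using schur_bound_mono[OF _ assms(2)] by blast
qed

text \<open>Multipliers pull back along \<open>h\<close>: the homomorphism property matches the
  kernels and injectivity keeps the support finite. Passage to subgroups, embedding of a summand and
  splitting of a sum are all instances.\<close>

lemma multiplier_approx_inj_hom:
  assumes G: "group G" and H: "group H" and h: "h \<in> hom G H" and inj: "inj_on h (carrier G)"
    and H_approx: "multiplier_approx H C"
  shows "multiplier_approx G C"
proof (rule multiplier_approxI)
  fix F and \<epsilon> :: real
  assume F: "finite F" "F \<subseteq> carrier G" "\<epsilon> > 0"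
  have hc: "h g \<in> carrier H" if "g \<in> carrier G" for g
    using h that by (auto simp: hom_def)
  have "finite (h ` F)" "h ` F \<subseteq> carrier H"
    using F hc by auto
  then obtain \<phi> where fin: "finite {g \<in> carrier H. \<phi> g \<noteq> 0}"
    and near: "\<And>g. g \<in> h ` F \<Longrightarrow> cmod (\<phi> g - 1) < \<epsilon>"
    and schur: "schur_bound (carrier H) (multiplier_kernel H \<phi>) C"
    using multiplier_approxD[OF H_approx _ _ F(3)] by blast
  have "inj_on h {g \<in> carrier G. \<phi> (h g) \<noteq> 0}"
    by (rule inj_on_subset[OF inj]) auto
  moreover have "h ` {g \<in> carrier G. \<phi> (h g) \<noteq> 0} \<subseteq> {g \<in> carrier H. \<phi> g \<noteq> 0}"
    using hc by auto
  ultimately have "finite {g \<in> carrier G. \<phi> (h g) \<noteq> 0}"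
    using finite_imageD[OF finite_subset[OF _ fin]] by simp
  moreover have "schur_bound (carrier G) (multiplier_kernel G (\<lambda>g. \<phi> (h g))) C"
  proof (rule schur_bound_cong[OF schur_bound_pullback[OF schur]])
    interpret group_hom G H h
      by (intro group_hom.intro G H group_hom_axioms.intro h)
    fix s t assume "s \<in> carrier G" "t \<in> carrier G"
    then show "multiplier_kernel H \<phi> (h s) (h t) = multiplier_kernel G (\<lambda>g. \<phi> (h g)) s t"
      by (simp add: multiplier_kernel_def)
  qed (rule hc)
  ultimately show "\<exists>\<phi>. finite {g \<in> carrier G. \<phi> g \<noteq> 0} \<and> (\<forall>g\<in>F. cmod (\<phi> g - 1) < \<epsilon>) \<and>
       schur_bound (carrier G) (multiplier_kernel G \<phi>) C"
    using near by (intro exI[of _ "\<lambda>g. \<phi> (h g)"]) auto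
qed

lemma multiplier_kernel_DirProd:
  assumes "group G" "group H" "s \<in> carrier (G \<times>\<times> H)" "t \<in> carrier (G \<times>\<times> H)"
  shows "multiplier_kernel (G \<times>\<times> H) \<phi> s t
    = \<phi> (fst s \<otimes>\<^bsub>G\<^esub> inv\<^bsub>G\<^esub> fst t, snd s \<otimes>\<^bsub>H\<^esub> inv\<^bsub>H\<^esub> snd t)"
proof -
  obtain a b c d where "s = (a, b)" "t = (c, d)"
    by (metis surj_pair)
  then show ?thesis
    using assms by (simp add: multiplier_kernel_def)
qed

text \<open>The tensor product of two multipliers has as its kernel the product of two kernels
  pulled back along the projections, so the Schur bounds multiply.\<close>

lemma multiplier_approx_DirProd:
  assumes G: "group G" and H: "group H" and C: "0 < C" "0 < D"
    and GC: "multiplier_approx G C" and HD: "multiplier_approx H D"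
  shows "multiplier_approx (G \<times>\<times> H) (C * D)"
proof (rule multiplier_approxI)
  fix F :: "('a \<times> 'c) set" and \<epsilon> :: real
  assume F: "finite F" "F \<subseteq> carrier (G \<times>\<times> H)" "\<epsilon> > 0"
  \<comment> \<open>With \<open>a\<close> and \<open>b\<close> the deviations of the two factors
    from 1, the deviation of the product is \<open>a b + a + b\<close>. The bound 1 absorbs one
    factor of \<open>a b\<close>, and three terms below \<open>\<epsilon> / 3\<close>
    remain.\<close>
  define \<delta> where "\<delta> = min 1 (\<epsilon> / 3)"
  have \<delta>: "0 < \<delta>" "\<delta> \<le> 1" "3 * \<delta> \<le> \<epsilon>"
    using F(3) by (auto simp: \<delta>_def)
  have "finite (fst ` F)" "fst ` F \<subseteq> carrier G" "finite (snd ` F)" "snd ` F \<subseteq> carrier H"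
    using F by auto
  note F_proj = this
  obtain \<phi> where \<phi>: "finite {g \<in> carrier G. \<phi> g \<noteq> 0}"
    "\<And>g. g \<in> fst ` F \<Longrightarrow> cmod (\<phi> g - 1) < \<delta>" "schur_bound (carrier G) (multiplier_kernel G \<phi>) C"
    by (rule multiplier_approxD[OF GC F_proj(1,2) \<delta>(1)]) (rule that)
  obtain \<psi> where \<psi>: "finite {h \<in> carrier H. \<psi> h \<noteq> 0}"
    "\<And>h. h \<in> snd ` F \<Longrightarrow> cmod (\<psi> h - 1) < \<delta>" "schur_bound (carrier H) (multiplier_kernel H \<psi>) D"
    by (rule multiplier_approxD[OF HD F_proj(3,4) \<delta>(1)]) (rule that)
  let ?\<chi> = "\<lambda>x. \<phi> (fst x) * \<psi> (snd x)"
  have "{x \<in> carrier (G \<times>\<times> H). ?\<chi> x \<noteq> 0} \<subseteq> {g \<in> carrier G. \<phi> g \<noteq> 0} \<times> {h \<in> carrier H. \<psi> h \<noteq> 0}"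
    by auto
  then have "finite {x \<in> carrier (G \<times>\<times> H). ?\<chi> x \<noteq> 0}"
    using \<phi>(1) \<psi>(1) finite_subset by blast
  moreover have "cmod (?\<chi> x - 1) < \<epsilon>" if "x \<in> F" for x
  proof -
    let ?a = "\<phi> (fst x) - 1" and ?b = "\<psi> (snd x) - 1"
    have ab: "cmod ?a < \<delta>" "cmod ?b < \<delta>"
      using \<phi>(2) \<psi>(2) that by auto
    have "?\<chi> x - 1 = ?a * ?b + ?a + ?b"
      by (simp add: algebra_simps)
    then have "cmod (?\<chi> x - 1) \<le> cmod ?a * cmod ?b + cmod ?a + cmod ?b"
      by (metis norm_triangle_mono norm_mult order_refl)
    also have "\<dots> \<le> 1 * cmod ?b + cmod ?a + cmod ?b"
      using ab \<delta>(2) by (intro add_mono mult_right_mono) auto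
    also have "\<dots> < \<epsilon>"
      using ab \<delta>(3) by simp
    finally show ?thesis .
  qed
  moreover have "schur_bound (carrier (G \<times>\<times> H)) (multiplier_kernel (G \<times>\<times> H) ?\<chi>) (C * D)"
  proof (rule schur_bound_cong[OF schur_bound_mult[OF
        schur_bound_pullback[OF \<phi>(3), where h = fst and X = "carrier (G \<times>\<times> H)"]
        schur_bound_pullback[OF \<psi>(3), where h = snd and X = "carrier (G \<times>\<times> H)"] C(2)]])
    fix s t assume "s \<in> carrier (G \<times>\<times> H)" "t \<in> carrier (G \<times>\<times> H)"
    then show "multiplier_kernel G \<phi> (fst s) (fst t) * multiplier_kernel H \<psi> (snd s) (snd t) = multiplier_kernel (G \<times>\<times> H) ?\<chi> s t"
      by (subst multiplier_kernel_DirProd[OF G H]) (simp_all add: multiplier_kernel_def)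
  qed auto
  ultimately show "\<exists>\<phi>. finite {g \<in> carrier (G \<times>\<times> H). \<phi> g \<noteq> 0} \<and> (\<forall>g\<in>F. cmod (\<phi> g - 1) < \<epsilon>) \<and>
       schur_bound (carrier (G \<times>\<times> H)) (multiplier_kernel (G \<times>\<times> H) \<phi>) (C * D)"
    by (intro exI[of _ ?\<chi>]) blast
qed

text \<open>
  Instead of separating \<open>1\<close> from the closure of the convex set of multipliers \<open>\<phi>\<close> of norm at most
  \<open>a\<close>, restricted to \<open>F\<close>, we take a near-minimiser \<open>p\<close> of the Euclidean distance to \<open>1\<close> on \<open>F\<close>; the
  functional is the inner product with \<open>1 - p\<close>.
\<close>

lemma separating_functional:
  assumes G: "group G" and not: "\<not> multiplier_approx G a" and a: "0 < a"
  obtains F d q where "finite F" "F \<subseteq> carrier G" "0 < q" "q < 1" "(\<Sum>g\<in>F. d g) = 1"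
    "\<And>\<phi> C. finite {g \<in> carrier G. \<phi> g \<noteq> 0} \<Longrightarrow> 0 \<le> C \<Longrightarrow> schur_bound (carrier G) (multiplier_kernel G \<phi>) C
       \<Longrightarrow> cmod (\<Sum>g\<in>F. d g * \<phi> g) \<le> q * C / a"
proof -
  interpret group G by (rule G)
  define K where "K = {\<phi>. finite {g \<in> carrier G. \<phi> g \<noteq> 0} \<and> schur_bound (carrier G) (multiplier_kernel G \<phi>) a}"
  have "\<exists>F \<epsilon>. finite F \<and> F \<subseteq> carrier G \<and> 0 < \<epsilon> \<and> (\<forall>\<phi>\<in>K. \<exists>g\<in>F. \<epsilon> \<le> cmod (\<phi> g - 1))"
  proof (rule ccontr)
    assume none: "\<not> ?thesis"
    have "multiplier_approx G a"
    proof (rule multiplier_approxI)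
      fix F and \<epsilon> :: real
      assume F: "finite F" "F \<subseteq> carrier G" "0 < \<epsilon>"
      have "\<not> (\<forall>\<phi>\<in>K. \<exists>g\<in>F. \<epsilon> \<le> cmod (\<phi> g - 1))"
        by (rule notI, rule notE[OF none]) (intro exI[of _ F] exI[of _ \<epsilon>] conjI F)
      then obtain \<phi> where "\<phi> \<in> K" "\<And>g. g \<in> F \<Longrightarrow> \<not> \<epsilon> \<le> cmod (\<phi> g - 1)"
        unfolding ball_simps bex_simps by (elim bexE) (rule that, assumption, erule bspec)
      then show "\<exists>\<phi>. finite {g \<in> carrier G. \<phi> g \<noteq> 0} \<and> (\<forall>g\<in>F. cmod (\<phi> g - 1) < \<epsilon>) \<and>
          schur_bound (carrier G) (multiplier_kernel G \<phi>) a"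
        unfolding K_def by (intro exI[of _ \<phi>]) (simp add: not_le)
    qed
    with not show False by contradiction
  qed
  then obtain F \<epsilon> where F: "finite F" "F \<subseteq> carrier G" and \<epsilon>: "0 < \<epsilon>"
    and far: "\<And>\<phi>. \<phi> \<in> K \<Longrightarrow> \<exists>g\<in>F. \<epsilon> \<le> cmod (\<phi> g - 1)"
    by (elim exE conjE) (rule that, assumption, assumption, assumption, erule bspec)
  define dst where "dst \<phi> = (\<Sum>g\<in>F. (cmod (\<phi> g - 1))\<^sup>2)" for \<phi> :: "'a \<Rightarrow> complex"
  define D where "D = Inf (dst ` K)"
  have multiplier_kernel_cmult: "multiplier_kernel G (\<lambda>g. c * \<phi> g) = (\<lambda>s t. c * multiplier_kernel G \<phi> s t)" for c \<phi>
    by (simp add: multiplier_kernel_def fun_eq_iff)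
  have multiplier_kernel_add: "multiplier_kernel G (\<lambda>g. \<phi> g + \<psi> g) = (\<lambda>s t. multiplier_kernel G \<phi> s t + multiplier_kernel G \<psi> s t)" for \<phi> \<psi>
    by (simp add: multiplier_kernel_def fun_eq_iff)
  have K_cmult: "(\<lambda>g. c * \<phi> g) \<in> K"
    if \<phi>: "finite {g \<in> carrier G. \<phi> g \<noteq> 0}" "schur_bound (carrier G) (multiplier_kernel G \<phi>) C" "cmod c * C \<le> a" for c C \<phi>
  proof -
    have "finite {g \<in> carrier G. c * \<phi> g \<noteq> 0}"
      by (rule finite_subset[OF _ \<phi>(1)]) auto
    then show ?thesis
      using schur_bound_mono[OF schur_bound_cmult[OF \<phi>(2)] \<phi>(3)] by (simp add: K_def multiplier_kernel_cmult)
  qed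
  have K_convex: "(\<lambda>g. of_real (1 - t) * \<phi> g + of_real t * \<psi> g) \<in> K"
    if "\<phi> \<in> K" "\<psi> \<in> K" "0 \<le> t" "t \<le> 1" for \<phi> \<psi> t
  proof -
    have "finite ({g \<in> carrier G. \<phi> g \<noteq> 0} \<union> {g \<in> carrier G. \<psi> g \<noteq> 0})"
      using that by (simp add: K_def)
    then have "finite {g \<in> carrier G. of_real (1 - t) * \<phi> g + of_real t * \<psi> g \<noteq> 0}"
      by (rule rev_finite_subset) auto
    moreover have "schur_bound (carrier G) (multiplier_kernel G (\<lambda>g. of_real (1 - t) * \<phi> g + of_real t * \<psi> g))
        (cmod (of_real (1 - t)) * a + cmod (of_real t) * a)"
      using that unfolding multiplier_kernel_add multiplier_kernel_cmult K_def by (intro schur_bound_add schur_bound_cmult) auto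
    moreover have "cmod (of_real (1 - t)) * a + cmod (of_real t) * a = a"
      unfolding norm_of_real using that by (simp add: algebra_simps)
    ultimately show ?thesis by (simp add: K_def)
  qed
  have K0: "(\<lambda>g. 0) \<in> K"
    using schur_bound_mono[OF schur_bound_const[of "carrier G" 0], of a] a
    by (simp add: K_def multiplier_kernel_def[abs_def])
  have K_le: "cmod (\<phi> g) \<le> a" if "\<phi> \<in> K" "g \<in> F" for \<phi> g
    using schur_bound_le[of "carrier G" "multiplier_kernel G \<phi>" a g "\<one>\<^bsub>G\<^esub>"] that F(2)
    by (auto simp: K_def multiplier_kernel_def subset_eq)
  have dst_ge: "\<epsilon>\<^sup>2 \<le> dst \<phi>" if \<phi>: "\<phi> \<in> K" for \<phi>
  proof -
    obtain g where "g \<in> F" "\<epsilon> \<le> cmod (\<phi> g - 1)"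
      using far[OF \<phi>] by (elim bexE) (rule that)
    then have "\<epsilon>\<^sup>2 \<le> (cmod (\<phi> g - 1))\<^sup>2" "(cmod (\<phi> g - 1))\<^sup>2 \<le> dst \<phi>"
      unfolding dst_def using \<epsilon> F(1) by (auto intro!: power_mono member_le_sum)
    then show ?thesis by (rule order_trans)
  qed
  have "\<epsilon>\<^sup>2 \<le> D"
    unfolding D_def using K0 dst_ge by (intro cINF_greatest) auto
  then have D: "0 < D" using zero_less_power[OF \<epsilon>, of 2] by linarith
  have D_le: "D \<le> dst \<phi>" if "\<phi> \<in> K" for \<phi>
    unfolding D_def using that dst_ge by (intro cINF_lower bdd_belowI2) auto
  \<comment> \<open>Values of elements of \<open>K\<close> have modulus at most \<open>a\<close>, so
    \<open>M\<close> bounds the squared distance on \<open>F\<close> between any two of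
    them.\<close>
  define M where "M = (\<Sum>g\<in>F. (2 * a)\<^sup>2)"
  have M: "0 \<le> M" unfolding M_def by (simp add: sum_nonneg)
  \<comment> \<open>The infimum \<open>D\<close> need not be attained, so \<open>p\<close> below is
    optimal only up to \<open>t D / 2\<close>. With this step length the quadratic term
    \<open>t^2 M\<close> is at most \<open>t D / 2\<close> as well, and after division by
    \<open>2 t\<close> both errors together cost at most \<open>D / 2\<close>.\<close>
  define t where "t = min 1 (D / (2 * (M + 1)))"
  have t: "0 < t" "t \<le> 1" using D M by (auto simp: t_def)
  have "t * M \<le> D / (2 * (M + 1)) * M"
    unfolding t_def using M by (intro mult_right_mono) auto
  also have "\<dots> \<le> D / 2"
    using M D by (simp add: field_simps)
  finally have tM: "t * M \<le> D / 2" .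
  obtain p where p: "p \<in> K" "dst p < D + t * D / 2"
  proof -
    have "\<exists>x\<in>dst ` K. x < D + t * D / 2"
      unfolding D_def using K0 t D by (intro cInf_lessD) (auto simp: D_def)
    then show ?thesis using that by blast
  qed
  define e where "e g = cnj (1 - p g)" for g
  define H where "H \<phi> = (\<Sum>g\<in>F. e g * \<phi> g)" for \<phi>
  have H_cmult: "H (\<lambda>g. c * \<phi> g) = c * H \<phi>" for c \<phi>
    by (simp add: H_def sum_distrib_left mult.left_commute)
  have H_diff: "H \<phi> - H \<psi> = H (\<lambda>g. \<phi> g - \<psi> g)" for \<phi> \<psi>
    by (simp add: H_def sum_subtractf right_diff_distrib)
  have H1p: "Re (H (\<lambda>g. 1)) - Re (H p) = dst p"
  proof -
    have "Re (H (\<lambda>g. 1) - H p) = (\<Sum>g\<in>F. Re (e g * (1 - p g)))"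
      unfolding H_diff unfolding H_def Re_sum ..
    also have "\<dots> = dst p"
      unfolding dst_def e_def by (intro sum.cong refl) (simp add: cmod_power2, simp add: power2_eq_square algebra_simps)
    finally show ?thesis by simp
  qed
  have H_Re: "Re (H \<phi>) \<le> Re (H (\<lambda>g. 1)) - D / 2" if \<phi>: "\<phi> \<in> K" for \<phi>
  proof -
    \<comment> \<open>A step of length \<open>t\<close> from \<open>p\<close> towards \<phi> stays
      in \<open>K\<close>, so its squared distance is at least \<open>D\<close>. Expanding the
      square gives \<open>Re (H \<phi> - H p) \<le> D / 2\<close>, whereas the constant function 1
      in place of \<phi> gives at least \<open>D\<close>.\<close>
    let ?c = "\<lambda>g. of_real (1 - t) * p g + of_real t * \<phi> g"
    have "D \<le> dst ?c"
      by (rule D_le[OF K_convex[OF p(1) \<phi>]]) (use t in auto)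
    also have "dst ?c = (\<Sum>g\<in>F. (cmod (p g - 1))\<^sup>2 - 2 * t * Re (e g * (\<phi> g - p g)) + t\<^sup>2 * (cmod (\<phi> g - p g))\<^sup>2)"
      unfolding dst_def e_def
      by (intro sum.cong refl) (simp add: cmod_power2, simp add: power2_eq_square algebra_simps)
    also have "\<dots> = dst p - 2 * t * Re (H \<phi> - H p) + t\<^sup>2 * (\<Sum>g\<in>F. (cmod (\<phi> g - p g))\<^sup>2)"
      unfolding H_diff
      by (simp only: H_def dst_def sum.distrib sum_subtractf sum_distrib_left Re_sum)
    also have "\<dots> \<le> dst p - 2 * t * Re (H \<phi> - H p) + t\<^sup>2 * M"
    proof -
      have "cmod (\<phi> g - p g) \<le> 2 * a" if "g \<in> F" for g
        using norm_triangle_ineq4[of "\<phi> g" "p g"] K_le[OF \<phi> that] K_le[OF p(1) that] by simp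
      then show ?thesis
        unfolding M_def by (intro add_left_mono mult_left_mono sum_mono power_mono) auto
    qed
    finally have "2 * t * Re (H \<phi> - H p) \<le> dst p - D + t * (t * M)"
      by (simp add: power2_eq_square)
    also have "\<dots> \<le> t * D / 2 + t * (D / 2)"
      using p(2) tM t by (intro add_mono mult_left_mono) auto
    finally have "t * (2 * Re (H \<phi> - H p)) \<le> t * D"
      by (simp only: mult.commute mult.left_commute mult.assoc) simp
    then have "2 * Re (H \<phi> - H p) \<le> D" using t(1) by simp
    then show ?thesis using H1p D_le[OF p(1)] by simp
  qed
  define R where "R = Re (H (\<lambda>g. 1)) - D / 2"
  have H_bound: "cmod (H \<phi>) \<le> R" if \<phi>: "\<phi> \<in> K" for \<phi>
  proof (cases "H \<phi> = 0")
    case True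
    then show ?thesis using H_Re[OF \<phi>] by (simp add: R_def)
  next
    case False
    \<comment> \<open>\<open>K\<close> is invariant under scalars of modulus 1, which turns the
      bound on the real part into a bound on the modulus.\<close>
    let ?c = "cnj (sgn (H \<phi>))"
    have "(\<lambda>g. ?c * \<phi> g) \<in> K"
      using \<phi> False by (intro K_cmult[of _ a]) (auto simp: K_def norm_sgn)
    from H_Re[OF this] have "Re (?c * H \<phi>) \<le> R" by (simp add: H_cmult R_def)
    moreover have "?c * H \<phi> = of_real (cmod (H \<phi>))"
      using False by (simp add: sgn_eq complex_norm_square[symmetric] mult.commute power2_eq_square)
    ultimately show ?thesis by simp
  qed
  have R: "0 \<le> R" using H_bound[OF K0] norm_ge_zero order_trans by blast
  define N where "N = cmod (H (\<lambda>g. 1))"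
  have N: "R + D / 2 \<le> N"
    unfolding N_def R_def using complex_Re_le_cmod[of "H (\<lambda>g. 1)"] by simp
  \<comment> \<open>\<open>R + D / 4\<close> lies strictly between \<open>R\<close> and
    \<open>N\<close> and is positive even if \<open>R = 0\<close>, so the ratio lies strictly
    between 0 and 1.\<close>
  define q where "q = (R + D / 4) / N"
  have q: "0 < q" "q < 1" "R \<le> q * N" using R D N by (auto simp: q_def)
  define d where "d g = e g / H (\<lambda>g. 1)" for g
  have d_sum: "(\<Sum>g\<in>F. d g * \<phi> g) = H \<phi> / H (\<lambda>g. 1)" for \<phi>
    by (simp add: d_def H_def sum_divide_distrib)
  have N0: "0 < N" using N R D by simp
  show thesis
  proof (rule that[OF F q(1,2), of d])
    show "(\<Sum>g\<in>F. d g) = 1"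
      using d_sum[of "\<lambda>g. 1"] N0 by (simp add: N_def)
    fix \<phi> C
    assume \<phi>: "finite {g \<in> carrier G. \<phi> g \<noteq> 0}" "schur_bound (carrier G) (multiplier_kernel G \<phi>) C" and C: "0 \<le> C"
    define Z where "Z = cmod (\<Sum>g\<in>F. d g * \<phi> g)"
    \<comment> \<open>\<open>C\<close> may be 0, so \<phi> is scaled by \<open>a / E\<close> for
      every \<open>E > C\<close> and the bound is passed to the limit.\<close>
    have "Z \<le> q * E / a" if "C < E" for E
    proof -
      have E: "0 < E" using C that by simp
      have "(\<lambda>g. of_real (a / E) * \<phi> g) \<in> K"
        using K_cmult[OF \<phi>(1) schur_bound_mono[OF \<phi>(2)], of E "of_real (a / E)"] that E a
        by (simp add: norm_divide)
      from H_bound[OF this] have "a / E * cmod (H \<phi>) \<le> q * N"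
        using q(3) E a unfolding H_cmult norm_mult norm_of_real by simp
      then show ?thesis
        using N0 E a unfolding Z_def d_sum norm_divide N_def[symmetric] by (simp add: field_simps)
    qed
    then have "Z * a / q \<le> E" if "C < E" for E
      using that a q(1) by (simp add: field_simps)
    then have "Z * a / q \<le> C"
      by (rule dense_ge)
    then show "cmod (\<Sum>g\<in>F. d g * \<phi> g) \<le> q * C / a"
      using a q(1) unfolding Z_def[symmetric] by (simp add: field_simps)
  qed
qed


text \<open>Tested against \<open>z\<close>, \<open>w\<close>, \<open>w'\<close>, the slice gives
  the form of the original multiplier at the Kronecker product of \<open>x\<close> and
  \<open>z\<close> and at the product vectors built from \<open>u\<close>, \<open>w\<close> and from
  \<open>v\<close>, \<open>w'\<close>. The norms of product vectors factor, which explains the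
  constant.\<close>

lemma schur_bound_slice:
  assumes G: "group G" and H: "group H"
    and schur: "schur_bound (carrier (G \<times>\<times> H)) (multiplier_kernel (G \<times>\<times> H) \<phi>) C"
    and I: "finite I" and p: "\<And>i. i \<in> I \<Longrightarrow> p i \<in> carrier G" and x: "form_bound I x 1"
  shows "schur_bound (carrier H)
    (multiplier_kernel H (\<lambda>h. \<Sum>i\<in>I. \<Sum>j\<in>I. \<phi> (p i \<otimes>\<^bsub>G\<^esub> inv\<^bsub>G\<^esub> p j, h) * x i j * u i * v j))
    (C * L2_set (\<lambda>i. cmod (u i)) I * L2_set (\<lambda>j. cmod (v j)) I)"
proof (rule schur_boundI)
  fix J :: "nat set" and q z
  assume J: "finite J" and q: "\<And>k. k \<in> J \<Longrightarrow> q k \<in> carrier H" and z: "form_bound J z 1"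
  let ?U = "L2_set (\<lambda>i. cmod (u i)) I" and ?V = "L2_set (\<lambda>j. cmod (v j)) I"
  let ?pq = "\<lambda>m. (p (fst m), q (snd m))"
  let ?xz = "\<lambda>m n. x (fst m) (fst n) * z (snd m) (snd n)"
  let ?\<Phi> = "\<lambda>i j k l. \<phi> (p i \<otimes>\<^bsub>G\<^esub> inv\<^bsub>G\<^esub> p j, q k \<otimes>\<^bsub>H\<^esub> inv\<^bsub>H\<^esub> q l)"
  have IJ: "form_bound (I \<times> J) (\<lambda>m n. multiplier_kernel (G \<times>\<times> H) \<phi> (?pq m) (?pq n) * ?xz m n) C"
    using I J p q by (intro schur_boundD1[OF schur] form_bound_kronecker x z) auto
  have tensor: "L2_set (\<lambda>m. cmod (f (fst m) * g (snd m))) (I \<times> J)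
      = L2_set (\<lambda>i. cmod (f i)) I * L2_set (\<lambda>k. cmod (g k)) J" for f :: "'e \<Rightarrow> complex" and g
  proof -
    have "(\<Sum>m\<in>I \<times> J. (cmod (f (fst m) * g (snd m)))\<^sup>2) = (\<Sum>i\<in>I. \<Sum>k\<in>J. (cmod (f i))\<^sup>2 * (cmod (g k))\<^sup>2)"
      by (simp only: sum.cartesian_product case_prod_unfold norm_mult power_mult_distrib)
    then show ?thesis
      by (simp add: L2_set_def real_sqrt_mult[symmetric] sum_product)
  qed
  show "form_bound J (\<lambda>k l. multiplier_kernel H (\<lambda>h. \<Sum>i\<in>I. \<Sum>j\<in>I. \<phi> (p i \<otimes>\<^bsub>G\<^esub> inv\<^bsub>G\<^esub> p j, h) * x i j * u i * v j) (q k) (q l)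
      * z k l) (C * ?U * ?V)"
    unfolding form_bound_def
  proof (intro allI)
    fix w w'
    let ?f = "\<lambda>i j k l. ?\<Phi> i j k l * (x i j * z k l) * (u i * w k) * (v j * w' l)"
    have "(\<Sum>k\<in>J. \<Sum>l\<in>J. multiplier_kernel H (\<lambda>h. \<Sum>i\<in>I. \<Sum>j\<in>I. \<phi> (p i \<otimes>\<^bsub>G\<^esub> inv\<^bsub>G\<^esub> p j, h) * x i j * u i * v j) (q k) (q l)
        * z k l * w k * w' l) = (\<Sum>k\<in>J. \<Sum>l\<in>J. \<Sum>i\<in>I. \<Sum>j\<in>I. ?f i j k l)"
      unfolding multiplier_kernel_def sum_distrib_right by (intro sum.cong refl) (simp only: mult_ac)
    also have "\<dots> = (\<Sum>k\<in>J. \<Sum>i\<in>I. \<Sum>l\<in>J. \<Sum>j\<in>I. ?f i j k l)"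
      by (intro sum.cong refl sum.swap)
    also have "\<dots> = (\<Sum>i\<in>I. \<Sum>k\<in>J. \<Sum>l\<in>J. \<Sum>j\<in>I. ?f i j k l)"
      by (rule sum.swap)
    also have "\<dots> = (\<Sum>i\<in>I. \<Sum>k\<in>J. \<Sum>j\<in>I. \<Sum>l\<in>J. ?f i j k l)"
      by (intro sum.cong refl sum.swap)
    also have "\<dots> = (\<Sum>m\<in>I \<times> J. \<Sum>n\<in>I \<times> J. ?f (fst m) (fst n) (snd m) (snd n))"
      by (simp only: sum.cartesian_product' fst_conv snd_conv)
    also have "\<dots> = (\<Sum>m\<in>I \<times> J. \<Sum>n\<in>I \<times> J. multiplier_kernel (G \<times>\<times> H) \<phi> (?pq m) (?pq n) * ?xz m n
        * (u (fst m) * w (snd m)) * (v (fst n) * w' (snd n)))"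
    proof (intro sum.cong refl)
      fix m n assume "m \<in> I \<times> J" "n \<in> I \<times> J"
      then have "?pq m \<in> carrier (G \<times>\<times> H)" "?pq n \<in> carrier (G \<times>\<times> H)"
        using p q by auto
      from multiplier_kernel_DirProd[OF G H this, of \<phi>]
      show "?f (fst m) (fst n) (snd m) (snd n) = multiplier_kernel (G \<times>\<times> H) \<phi> (?pq m) (?pq n) * ?xz m n
        * (u (fst m) * w (snd m)) * (v (fst n) * w' (snd n))"
        by simp
    qed
    finally show "cmod (\<Sum>k\<in>J. \<Sum>l\<in>J. multiplier_kernel H (\<lambda>h. \<Sum>i\<in>I. \<Sum>j\<in>I. \<phi> (p i \<otimes>\<^bsub>G\<^esub> inv\<^bsub>G\<^esub> p j, h) * x i j * u i * v j) (q k) (q l)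
        * z k l * w k * w' l) \<le> C * ?U * ?V * L2_set (\<lambda>i. cmod (w i)) J * L2_set (\<lambda>j. cmod (w' j)) J"
      using form_boundD[OF IJ, of "\<lambda>m. u (fst m) * w (snd m)" "\<lambda>n. v (fst n) * w' (snd n)"]
      unfolding tensor by (simp only: mult_ac)
  qed
qed

text \<open>The functional \<open>e\<close> in the second variable turns \<phi> into \<psi> on
  \<open>G\<close>. Its bound is \<open>r a\<close>: slices of \<phi> have bound \<open>a b\<close>
  times the norms of the test vectors, and \<open>e\<close> contributes the factor
  \<open>r / b\<close>. Then \<open>d\<close> gives a value of modulus at most
  \<open>q r < 1\<close>, whereas closeness of \<phi> to 1 on \<open>F \<times> E\<close> forces a
  value close to 1.\<close>

lemma not_multiplier_approx_DirProd:
  assumes G: "group G" and H: "group H" and ab: "0 < a" "0 < b"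
    and not_G: "\<not> multiplier_approx G a" and not_H: "\<not> multiplier_approx H b"
  shows "\<not> multiplier_approx (G \<times>\<times> H) (a * b)"
proof
  assume GH: "multiplier_approx (G \<times>\<times> H) (a * b)"
  obtain F d q where F: "finite F" "F \<subseteq> carrier G" "0 < q" "q < 1" "(\<Sum>g\<in>F. d g) = 1"
    and d: "\<And>\<phi> C. finite {g \<in> carrier G. \<phi> g \<noteq> 0} \<Longrightarrow> 0 \<le> C \<Longrightarrow> schur_bound (carrier G) (multiplier_kernel G \<phi>) C
       \<Longrightarrow> cmod (\<Sum>g\<in>F. d g * \<phi> g) \<le> q * C / a"
    by (rule separating_functional[OF G not_G ab(1)]) (rule that)
  obtain E e r where E: "finite E" "E \<subseteq> carrier H" "0 < r" "r < 1" "(\<Sum>h\<in>E. e h) = 1"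
    and e: "\<And>\<phi> C. finite {h \<in> carrier H. \<phi> h \<noteq> 0} \<Longrightarrow> 0 \<le> C \<Longrightarrow> schur_bound (carrier H) (multiplier_kernel H \<phi>) C
       \<Longrightarrow> cmod (\<Sum>h\<in>E. e h * \<phi> h) \<le> r * C / b"
    by (rule separating_functional[OF H not_H ab(2)]) (rule that)
  have qr: "q * r < 1"
    using mult_strict_mono[of q 1 r 1] F E by simp
  \<comment> \<open>The l^1-norm of the tensor product functional: it converts pointwise closeness
    of \<phi> to 1 into closeness of the value. Below, \<open>S + 1\<close> avoids division by
    zero.\<close>
  define S where "S = (\<Sum>g\<in>F. \<Sum>h\<in>E. cmod (d g) * cmod (e h))"
  have S: "0 \<le> S" unfolding S_def by (intro sum_nonneg) auto
  define \<epsilon> where "\<epsilon> = (1 - q * r) / (S + 1)"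
  have \<epsilon>: "0 < \<epsilon>" using S qr by (simp add: \<epsilon>_def)
  have \<epsilon>S: "\<epsilon> * S < 1 - q * r" using S qr by (simp add: \<epsilon>_def field_simps)
  have FE: "finite (F \<times> E)" "F \<times> E \<subseteq> carrier (G \<times>\<times> H)"
    using F E by auto
  obtain \<phi> where \<phi>: "finite {x \<in> carrier (G \<times>\<times> H). \<phi> x \<noteq> 0}"
    "\<And>x. x \<in> F \<times> E \<Longrightarrow> cmod (\<phi> x - 1) < \<epsilon>"
    "schur_bound (carrier (G \<times>\<times> H)) (multiplier_kernel (G \<times>\<times> H) \<phi>) (a * b)"
    by (rule multiplier_approxD[OF GH FE \<epsilon>]) (rule that)
  define \<psi> where "\<psi> g = (\<Sum>h\<in>E. e h * \<phi> (g, h))" for g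
  have "{g \<in> carrier G. \<psi> g \<noteq> 0} \<subseteq> fst ` {x \<in> carrier (G \<times>\<times> H). \<phi> x \<noteq> 0}"
  proof
    fix g assume g: "g \<in> {g \<in> carrier G. \<psi> g \<noteq> 0}"
    then have "(\<Sum>h\<in>E. e h * \<phi> (g, h)) \<noteq> 0"
      by (simp add: \<psi>_def)
    then obtain h where "h \<in> E" "e h * \<phi> (g, h) \<noteq> 0"
      by (rule sum.not_neutral_contains_not_neutral)
    then show "g \<in> fst ` {x \<in> carrier (G \<times>\<times> H). \<phi> x \<noteq> 0}"
      using g E(2) by (intro image_eqI[of _ _ "(g, h)"]) auto
  qed
  then have \<psi>_fin: "finite {g \<in> carrier G. \<psi> g \<noteq> 0}"
    using \<phi>(1) by (meson finite_imageI finite_subset)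
  have \<psi>_schur: "schur_bound (carrier G) (multiplier_kernel G \<psi>) (r * a)"
  proof (rule schur_boundI)
    fix I :: "nat set" and p x
    assume I: "finite I" and p: "\<And>i. i \<in> I \<Longrightarrow> p i \<in> carrier G" and x: "form_bound I x 1"
    show "form_bound I (\<lambda>i j. multiplier_kernel G \<psi> (p i) (p j) * x i j) (r * a)"
      unfolding form_bound_def
    proof (intro allI)
      fix u v
      let ?U = "L2_set (\<lambda>i. cmod (u i)) I" and ?V = "L2_set (\<lambda>j. cmod (v j)) I"
      \<comment> \<open>Applying \<open>e\<close> commutes with testing against \<open>x\<close>,
        \<open>u\<close>, \<open>v\<close>, so the form of \<psi> is \<open>e\<close> evaluated at
        the slice \<theta>.\<close>
      define \<theta> where "\<theta> h = (\<Sum>i\<in>I. \<Sum>j\<in>I. \<phi> (p i \<otimes>\<^bsub>G\<^esub> inv\<^bsub>G\<^esub> p j, h) * x i j * u i * v j)" for h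
      have "{h \<in> carrier H. \<theta> h \<noteq> 0} \<subseteq> snd ` {x \<in> carrier (G \<times>\<times> H). \<phi> x \<noteq> 0}"
      proof
        fix h assume h: "h \<in> {h \<in> carrier H. \<theta> h \<noteq> 0}"
        then have "(\<Sum>i\<in>I. \<Sum>j\<in>I. \<phi> (p i \<otimes>\<^bsub>G\<^esub> inv\<^bsub>G\<^esub> p j, h) * x i j * u i * v j) \<noteq> 0"
          by (simp add: \<theta>_def)
        then obtain i where i: "i \<in> I"
          and "(\<Sum>j\<in>I. \<phi> (p i \<otimes>\<^bsub>G\<^esub> inv\<^bsub>G\<^esub> p j, h) * x i j * u i * v j) \<noteq> 0"
          by (rule sum.not_neutral_contains_not_neutral)
        then obtain j where j: "j \<in> I" "\<phi> (p i \<otimes>\<^bsub>G\<^esub> inv\<^bsub>G\<^esub> p j, h) * x i j * u i * v j \<noteq> 0"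
          by (elim sum.not_neutral_contains_not_neutral) (rule that)
        moreover have "p i \<otimes>\<^bsub>G\<^esub> inv\<^bsub>G\<^esub> p j \<in> carrier G"
          using G i j(1) p by (simp add: group.is_monoid monoid.m_closed)
        ultimately show "h \<in> snd ` {x \<in> carrier (G \<times>\<times> H). \<phi> x \<noteq> 0}"
          using h by (intro image_eqI[of _ _ "(p i \<otimes>\<^bsub>G\<^esub> inv\<^bsub>G\<^esub> p j, h)"]) auto
      qed
      then have "finite {h \<in> carrier H. \<theta> h \<noteq> 0}"
        using \<phi>(1) by (meson finite_imageI finite_subset)
      moreover have "schur_bound (carrier H) (multiplier_kernel H \<theta>) (a * b * ?U * ?V)"
        unfolding \<theta>_def by (rule schur_bound_slice[OF G H \<phi>(3) I p x])
      ultimately have "cmod (\<Sum>h\<in>E. e h * \<theta> h) \<le> r * (a * b * ?U * ?V) / b"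
        using ab by (intro e) auto
      also have "\<dots> = r * a * ?U * ?V" using ab by simp
      also have "(\<Sum>h\<in>E. e h * \<theta> h) = (\<Sum>i\<in>I. \<Sum>h\<in>E. \<Sum>j\<in>I. e h * (\<phi> (p i \<otimes>\<^bsub>G\<^esub> inv\<^bsub>G\<^esub> p j, h) * x i j * u i * v j))"
        unfolding \<theta>_def sum_distrib_left by (rule sum.swap)
      also have "\<dots> = (\<Sum>i\<in>I. \<Sum>j\<in>I. \<Sum>h\<in>E. e h * (\<phi> (p i \<otimes>\<^bsub>G\<^esub> inv\<^bsub>G\<^esub> p j, h) * x i j * u i * v j))"
        by (intro sum.cong refl sum.swap)
      also have "\<dots> = (\<Sum>i\<in>I. \<Sum>j\<in>I. multiplier_kernel G \<psi> (p i) (p j) * x i j * u i * v j)"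
        unfolding multiplier_kernel_def \<psi>_def sum_distrib_right by (simp only: mult.assoc)
      finally show "cmod (\<Sum>i\<in>I. \<Sum>j\<in>I. multiplier_kernel G \<psi> (p i) (p j) * x i j * u i * v j) \<le> r * a * ?U * ?V" .
    qed
  qed
  have le: "cmod (\<Sum>g\<in>F. d g * \<psi> g) \<le> q * r"
    using d[OF \<psi>_fin _ \<psi>_schur] E(3) ab by simp
  have "(\<Sum>g\<in>F. d g * \<psi> g) - 1 = (\<Sum>g\<in>F. d g * \<psi> g) - (\<Sum>g\<in>F. d g * (\<Sum>h\<in>E. e h))"
    using F(5) E(5) by simp
  also have "\<dots> = (\<Sum>g\<in>F. \<Sum>h\<in>E. d g * e h * (\<phi> (g, h) - 1))"
    unfolding \<psi>_def sum_subtractf[symmetric] sum_distrib_left by (intro sum.cong refl) (simp add: algebra_simps)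
  also have "cmod \<dots> \<le> (\<Sum>g\<in>F. \<Sum>h\<in>E. cmod (d g) * cmod (e h) * \<epsilon>)"
  proof (intro sum_norm_le)
    fix g h assume "g \<in> F" "h \<in> E"
    then show "cmod (d g * e h * (\<phi> (g, h) - 1)) \<le> cmod (d g) * cmod (e h) * \<epsilon>"
      using \<phi>(2)[of "(g, h)"] unfolding norm_mult by (intro mult_left_mono) auto
  qed
  also have "\<dots> = \<epsilon> * S"
    unfolding S_def sum_distrib_left mult.commute[of \<epsilon>] ..
  finally have "cmod ((\<Sum>g\<in>F. d g * \<psi> g) - 1) < 1 - q * r"
    using \<epsilon>S by simp
  then show False
    using le norm_triangle_ineq2[of 1 "\<Sum>g\<in>F. d g * \<psi> g"] by (simp add: norm_minus_commute)
qed

section \<open>Operators on square summable functions\<close>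

text \<open>Reduces membership in \<open>ell2 X\<close> and norm bounds to finite subsets, where the
  estimates for finite matrices apply.\<close>

lemma ell2_L2_bound:
  assumes "\<And>x. x \<notin> X \<Longrightarrow> f x = 0" "\<And>F. finite F \<Longrightarrow> F \<subseteq> X \<Longrightarrow> L2_set (\<lambda>x. cmod (f x)) F \<le> B"
  shows "f \<in> ell2 X" "l2_norm X f \<le> B"
proof -
  have B: "0 \<le> B" using assms(2)[of "{}"] by simp
  have sq: "(\<Sum>x\<in>F. (cmod (f x))\<^sup>2) \<le> B\<^sup>2" if "finite F" "F \<subseteq> X" for F
    using power_mono[OF assms(2)[OF that], of 2] by (simp add: L2_set_sq)
  have sum: "(\<lambda>x. (cmod (f x))\<^sup>2) summable_on X"
    by (rule nonneg_bdd_above_summable_on) (use sq in \<open>auto intro!: bdd_aboveI2\<close>)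
  then show "f \<in> ell2 X" using assms(1) by (simp add: ell2_def)
  have "(\<Sum>\<^sub>\<infinity>x\<in>X. (cmod (f x))\<^sup>2) \<le> B\<^sup>2"
    by (rule infsum_le_finite_sums[OF sum sq])
  then show "l2_norm X f \<le> B"
    unfolding l2_norm_def using real_sqrt_le_mono B by fastforce
qed

lemma ell2_outside: "f \<in> ell2 X \<Longrightarrow> x \<notin> X \<Longrightarrow> f x = 0"
  by (simp add: ell2_def)

lemma ell2_summable: "f \<in> ell2 X \<Longrightarrow> (\<lambda>x. (cmod (f x))\<^sup>2) summable_on X"
  by (simp add: ell2_def)

lemma l2_norm_nonneg [simp]: "0 \<le> l2_norm X f"
  by (simp add: l2_norm_def infsum_nonneg)

lemma l2_norm_sq: "(l2_norm X f)\<^sup>2 = (\<Sum>\<^sub>\<infinity>x\<in>X. (cmod (f x))\<^sup>2)"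
  by (simp add: l2_norm_def infsum_nonneg)

lemma L2_set_le_l2_norm:
  assumes "f \<in> ell2 X" "finite F" "F \<subseteq> X"
  shows "L2_set (\<lambda>x. cmod (f x)) F \<le> l2_norm X f"
  unfolding L2_set_def l2_norm_def
  by (intro real_sqrt_le_mono finite_sum_le_infsum ell2_summable assms) simp

lemma cmod_le_l2_norm:
  assumes "f \<in> ell2 X"
  shows "cmod (f x) \<le> l2_norm X f"
  using L2_set_le_l2_norm[OF assms, of "{x}"] ell2_outside[OF assms, of x] by (cases "x \<in> X") (auto simp: L2_set_def)

lemma ell2_zero [simp]: "(\<lambda>x. 0) \<in> ell2 X"
  by (simp add: ell2_def)

lemma l2_norm_zero [simp]: "l2_norm X (\<lambda>x. 0) = 0"
  by (simp add: l2_norm_def)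

lemma ell2_add:
  assumes "f \<in> ell2 X" "g \<in> ell2 X"
  shows "(\<lambda>x. f x + g x) \<in> ell2 X" "l2_norm X (\<lambda>x. f x + g x) \<le> l2_norm X f + l2_norm X g"
proof -
  have "L2_set (\<lambda>x. cmod (f x + g x)) F \<le> l2_norm X f + l2_norm X g" if "finite F" "F \<subseteq> X" for F
  proof -
    have "L2_set (\<lambda>x. cmod (f x + g x)) F \<le> L2_set (\<lambda>x. cmod (f x) + cmod (g x)) F"
      by (rule L2_set_mono) (auto simp: norm_triangle_ineq)
    also have "\<dots> \<le> L2_set (\<lambda>x. cmod (f x)) F + L2_set (\<lambda>x. cmod (g x)) F"
      by (rule L2_set_triangle_ineq)
    also have "\<dots> \<le> l2_norm X f + l2_norm X g"
      by (intro add_mono L2_set_le_l2_norm assms that)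
    finally show ?thesis .
  qed
  note * = ell2_L2_bound[of X "\<lambda>x. f x + g x", OF _ this]
  show "(\<lambda>x. f x + g x) \<in> ell2 X" "l2_norm X (\<lambda>x. f x + g x) \<le> l2_norm X f + l2_norm X g"
    by (rule *; simp add: ell2_outside[OF assms(1)] ell2_outside[OF assms(2)])+
qed

lemma l2_norm_cmult: "l2_norm X (\<lambda>x. c * f x) = cmod c * l2_norm X f"
  unfolding l2_norm_def by (simp add: norm_mult power_mult_distrib infsum_cmult_right' real_sqrt_mult)

lemma ell2_cmult:
  assumes "f \<in> ell2 X"
  shows "(\<lambda>x. c * f x) \<in> ell2 X"
  using assms by (auto simp: ell2_def norm_mult power_mult_distrib intro: summable_on_cmult_right)

lemma ell2_diff:
  assumes "f \<in> ell2 X" "g \<in> ell2 X"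
  shows "(\<lambda>x. f x - g x) \<in> ell2 X"
  using ell2_add(1)[OF assms(1) ell2_cmult[OF assms(2), of "-1"]] by simp

lemma ell2_sum:
  assumes "\<And>i. i \<in> I \<Longrightarrow> f i \<in> ell2 X"
  shows "(\<lambda>x. \<Sum>i\<in>I. f i x) \<in> ell2 X"
  using assms by (induction I rule: infinite_finite_induct) (auto intro: ell2_add)

lemma ell2_finite_support:
  assumes "finite F" "F \<subseteq> X" "\<And>x. x \<notin> F \<Longrightarrow> f x = 0"
  shows "f \<in> ell2 X" "l2_norm X f = L2_set (\<lambda>x. cmod (f x)) F"
proof -
  have "((\<lambda>x. (cmod (f x))\<^sup>2) has_sum (\<Sum>x\<in>F. (cmod (f x))\<^sup>2)) X"
    by (rule has_sum_finite_neutralI[OF assms(1,2)]) (use assms(3) in auto)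
  then show "f \<in> ell2 X" "l2_norm X f = L2_set (\<lambda>x. cmod (f x)) F"
    using assms by (auto simp: ell2_def l2_norm_def L2_set_def infsumI dest: has_sum_imp_summable)
qed

section \<open>Point masses and truncation to finite sets\<close>

definition delta :: "'x \<Rightarrow> 'x vec" where
  "delta y = (\<lambda>x. if x = y then 1 else 0)"

lemma delta_ell2 [simp]: "y \<in> X \<Longrightarrow> delta y \<in> ell2 X"
  by (rule ell2_finite_support[of "{y}"]) (auto simp: delta_def)

lemma l2_norm_delta: "y \<in> X \<Longrightarrow> l2_norm X (delta y) = 1"
  by (subst ell2_finite_support[of "{y}"]) (auto simp: delta_def)

definition truncate :: "'x set \<Rightarrow> 'x vec \<Rightarrow> 'x vec" where
  "truncate F f = (\<lambda>x. if x \<in> F then f x else 0)"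

lemma truncate_ell2: "finite F \<Longrightarrow> F \<subseteq> X \<Longrightarrow> truncate F f \<in> ell2 X"
  by (rule ell2_finite_support[of F]) (auto simp: truncate_def)

lemma l2_norm_truncate: "finite F \<Longrightarrow> F \<subseteq> X \<Longrightarrow> l2_norm X (truncate F f) = L2_set (\<lambda>x. cmod (f x)) F"
  by (subst ell2_finite_support[of F]) (auto simp: truncate_def intro: L2_set_cong)

text \<open>The squared norm of the tail is the full sum minus a finite partial sum.\<close>

lemma tendsto_l2_norm_truncate:
  assumes f: "f \<in> ell2 X"
  shows "((\<lambda>F. l2_norm X (\<lambda>x. f x - truncate F f x)) \<longlongrightarrow> 0) (finite_subsets_at_top X)"
proof -
  let ?s = "\<lambda>x. (cmod (f x))\<^sup>2"
  have "(sum ?s \<longlongrightarrow> (l2_norm X f)\<^sup>2) (finite_subsets_at_top X)"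
    using has_sum_infsum[OF ell2_summable[OF f]] unfolding has_sum_def l2_norm_sq .
  then have "((\<lambda>F. sqrt ((l2_norm X f)\<^sup>2 - sum ?s F)) \<longlongrightarrow> sqrt ((l2_norm X f)\<^sup>2 - (l2_norm X f)\<^sup>2))
      (finite_subsets_at_top X)"
    by (intro tendsto_intros)
  moreover have "\<forall>\<^sub>F F in finite_subsets_at_top X.
      sqrt ((l2_norm X f)\<^sup>2 - sum ?s F) = l2_norm X (\<lambda>x. f x - truncate F f x)"
  proof (rule eventually_finite_subsets_at_top_weakI)
    fix F assume F: "finite F" "F \<subseteq> X"
    have "(\<Sum>\<^sub>\<infinity>x\<in>X. (cmod (f x - truncate F f x))\<^sup>2) = (\<Sum>\<^sub>\<infinity>x\<in>X - F. ?s x)"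
      by (rule infsum_cong_neutral) (auto simp: truncate_def)
    also have "\<dots> = (l2_norm X f)\<^sup>2 - sum ?s F"
      unfolding l2_norm_sq using F ell2_summable[OF f] by (subst infsum_Diff) auto
    finally show "sqrt ((l2_norm X f)\<^sup>2 - sum ?s F) = l2_norm X (\<lambda>x. f x - truncate F f x)"
      by (simp add: l2_norm_def)
  qed
  ultimately show ?thesis
    by (simp add: tendsto_cong)
qed

section \<open>The inner product\<close>

lemma l2_inner_summable:
  assumes "f \<in> ell2 X" "g \<in> ell2 X"
  shows "(\<lambda>x. f x * cnj (g x)) summable_on X"
    and "cmod (l2_inner X f g) \<le> l2_norm X f * l2_norm X g"
proof -
  have bound: "(\<Sum>x\<in>F. cmod (f x * cnj (g x))) \<le> l2_norm X f * l2_norm X g" if F: "finite F" "F \<subseteq> X" for F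
  proof -
    have "(\<Sum>x\<in>F. cmod (f x * cnj (g x))) = (\<Sum>x\<in>F. \<bar>cmod (f x)\<bar> * \<bar>cmod (g x)\<bar>)"
      by (simp add: norm_mult)
    also have "\<dots> \<le> L2_set (\<lambda>x. cmod (f x)) F * L2_set (\<lambda>x. cmod (g x)) F"
      by (rule L2_set_mult_ineq)
    also have "\<dots> \<le> l2_norm X f * l2_norm X g"
      by (intro mult_mono L2_set_le_l2_norm assms F) auto
    finally show ?thesis .
  qed
  have abs: "(\<lambda>x. cmod (f x * cnj (g x))) summable_on X"
    by (rule nonneg_bdd_above_summable_on) (use bound in \<open>auto intro!: bdd_aboveI2\<close>)
  then show "(\<lambda>x. f x * cnj (g x)) summable_on X"
    by (rule abs_summable_summable)
  have "cmod (l2_inner X f g) \<le> (\<Sum>\<^sub>\<infinity>x\<in>X. cmod (f x * cnj (g x)))"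
    unfolding l2_inner_def by (rule norm_infsum_bound[OF abs])
  also have "\<dots> \<le> l2_norm X f * l2_norm X g"
    by (rule infsum_le_finite_sums[OF abs bound])
  finally show "cmod (l2_inner X f g) \<le> l2_norm X f * l2_norm X g" .
qed

lemma l2_inner_add:
  assumes "f \<in> ell2 X" "g \<in> ell2 X" "h \<in> ell2 X"
  shows "l2_inner X (\<lambda>x. f x + g x) h = l2_inner X f h + l2_inner X g h"
  unfolding l2_inner_def distrib_right
  by (intro infsum_add l2_inner_summable assms)

lemma l2_inner_cmult: "l2_inner X (\<lambda>x. c * f x) g = c * l2_inner X f g"
  unfolding l2_inner_def by (simp add: infsum_cmult_right' mult.assoc)

lemma l2_inner_diff:
  assumes "f \<in> ell2 X" "g \<in> ell2 X" "h \<in> ell2 X"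
  shows "l2_inner X (\<lambda>x. f x - g x) h = l2_inner X f h - l2_inner X g h"
  using l2_inner_add[OF assms(1) ell2_cmult[OF assms(2), of "-1"] assms(3)]
    l2_inner_cmult[of X "-1" g h] by simp

lemma l2_inner_commute: "l2_inner X f g = cnj (l2_inner X g f)"
  unfolding l2_inner_def by (subst infsum_cnj[symmetric]) (simp add: mult.commute)

lemma l2_inner_self:
  assumes "f \<in> ell2 X"
  shows "l2_inner X f f = of_real ((l2_norm X f)\<^sup>2)"
  unfolding l2_inner_def l2_norm_sq complex_norm_square[symmetric]
  by (rule infsumI, rule has_sum_bounded_linear[OF bounded_linear_of_real],
      rule has_sum_infsum, rule ell2_summable[OF assms])

lemma l2_inner_delta:
  assumes "y \<in> X"
  shows "l2_inner X f (delta y) = f y"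
proof -
  have "((\<lambda>x. f x * cnj (delta y x)) has_sum (\<Sum>x\<in>{y}. f x * cnj (delta y x))) X"
    by (rule has_sum_finite_neutralI[of "{y}"]) (use assms in \<open>auto simp: delta_def\<close>)
  then show ?thesis by (simp add: l2_inner_def infsumI) (simp add: delta_def)
qed

lemma l2_inner_sum:
  assumes "\<And>i. i \<in> I \<Longrightarrow> f i \<in> ell2 X" "g \<in> ell2 X"
  shows "l2_inner X (\<lambda>x. \<Sum>i\<in>I. f i x) g = (\<Sum>i\<in>I. l2_inner X (f i) g)"
  using assms(1)
proof (induction I rule: infinite_finite_induct)
  case (insert i I)
  then show ?case by (simp add: l2_inner_add ell2_sum assms(2))
qed (simp_all add: l2_inner_def)

text \<open>Operator matrices violate the convention of vanishing outside \<open>ell2\<close>: such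
  a matrix may be nonzero at a vector of which only one block is square summable. Hence this version
  of \<open>bounded_ops\<close> without that clause.\<close>

definition bounded_linear_l2 :: "'x set \<Rightarrow> 'x operator \<Rightarrow> bool" where
  "bounded_linear_l2 X T \<longleftrightarrow>
     (\<forall>f\<in>ell2 X. T f \<in> ell2 X) \<and>
     (\<forall>f\<in>ell2 X. \<forall>g\<in>ell2 X. T (\<lambda>x. f x + g x) = (\<lambda>x. T f x + T g x)) \<and>
     (\<forall>c. \<forall>f\<in>ell2 X. T (\<lambda>x. c * f x) = (\<lambda>x. c * T f x)) \<and>
     (\<exists>C. \<forall>f\<in>ell2 X. l2_norm X (T f) \<le> C * l2_norm X f)"

lemma bounded_ops_iff:
  "T \<in> bounded_ops X \<longleftrightarrow> bounded_linear_l2 X T \<and> (\<forall>f. f \<notin> ell2 X \<longrightarrow> T f = (\<lambda>x. 0))"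
  by (auto simp: bounded_ops_def bounded_linear_l2_def)

lemma bounded_opsD: "T \<in> bounded_ops X \<Longrightarrow> bounded_linear_l2 X T"
  by (simp add: bounded_ops_iff)

lemma bounded_linear_l2I:
  assumes "\<And>f. f \<in> ell2 X \<Longrightarrow> T f \<in> ell2 X"
    and "\<And>f g. f \<in> ell2 X \<Longrightarrow> g \<in> ell2 X \<Longrightarrow> T (\<lambda>x. f x + g x) = (\<lambda>x. T f x + T g x)"
    and "\<And>c f. f \<in> ell2 X \<Longrightarrow> T (\<lambda>x. c * f x) = (\<lambda>x. c * T f x)"
    and "\<And>f. f \<in> ell2 X \<Longrightarrow> l2_norm X (T f) \<le> C * l2_norm X f"
  shows "bounded_linear_l2 X T"
  unfolding bounded_linear_l2_def using assms by blast

lemma bounded_linear_l2D: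
  assumes "bounded_linear_l2 X T"
  shows "f \<in> ell2 X \<Longrightarrow> T f \<in> ell2 X"
    and "f \<in> ell2 X \<Longrightarrow> g \<in> ell2 X \<Longrightarrow> T (\<lambda>x. f x + g x) = (\<lambda>x. T f x + T g x)"
    and "f \<in> ell2 X \<Longrightarrow> T (\<lambda>x. c * f x) = (\<lambda>x. c * T f x)"
  using assms unfolding bounded_linear_l2_def by simp_all

lemma bounded_linear_l2_bound:
  assumes "bounded_linear_l2 X T"
  obtains C where "0 < C" "\<And>f. f \<in> ell2 X \<Longrightarrow> l2_norm X (T f) \<le> C * l2_norm X f"
proof -
  obtain C where C: "\<And>f. f \<in> ell2 X \<Longrightarrow> l2_norm X (T f) \<le> C * l2_norm X f"
    using assms unfolding bounded_linear_l2_def by (elim conjE exE) (rule that, erule bspec)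
  show ?thesis
  proof (rule that[of "max C 1"])
    fix f assume "f \<in> ell2 X"
    then have "l2_norm X (T f) \<le> C * l2_norm X f" by (rule C)
    also have "\<dots> \<le> max C 1 * l2_norm X f" by (rule mult_right_mono) auto
    finally show "l2_norm X (T f) \<le> max C 1 * l2_norm X f" .
  qed simp
qed

lemma op_norm_leI:
  assumes "0 \<le> C" "\<And>f. f \<in> ell2 X \<Longrightarrow> l2_norm X (T f) \<le> C * l2_norm X f"
  shows "op_norm X T \<le> C"
  unfolding op_norm_def
proof (rule cSUP_least)
  show "{f \<in> ell2 X. l2_norm X f \<le> 1} \<noteq> {}"
    by (auto intro!: exI[of _ "\<lambda>x. 0"])
  fix f assume "f \<in> {f \<in> ell2 X. l2_norm X f \<le> 1}"
  then have "l2_norm X (T f) \<le> C * l2_norm X f" "C * l2_norm X f \<le> C * 1"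
    using assms(1) by (simp_all only: mem_Collect_eq assms(2) mult_left_mono)
  then show "l2_norm X (T f) \<le> C" by simp
qed

context
  fixes X :: "'x set" and T :: "'x operator"
  assumes T: "bounded_linear_l2 X T"
begin

lemma l2_op_zero: "T (\<lambda>x. 0) = (\<lambda>x. 0)"
  using bounded_linear_l2D(3)[OF T ell2_zero, of 0] by simp

lemma l2_op_diff: "f \<in> ell2 X \<Longrightarrow> g \<in> ell2 X \<Longrightarrow> T (\<lambda>x. f x - g x) = (\<lambda>x. T f x - T g x)"
  using bounded_linear_l2D(2)[OF T _ ell2_cmult, of f g "-1"] bounded_linear_l2D(3)[OF T, of g "-1"] by simp

lemma l2_op_sum:
  assumes "\<And>i. i \<in> I \<Longrightarrow> f i \<in> ell2 X"
  shows "T (\<lambda>x. \<Sum>i\<in>I. f i x) = (\<lambda>x. \<Sum>i\<in>I. T (f i) x)"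
  using assms
  by (induction I rule: infinite_finite_induct)
    (simp_all add: l2_op_zero bounded_linear_l2D(2)[OF T] ell2_sum)

lemma l2_op_truncate:
  assumes F: "finite F" "F \<subseteq> X"
  shows "T (truncate F f) = (\<lambda>x. \<Sum>y\<in>F. f y * T (delta y) x)"
proof -
  have "truncate F f = (\<lambda>x. \<Sum>y\<in>F. f y * delta y x)"
    using F(1) by (auto simp: truncate_def delta_def fun_eq_iff if_distrib cong: if_cong)
  moreover have "delta y \<in> ell2 X" if "y \<in> F" for y
    using F(2) that by auto
  ultimately show ?thesis
    by (simp add: l2_op_sum ell2_cmult bounded_linear_l2D(3)[OF T])
qed

lemma tendsto_inner_l2_op_truncate:
  assumes f: "f \<in> ell2 X" and g: "g \<in> ell2 X"
  shows "((\<lambda>F. l2_inner X (T (truncate F f)) g) \<longlongrightarrow> l2_inner X (T f) g) (finite_subsets_at_top X)"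
proof -
  obtain C where C: "0 < C" "\<And>f. f \<in> ell2 X \<Longrightarrow> l2_norm X (T f) \<le> C * l2_norm X f"
    using bounded_linear_l2_bound[OF T] by blast
  have "((\<lambda>F. C * l2_norm X (\<lambda>x. f x - truncate F f x) * l2_norm X g) \<longlongrightarrow> C * 0 * l2_norm X g)
      (finite_subsets_at_top X)"
    by (intro tendsto_intros tendsto_l2_norm_truncate f)
  then have lim: "((\<lambda>F. C * l2_norm X (\<lambda>x. f x - truncate F f x) * l2_norm X g) \<longlongrightarrow> 0) (finite_subsets_at_top X)"
    by simp
  have "((\<lambda>F. l2_inner X (T f) g - l2_inner X (T (truncate F f)) g) \<longlongrightarrow> 0) (finite_subsets_at_top X)"
  proof (rule Lim_null_comparison[OF _ lim], rule eventually_finite_subsets_at_top_weakI)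
    fix F assume F: "finite F" "F \<subseteq> X"
    note cF = truncate_ell2[OF F, of f]
    have "l2_inner X (T f) g - l2_inner X (T (truncate F f)) g = l2_inner X (T (\<lambda>x. f x - truncate F f x)) g"
      unfolding l2_op_diff[OF f cF] by (rule l2_inner_diff[symmetric]) (intro bounded_linear_l2D(1)[OF T] f cF g)+
    also have "cmod \<dots> \<le> l2_norm X (T (\<lambda>x. f x - truncate F f x)) * l2_norm X g"
      by (intro l2_inner_summable bounded_linear_l2D(1)[OF T] ell2_diff f cF g)
    also have "\<dots> \<le> C * l2_norm X (\<lambda>x. f x - truncate F f x) * l2_norm X g"
      by (intro mult_right_mono C ell2_diff f cF) simp
    finally show "cmod (l2_inner X (T f) g - l2_inner X (T (truncate F f)) g)
        \<le> C * l2_norm X (\<lambda>x. f x - truncate F f x) * l2_norm X g" .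
  qed
  from tendsto_diff[OF tendsto_const[of "l2_inner X (T f) g"] this] show ?thesis by simp
qed

text \<open>Truncations converge in norm, so a bounded operator is determined by its matrix in the
  basis \<open>delta\<close>.\<close>

lemma has_sum_inner_l2_op:
  assumes f: "f \<in> ell2 X" and g: "g \<in> ell2 X"
  shows "((\<lambda>y. f y * l2_inner X (T (delta y)) g) has_sum l2_inner X (T f) g) X"
  unfolding has_sum_def
proof (rule tendsto_cong[THEN iffD1, OF _ tendsto_inner_l2_op_truncate[OF f g]],
    rule eventually_finite_subsets_at_top_weakI)
  fix F assume F: "finite F" "F \<subseteq> X"
  have "l2_inner X (\<lambda>x. \<Sum>y\<in>F. f y * T (delta y) x) g = (\<Sum>y\<in>F. l2_inner X (\<lambda>x. f y * T (delta y) x) g)"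
    using F by (intro l2_inner_sum ell2_cmult bounded_linear_l2D(1)[OF T] delta_ell2 g) auto
  then show "l2_inner X (T (truncate F f)) g = (\<Sum>y\<in>F. f y * l2_inner X (T (delta y)) g)"
    by (simp add: l2_op_truncate[OF F] l2_inner_cmult)
qed

lemma has_sum_l2_op:
  assumes f: "f \<in> ell2 X" and x: "x \<in> X"
  shows "((\<lambda>y. f y * T (delta y) x) has_sum T f x) X"
  using has_sum_inner_l2_op[OF f delta_ell2[OF x]] x by (simp add: l2_inner_delta)

lemma l2_norm_op_le:
  assumes f: "f \<in> ell2 X"
  shows "l2_norm X (T f) \<le> op_norm X T * l2_norm X f"
proof -
  obtain C where C: "0 < C" "\<And>f. f \<in> ell2 X \<Longrightarrow> l2_norm X (T f) \<le> C * l2_norm X f"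
    using bounded_linear_l2_bound[OF T] by blast
  have le: "l2_norm X (T g) \<le> op_norm X T" if g: "g \<in> ell2 X" "l2_norm X g \<le> 1" for g
    unfolding op_norm_def
  proof (rule cSUP_upper)
    show "g \<in> {f \<in> ell2 X. l2_norm X f \<le> 1}" using g by simp
    show "bdd_above ((\<lambda>f. l2_norm X (T f)) ` {f \<in> ell2 X. l2_norm X f \<le> 1})"
    proof (rule bdd_aboveI2)
      fix h assume "h \<in> {f \<in> ell2 X. l2_norm X f \<le> 1}"
      then have "l2_norm X (T h) \<le> C * l2_norm X h" "C * l2_norm X h \<le> C * 1"
        using C(1) by (auto intro!: C(2) mult_left_mono)
      then show "l2_norm X (T h) \<le> C" by simp
    qed
  qed
  show ?thesis
  proof (cases "l2_norm X f = 0")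
    case True
    then show ?thesis using C(2)[OF f] by simp
  next
    case False
    then have pos: "0 < l2_norm X f" by (simp add: less_le)
    let ?c = "of_real (1 / l2_norm X f) :: complex"
    have "l2_norm X (T (\<lambda>x. ?c * f x)) \<le> op_norm X T"
      using pos by (intro le ell2_cmult f) (simp only: l2_norm_cmult, simp add: norm_divide)
    then have "l2_norm X (T f) / l2_norm X f \<le> op_norm X T"
      using pos unfolding bounded_linear_l2D(3)[OF T f] l2_norm_cmult by (simp add: norm_divide)
    then show ?thesis using pos by (simp add: field_simps)
  qed
qed

lemma form_bound_op_norm:
  assumes I: "finite I" "I \<subseteq> X" and C: "op_norm X T \<le> C"
  shows "form_bound I (\<lambda>x y. T (delta y) x) C"
proof (rule form_bound_opI)
  fix v
  have "L2_set (\<lambda>x. cmod (\<Sum>y\<in>I. T (delta y) x * v y)) I = L2_set (\<lambda>x. cmod (T (truncate I v) x)) I"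
    unfolding l2_op_truncate[OF I] by (simp only: mult.commute)
  also have "\<dots> \<le> l2_norm X (T (truncate I v))"
    by (intro L2_set_le_l2_norm bounded_linear_l2D(1)[OF T] truncate_ell2 I)
  also have "\<dots> \<le> op_norm X T * l2_norm X (truncate I v)"
    by (intro l2_norm_op_le truncate_ell2 I)
  also have "\<dots> \<le> C * l2_norm X (truncate I v)"
    by (intro mult_right_mono C) simp
  finally show "L2_set (\<lambda>x. cmod (\<Sum>y\<in>I. T (delta y) x * v y)) I \<le> C * L2_set (\<lambda>j. cmod (v j)) I"
    by (simp add: l2_norm_truncate[OF I])
qed

text \<open>Converse of \<open>form_bound_op_norm\<close>: the operator norm is governed by the
  finite square submatrices. This carries Schur bounds for finite matrices over to
  operators.\<close>

lemma op_norm_le_form_bound: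
  assumes C: "0 \<le> C" and bound: "\<And>I. finite I \<Longrightarrow> I \<subseteq> X \<Longrightarrow> form_bound I (\<lambda>x y. T (delta y) x) C"
  shows "op_norm X T \<le> C"
proof -
  have "l2_norm X (T f) \<le> C * l2_norm X f" if f: "f \<in> ell2 X" for f
  proof (rule ell2_L2_bound(2))
    show "T f x = 0" if "x \<notin> X" for x
      by (rule ell2_outside[OF bounded_linear_l2D(1)[OF T f] that])
    fix I assume I: "finite I" "I \<subseteq> X"
    have lim: "((\<lambda>F. \<Sum>y\<in>F. f y * T (delta y) x) \<longlongrightarrow> T f x) (finite_subsets_at_top X)" if "x \<in> I" for x
      using has_sum_l2_op[OF f, of x] that I(2) unfolding has_sum_def by auto
    have "((\<lambda>F. L2_set (\<lambda>x. cmod (\<Sum>y\<in>F. f y * T (delta y) x)) I) \<longlongrightarrow> L2_set (\<lambda>x. cmod (T f x)) I)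
        (finite_subsets_at_top X)"
      unfolding L2_set_def by (intro tendsto_intros lim)
    moreover have "\<forall>\<^sub>F F in finite_subsets_at_top X.
        L2_set (\<lambda>x. cmod (\<Sum>y\<in>F. f y * T (delta y) x)) I \<le> C * l2_norm X f"
      \<comment> \<open>\<open>F\<close> is taken to contain the rows \<open>I\<close>: enlarging
        the rows to \<open>F\<close> leaves a square matrix, for which the form bound is
        available.\<close>
      unfolding eventually_finite_subsets_at_top
    proof (intro exI[of _ I] conjI I allI impI, elim conjE)
      fix F assume F: "finite F" "I \<subseteq> F" "F \<subseteq> X"
      have "L2_set (\<lambda>x. cmod (\<Sum>y\<in>F. f y * T (delta y) x)) I \<le> L2_set (\<lambda>x. cmod (\<Sum>y\<in>F. f y * T (delta y) x)) F"
        unfolding L2_set_def by (intro real_sqrt_le_mono sum_mono2 F) simp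
      also have "\<dots> \<le> C * L2_set (\<lambda>x. cmod (f x)) F"
        using form_bound_op[OF bound[OF F(1,3)] C, of f] by (simp add: mult.commute)
      also have "\<dots> \<le> C * l2_norm X f"
        by (intro mult_left_mono L2_set_le_l2_norm f F C)
      finally show "L2_set (\<lambda>x. cmod (\<Sum>y\<in>F. f y * T (delta y) x)) I \<le> C * l2_norm X f" .
    qed
    ultimately show "L2_set (\<lambda>x. cmod (T f x)) I \<le> C * l2_norm X f"
      by (rule tendsto_upperbound) simp
  qed
  then show ?thesis
    by (rule op_norm_leI[OF C])
qed

text \<open>\<open>op_adjoint\<close> is a definite description, so an adjoint has to be produced.
  Its coefficients are forced by testing against \<open>delta x\<close>.\<close>

lemma adjoint_exists:
  "\<exists>S\<in>bounded_ops X. \<forall>f\<in>ell2 X. \<forall>g\<in>ell2 X. l2_inner X (T f) g = l2_inner X f (S g)"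
proof -
  obtain C where C: "0 < C" "\<And>f. f \<in> ell2 X \<Longrightarrow> l2_norm X (T f) \<le> C * l2_norm X f"
    using bounded_linear_l2_bound[OF T] by blast
  define S where "S g = (\<lambda>x. if g \<in> ell2 X \<and> x \<in> X then l2_inner X g (T (delta x)) else 0)" for g
  have Td: "T (delta x) \<in> ell2 X" if "x \<in> X" for x
    using that by (intro bounded_linear_l2D(1)[OF T] delta_ell2)
  have inner: "l2_inner X (T f) g = l2_inner X f (S g)" if f: "f \<in> ell2 X" and g: "g \<in> ell2 X" for f g
  proof -
    have "((\<lambda>x. f x * cnj (S g x)) has_sum l2_inner X (T f) g) X"
      by (rule has_sum_cong[THEN iffD1, OF _ has_sum_inner_l2_op[OF f g]])
        (simp add: S_def g l2_inner_commute[of X g])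
    then show ?thesis unfolding l2_inner_def[of X f] by (simp add: infsumI)
  qed
  have bound: "S g \<in> ell2 X \<and> l2_norm X (S g) \<le> C * l2_norm X g" if g: "g \<in> ell2 X" for g
  proof -
    have "L2_set (\<lambda>x. cmod (S g x)) F \<le> C * l2_norm X g" if F: "finite F" "F \<subseteq> X" for F
    proof -
      \<comment> \<open>Square summability of \<open>S g\<close> comes from testing against its own
        truncation: \<open>s^2 \<le> C s |g|\<close>, where a factor \<open>s\<close>
        cancels.\<close>
      let ?s = "L2_set (\<lambda>x. cmod (S g x)) F"
      note cF = truncate_ell2[OF F, of "S g"]
      have "((\<lambda>x. truncate F (S g) x * cnj (S g x)) has_sum (\<Sum>x\<in>F. truncate F (S g) x * cnj (S g x))) X"
        by (rule has_sum_finite_neutralI[OF F]) (auto simp: truncate_def)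
      then have "l2_inner X (truncate F (S g)) (S g) = (\<Sum>x\<in>F. truncate F (S g) x * cnj (S g x))"
        by (simp add: l2_inner_def infsumI)
      also have "\<dots> = (\<Sum>x\<in>F. of_real ((cmod (S g x))\<^sup>2))"
        by (intro sum.cong refl, unfold complex_norm_square) (simp add: truncate_def)
      also have "\<dots> = of_real (?s\<^sup>2)"
        unfolding L2_set_sq by simp
      finally have "cmod (l2_inner X (T (truncate F (S g))) g) = ?s\<^sup>2"
        unfolding inner[OF cF g] by (simp only: norm_of_real) simp
      then have "?s\<^sup>2 \<le> l2_norm X (T (truncate F (S g))) * l2_norm X g"
        using l2_inner_summable(2)[OF bounded_linear_l2D(1)[OF T cF] g] by simp
      also have "\<dots> \<le> C * l2_norm X (truncate F (S g)) * l2_norm X g"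
        by (intro mult_right_mono C cF) simp
      finally have "?s * ?s \<le> ?s * (C * l2_norm X g)"
        by (simp add: l2_norm_truncate[OF F] power2_eq_square mult_ac)
      moreover have "0 \<le> ?s" by simp
      ultimately show ?thesis
        using C(1) by (cases "?s = 0") (auto simp: mult_le_cancel_left)
    qed
    note * = ell2_L2_bound[of X "S g", OF _ this]
    show ?thesis by (intro conjI *) (simp_all add: S_def)
  qed
  have "bounded_linear_l2 X S"
  proof (rule bounded_linear_l2I[where C = C])
    show "S (\<lambda>x. f x + g x) = (\<lambda>x. S f x + S g x)" if "f \<in> ell2 X" "g \<in> ell2 X" for f g
      using that by (auto simp: S_def ell2_add l2_inner_add Td)
    show "S (\<lambda>x. c * f x) = (\<lambda>x. c * S f x)" if "f \<in> ell2 X" for c f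
      using that by (auto simp: S_def ell2_cmult l2_inner_cmult)
  qed (simp_all add: bound)
  then have "S \<in> bounded_ops X"
    by (simp add: bounded_ops_iff S_def)
  then show ?thesis using inner by (intro bexI[of _ S] ballI)
qed

end

lemma adjoint_unique:
  assumes "S \<in> bounded_ops X" "S' \<in> bounded_ops X"
    and "\<And>f g. f \<in> ell2 X \<Longrightarrow> g \<in> ell2 X \<Longrightarrow> l2_inner X f (S g) = l2_inner X f (S' g)"
  shows "S = S'"
proof
  fix g
  show "S g = S' g"
  proof (cases "g \<in> ell2 X")
    case True
    show ?thesis
    proof
      fix x
      show "S g x = S' g x"
      proof (cases "x \<in> X")
        case x: True
        have "l2_inner X (S g) (delta x) = l2_inner X (S' g) (delta x)"
          using assms(3)[OF delta_ell2[OF x] True] by (subst (1 2) l2_inner_commute) simp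
        then show ?thesis using x by (simp add: l2_inner_delta)
      next
        case False
        then show ?thesis
          using ell2_outside[OF bounded_linear_l2D(1)[OF bounded_opsD True]] assms(1,2) by metis
      qed
    qed
  next
    case False
    then show ?thesis using assms(1,2) by (simp add: bounded_ops_iff)
  qed
qed

lemma op_adjoint:
  assumes T: "T \<in> bounded_ops X"
  shows "op_adjoint X T \<in> bounded_ops X"
    and "f \<in> ell2 X \<Longrightarrow> g \<in> ell2 X \<Longrightarrow> l2_inner X (T f) g = l2_inner X f (op_adjoint X T g)"
proof -
  let ?P = "\<lambda>S. S \<in> bounded_ops X \<and>
     (\<forall>f\<in>ell2 X. \<forall>g\<in>ell2 X. l2_inner X (T f) g = l2_inner X f (S g))"
  obtain S where S: "?P S" using adjoint_exists[OF bounded_opsD[OF T]] by blast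
  have "?P (op_adjoint X T)"
    unfolding op_adjoint_def
  proof (rule theI[where P = ?P, OF S])
    fix S' assume S': "?P S'"
    show "S' = S"
      by (rule adjoint_unique[of S' X S]) (use S S' in simp_all)
  qed
  then show "op_adjoint X T \<in> bounded_ops X"
    and "f \<in> ell2 X \<Longrightarrow> g \<in> ell2 X \<Longrightarrow> l2_inner X (T f) g = l2_inner X f (op_adjoint X T g)"
    by simp_all
qed

text \<open>The adjoint moves to the other side of the inner product that defines the trace. Thus
  2-norm estimates concern only the column of \<open>T\<close> at the identity.\<close>

lemma norm2_group_trace:
  assumes "group G" and T: "T \<in> bounded_ops (carrier G)"
  shows "norm2 (carrier G) (group_trace G) T = l2_norm (carrier G) (T (delta \<one>\<^bsub>G\<^esub>))"
proof -
  let ?X = "carrier G" and ?d = "delta \<one>\<^bsub>G\<^esub>"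
  have d: "?d \<in> ell2 ?X"
    using assms(1) by (simp add: group.is_monoid)
  have "group_trace G (op_adjoint ?X T \<circ> T) = l2_inner ?X (op_adjoint ?X T (T ?d)) ?d"
    by (simp add: group_trace_def delta_def Let_def)
  also have "\<dots> = cnj (l2_inner ?X (T ?d) (T ?d))"
    unfolding l2_inner_commute[of ?X "op_adjoint ?X T (T ?d)"]
    using op_adjoint(2)[OF T d bounded_linear_l2D(1)[OF bounded_opsD[OF T] d]] by simp
  finally show ?thesis
    using bounded_linear_l2D(1)[OF bounded_opsD[OF T] d] by (simp add: norm2_def l2_inner_self)
qed

section \<open>Group von Neumann algebras and matrices of operators\<close>

lemma l2_norm_weight_le:
  assumes f: "f \<in> ell2 X" and B: "0 \<le> B" "\<And>x. x \<in> X \<Longrightarrow> cmod (w x) \<le> B"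
  shows "(\<lambda>x. w x * f x) \<in> ell2 X" "l2_norm X (\<lambda>x. w x * f x) \<le> B * l2_norm X f"
proof -
  have "L2_set (\<lambda>x. cmod (w x * f x)) F \<le> B * l2_norm X f" if F: "finite F" "F \<subseteq> X" for F
  proof -
    have "L2_set (\<lambda>x. cmod (w x * f x)) F \<le> L2_set (\<lambda>x. B * cmod (f x)) F"
      using F B by (intro L2_set_mono) (auto simp: norm_mult intro!: mult_right_mono)
    also have "\<dots> = B * L2_set (\<lambda>x. cmod (f x)) F"
      by (rule L2_set_right_distrib[symmetric]) (rule B)
    also have "\<dots> \<le> B * l2_norm X f"
      by (intro mult_left_mono L2_set_le_l2_norm f F B)
    finally show ?thesis .
  qed
  note * = ell2_L2_bound[of X "\<lambda>x. w x * f x", OF _ this]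
  show "(\<lambda>x. w x * f x) \<in> ell2 X" "l2_norm X (\<lambda>x. w x * f x) \<le> B * l2_norm X f"
    by (rule *; simp add: ell2_outside[OF f])+
qed

lemma l2_norm_sum_le:
  assumes "\<And>i. i \<in> I \<Longrightarrow> f i \<in> ell2 X"
  shows "l2_norm X (\<lambda>x. \<Sum>i\<in>I. f i x) \<le> (\<Sum>i\<in>I. l2_norm X (f i))"
  using assms
proof (induction I rule: infinite_finite_induct)
  case (insert i I)
  have "l2_norm X (\<lambda>x. f i x + (\<Sum>i\<in>I. f i x)) \<le> l2_norm X (f i) + l2_norm X (\<lambda>x. \<Sum>i\<in>I. f i x)"
    by (intro ell2_add ell2_sum insert.prems) auto
  then show ?case using insert by force
qed simp_all

text \<open>Left and right translations share this form, and injectivity of \<pi> on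
  \<open>X\<close> already makes the operator a contraction.\<close>

definition perm_op :: "'x set \<Rightarrow> ('x \<Rightarrow> 'x) \<Rightarrow> 'x operator" where
  "perm_op X \<pi> = (\<lambda>f x. if f \<in> ell2 X \<and> x \<in> X then f (\<pi> x) else 0)"

lemma perm_op_norm:
  assumes \<pi>: "inj_on \<pi> X" "\<pi> ` X \<subseteq> X" and f: "f \<in> ell2 X"
  shows "perm_op X \<pi> f \<in> ell2 X" "l2_norm X (perm_op X \<pi> f) \<le> l2_norm X f"
proof -
  have "L2_set (\<lambda>x. cmod (perm_op X \<pi> f x)) F \<le> l2_norm X f" if F: "finite F" "F \<subseteq> X" for F
  proof -
    have "L2_set (\<lambda>x. cmod (perm_op X \<pi> f x)) F = L2_set (\<lambda>x. cmod (f (\<pi> x))) F"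
      using F f by (intro L2_set_cong refl) (auto simp: perm_op_def)
    also have "\<dots> = L2_set (\<lambda>x. cmod (f x)) (\<pi> ` F)"
      using inj_on_subset[OF \<pi>(1) F(2)] by (subst L2_set_reindex[of \<pi> F]) (auto simp: bij_betw_def o_def)
    also have "\<dots> \<le> l2_norm X f"
      using F \<pi>(2) by (intro L2_set_le_l2_norm f) auto
    finally show ?thesis .
  qed
  note * = ell2_L2_bound[of X "perm_op X \<pi> f", OF _ this]
  show "perm_op X \<pi> f \<in> ell2 X" "l2_norm X (perm_op X \<pi> f) \<le> l2_norm X f"
    by (rule *; simp add: perm_op_def)+
qed

lemma perm_op_bounded_ops:
  assumes \<pi>: "inj_on \<pi> X" "\<pi> ` X \<subseteq> X"
  shows "perm_op X \<pi> \<in> bounded_ops X"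
proof -
  have "bounded_linear_l2 X (perm_op X \<pi>)"
  proof (rule bounded_linear_l2I[where C = 1])
    show "perm_op X \<pi> (\<lambda>x. f x + g x) = (\<lambda>x. perm_op X \<pi> f x + perm_op X \<pi> g x)"
      if "f \<in> ell2 X" "g \<in> ell2 X" for f g
      using that by (auto simp: perm_op_def ell2_add)
    show "perm_op X \<pi> (\<lambda>x. c * f x) = (\<lambda>x. c * perm_op X \<pi> f x)" if "f \<in> ell2 X" for c f
      using that by (auto simp: perm_op_def ell2_cmult)
  qed (simp_all add: perm_op_norm[OF \<pi>])
  then show ?thesis by (simp add: bounded_ops_iff perm_op_def)
qed

section \<open>Commutants as linear spaces of operators\<close>

lemma bounded_ops_add:
  assumes "S \<in> bounded_ops X" "T \<in> bounded_ops X"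
  shows "(\<lambda>f x. S f x + T f x) \<in> bounded_ops X"
proof -
  note S = bounded_opsD[OF assms(1)] and T = bounded_opsD[OF assms(2)]
  obtain C where C: "\<And>f. f \<in> ell2 X \<Longrightarrow> l2_norm X (S f) \<le> C * l2_norm X f"
    using bounded_linear_l2_bound[OF S] by blast
  obtain D where D: "\<And>f. f \<in> ell2 X \<Longrightarrow> l2_norm X (T f) \<le> D * l2_norm X f"
    using bounded_linear_l2_bound[OF T] by blast
  have "bounded_linear_l2 X (\<lambda>f x. S f x + T f x)"
  proof (rule bounded_linear_l2I[where C = "C + D"])
    fix f assume f: "f \<in> ell2 X"
    show "(\<lambda>x. S f x + T f x) \<in> ell2 X"
      by (intro ell2_add bounded_linear_l2D(1)[OF S] bounded_linear_l2D(1)[OF T] f)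
    have "l2_norm X (\<lambda>x. S f x + T f x) \<le> l2_norm X (S f) + l2_norm X (T f)"
      by (intro ell2_add bounded_linear_l2D(1)[OF S] bounded_linear_l2D(1)[OF T] f)
    then show "l2_norm X (\<lambda>x. S f x + T f x) \<le> (C + D) * l2_norm X f"
      using C[OF f] D[OF f] by (simp add: distrib_right)
    show "(\<lambda>x. S (\<lambda>x. c * f x) x + T (\<lambda>x. c * f x) x) = (\<lambda>x. c * (S f x + T f x))" for c
      by (simp add: bounded_linear_l2D(3)[OF S f] bounded_linear_l2D(3)[OF T f] distrib_left)
    show "(\<lambda>x. S (\<lambda>x. f x + g x) x + T (\<lambda>x. f x + g x) x) = (\<lambda>x. S f x + T f x + (S g x + T g x))"
      if "g \<in> ell2 X" for g
      by (simp add: bounded_linear_l2D(2)[OF S f that] bounded_linear_l2D(2)[OF T f that] add_ac)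
  qed
  then show ?thesis using assms by (simp add: bounded_ops_iff)
qed

lemma bounded_ops_cmult:
  assumes "T \<in> bounded_ops X"
  shows "(\<lambda>f x. c * T f x) \<in> bounded_ops X"
proof -
  note T = bounded_opsD[OF assms]
  obtain D where D: "\<And>f. f \<in> ell2 X \<Longrightarrow> l2_norm X (T f) \<le> D * l2_norm X f"
    using bounded_linear_l2_bound[OF T] by blast
  have "bounded_linear_l2 X (\<lambda>f x. c * T f x)"
  proof (rule bounded_linear_l2I[where C = "cmod c * D"])
    fix f assume f: "f \<in> ell2 X"
    show "(\<lambda>x. c * T f x) \<in> ell2 X"
      by (intro ell2_cmult bounded_linear_l2D(1)[OF T] f)
    show "l2_norm X (\<lambda>x. c * T f x) \<le> cmod c * D * l2_norm X f"
      unfolding l2_norm_cmult mult.assoc by (intro mult_left_mono D f) simp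
    show "(\<lambda>x. c * T (\<lambda>x. b * f x) x) = (\<lambda>x. b * (c * T f x))" for b
      by (simp add: bounded_linear_l2D(3)[OF T f] mult_ac)
    show "(\<lambda>x. c * T (\<lambda>x. f x + g x) x) = (\<lambda>x. c * T f x + c * T g x)"
      if "g \<in> ell2 X" for g
      by (simp add: bounded_linear_l2D(2)[OF T f that] distrib_left)
  qed
  then show ?thesis using assms by (simp add: bounded_ops_iff)
qed

lemma commutantD:
  assumes "T \<in> commutant X \<S>"
  shows "T \<in> bounded_ops X" "s \<in> \<S> \<Longrightarrow> T (s f) = s (T f)"
  using assms by (auto simp: commutant_def fun_eq_iff)

lemma commutantI:
  assumes "T \<in> bounded_ops X" "\<And>s f. s \<in> \<S> \<Longrightarrow> T (s f) = s (T f)"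
  shows "T \<in> commutant X \<S>"
  using assms by (auto simp: commutant_def fun_eq_iff)

lemma bounded_ops_ell2:
  assumes "T \<in> bounded_ops X"
  shows "T f \<in> ell2 X"
  using assms by (cases "f \<in> ell2 X") (auto simp: bounded_ops_def)

lemma commutant_add:
  assumes \<S>: "\<S> \<subseteq> bounded_ops X" and S: "S \<in> commutant X \<S>" and T: "T \<in> commutant X \<S>"
  shows "(\<lambda>f x. S f x + T f x) \<in> commutant X \<S>"
proof (rule commutantI)
  show "(\<lambda>f x. S f x + T f x) \<in> bounded_ops X"
    by (intro bounded_ops_add commutantD(1)[OF S] commutantD(1)[OF T])
  fix s f assume s: "s \<in> \<S>"
  have lin: "bounded_linear_l2 X s"
    using \<S> s by (blast intro: bounded_opsD)
  show "(\<lambda>x. S (s f) x + T (s f) x) = s (\<lambda>x. S f x + T f x)"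
    unfolding commutantD(2)[OF S s] commutantD(2)[OF T s]
    by (intro bounded_linear_l2D(2)[OF lin, symmetric] bounded_ops_ell2 commutantD(1)[OF S] commutantD(1)[OF T])
qed

lemma commutant_cmult:
  assumes \<S>: "\<S> \<subseteq> bounded_ops X" and T: "T \<in> commutant X \<S>"
  shows "(\<lambda>f x. c * T f x) \<in> commutant X \<S>"
proof (rule commutantI)
  show "(\<lambda>f x. c * T f x) \<in> bounded_ops X"
    by (intro bounded_ops_cmult commutantD(1)[OF T])
  fix s f assume s: "s \<in> \<S>"
  have lin: "bounded_linear_l2 X s"
    using \<S> s by (blast intro: bounded_opsD)
  show "(\<lambda>x. c * T (s f) x) = s (\<lambda>x. c * T f x)"
    unfolding commutantD(2)[OF T s]
    by (intro bounded_linear_l2D(3)[OF lin, symmetric] bounded_ops_ell2 commutantD(1)[OF T])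
qed

lemma commutant_zero:
  assumes \<S>: "\<S> \<subseteq> bounded_ops X"
  shows "(\<lambda>f x. 0) \<in> commutant X \<S>"
proof (rule commutantI)
  show "(\<lambda>f x. 0) \<in> bounded_ops X"
    by (auto simp: bounded_ops_iff intro!: bounded_linear_l2I[where C = 0])
  fix s and f :: "'a vec" assume s: "s \<in> \<S>"
  then have "bounded_linear_l2 X s" using \<S> by (blast intro: bounded_opsD)
  then show "(\<lambda>x. 0) = s (\<lambda>x. 0)" by (simp add: l2_op_zero)
qed

lemma commutant_sum:
  assumes \<S>: "\<S> \<subseteq> bounded_ops X" and "\<And>i. i \<in> I \<Longrightarrow> T i \<in> commutant X \<S>"
  shows "(\<lambda>f x. \<Sum>i\<in>I. c i * T i f x) \<in> commutant X \<S>"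
  using assms(2)
proof (induction I rule: infinite_finite_induct)
  case (insert i I)
  have "(\<lambda>f x. c i * T i f x + (\<Sum>i\<in>I. c i * T i f x)) \<in> commutant X \<S>"
    by (intro commutant_add[OF \<S>] commutant_cmult[OF \<S>] insert.IH insert.prems) auto
  then show ?case using insert.hyps by simp
qed (simp_all add: commutant_zero[OF \<S>])

lemma commutant_subset: "commutant X \<S> \<subseteq> bounded_ops X"
  by (auto simp: commutant_def)

lemma group_vN_bounded: "T \<in> group_vN G \<Longrightarrow> T \<in> bounded_ops (carrier G)"
  by (simp add: group_vN_def commutant_def)

section \<open>Translations and matrix coefficients in the group von Neumann algebra\<close>

context
  fixes G :: "('a, 'b) monoid_scheme"
  assumes G: "group G"
begin

lemma left_regular_perm_op:
  "left_regular G g = perm_op (carrier G) (\<lambda>x. inv\<^bsub>G\<^esub> g \<otimes>\<^bsub>G\<^esub> x)"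
  by (simp add: left_regular_def perm_op_def)

lemma left_mult_perm:
  assumes "g \<in> carrier G"
  shows "inj_on (\<lambda>x. g \<otimes>\<^bsub>G\<^esub> x) (carrier G)" "(\<lambda>x. g \<otimes>\<^bsub>G\<^esub> x) ` carrier G \<subseteq> carrier G"
proof -
  interpret group G by (rule G)
  show "inj_on (\<lambda>x. g \<otimes>\<^bsub>G\<^esub> x) (carrier G)" "(\<lambda>x. g \<otimes>\<^bsub>G\<^esub> x) ` carrier G \<subseteq> carrier G"
    using assms by (auto simp: inj_on_def)
qed

lemma right_mult_perm:
  assumes "g \<in> carrier G"
  shows "inj_on (\<lambda>x. x \<otimes>\<^bsub>G\<^esub> g) (carrier G)" "(\<lambda>x. x \<otimes>\<^bsub>G\<^esub> g) ` carrier G \<subseteq> carrier G"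
proof -
  interpret group G by (rule G)
  show "inj_on (\<lambda>x. x \<otimes>\<^bsub>G\<^esub> g) (carrier G)" "(\<lambda>x. x \<otimes>\<^bsub>G\<^esub> g) ` carrier G \<subseteq> carrier G"
    using assms by (auto simp: inj_on_def)
qed

lemma inv_in_carrier: "g \<in> carrier G \<Longrightarrow> inv\<^bsub>G\<^esub> g \<in> carrier G"
  using group.inv_closed[OF G] .

lemma left_regular_bounded: "g \<in> carrier G \<Longrightarrow> left_regular G g \<in> bounded_ops (carrier G)"
  unfolding left_regular_perm_op by (intro perm_op_bounded_ops left_mult_perm inv_in_carrier)

lemma l2_norm_left_regular:
  "g \<in> carrier G \<Longrightarrow> f \<in> ell2 (carrier G) \<Longrightarrow> l2_norm (carrier G) (left_regular G g f) \<le> l2_norm (carrier G) f"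
  unfolding left_regular_perm_op by (intro perm_op_norm left_mult_perm inv_in_carrier)

lemma left_regular_delta:
  assumes "g \<in> carrier G" "t \<in> carrier G"
  shows "left_regular G g (delta t) s = (if s \<in> carrier G \<and> s \<otimes>\<^bsub>G\<^esub> inv\<^bsub>G\<^esub> t = g then 1 else 0)"
proof (cases "s \<in> carrier G")
  case True
  interpret group G by (rule G)
  have "inv\<^bsub>G\<^esub> g \<otimes>\<^bsub>G\<^esub> s = t \<longleftrightarrow> s \<otimes>\<^bsub>G\<^esub> inv\<^bsub>G\<^esub> t = g"
  proof
    assume *: "inv\<^bsub>G\<^esub> g \<otimes>\<^bsub>G\<^esub> s = t"
    have "s = g \<otimes>\<^bsub>G\<^esub> t" using * assms True inv_solve_left by blast
    then show "s \<otimes>\<^bsub>G\<^esub> inv\<^bsub>G\<^esub> t = g" using assms by (simp add: m_assoc)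
  next
    assume "s \<otimes>\<^bsub>G\<^esub> inv\<^bsub>G\<^esub> t = g"
    then have "s = g \<otimes>\<^bsub>G\<^esub> t" using assms True by (auto simp: m_assoc)
    then show "inv\<^bsub>G\<^esub> g \<otimes>\<^bsub>G\<^esub> s = t" using assms by (simp add: m_assoc[symmetric])
  qed
  then show ?thesis
    using True delta_ell2[OF assms(2)] by (simp add: left_regular_def delta_def)
qed (simp add: left_regular_def)

lemma left_regular_in_group_vN:
  assumes "g \<in> carrier G"
  shows "left_regular G g \<in> group_vN G"
  unfolding group_vN_def
  by (rule commutantI[OF left_regular_bounded[OF assms]])
    (rule commutantD(2)[symmetric], assumption, use assms in blast)

lemma group_vN_sum:
  assumes "\<And>i. i \<in> I \<Longrightarrow> T i \<in> group_vN G"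
  shows "(\<lambda>f x. \<Sum>i\<in>I. c i * T i f x) \<in> group_vN G"
  using commutant_sum[OF commutant_subset] assms unfolding group_vN_def by blast

lemma group_vN_diff:
  assumes S: "S \<in> group_vN G" and T: "T \<in> group_vN G"
  shows "(\<lambda>f x. S f x - T f x) \<in> group_vN G"
proof -
  have "(\<lambda>f x. S f x + (-1) * T f x) \<in> group_vN G"
    using assms unfolding group_vN_def by (intro commutant_add commutant_cmult commutant_subset)
  then show ?thesis by simp
qed

text \<open>Associativity makes left and right translations commute. These elements of the commutant
  force the shape of the matrix entries in \<open>group_vN_coefficient\<close>.\<close>

lemma right_translation_in_commutant:
  assumes t: "t \<in> carrier G"
  shows "perm_op (carrier G) (\<lambda>x. x \<otimes>\<^bsub>G\<^esub> t) \<in> commutant (carrier G) (left_regular G ` carrier G)"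
proof (rule commutantI)
  interpret group G by (rule G)
  let ?R = "perm_op (carrier G) (\<lambda>x. x \<otimes>\<^bsub>G\<^esub> t)"
  show R: "?R \<in> bounded_ops (carrier G)"
    by (intro perm_op_bounded_ops right_mult_perm t)
  fix s f assume "s \<in> left_regular G ` carrier G"
  then obtain g where g: "g \<in> carrier G" and s: "s = left_regular G g" by blast
  show "?R (s f) = s (?R f)"
  proof (cases "f \<in> ell2 (carrier G)")
    case True
    have "s f \<in> ell2 (carrier G)" "?R f \<in> ell2 (carrier G)"
      unfolding s by (rule bounded_ops_ell2[OF left_regular_bounded[OF g]] bounded_ops_ell2[OF R])+
    then show ?thesis
      using g t True by (auto simp: s perm_op_def left_regular_def m_assoc fun_eq_iff)
  next
    case False
    then have "?R f = (\<lambda>x. 0)" "s f = (\<lambda>x. 0)" by (simp_all add: s perm_op_def left_regular_def)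
    then show ?thesis
      using l2_op_zero[OF bounded_opsD[OF R]] l2_op_zero[OF bounded_opsD[OF left_regular_bounded[OF g]]]
      by (simp add: s)
  qed
qed

text \<open>\<open>delta t\<close> is a right translate of the point mass at the identity, and
  \<open>T\<close> commutes with right translations. Thus \<open>T\<close> is determined by its
  column at the identity.\<close>

lemma group_vN_coefficient:
  assumes T: "T \<in> group_vN G" and t: "t \<in> carrier G" and s: "s \<in> carrier G"
  shows "T (delta t) s = T (delta \<one>\<^bsub>G\<^esub>) (s \<otimes>\<^bsub>G\<^esub> inv\<^bsub>G\<^esub> t)"
proof -
  interpret group G by (rule G)
  let ?R = "perm_op (carrier G) (\<lambda>x. x \<otimes>\<^bsub>G\<^esub> inv\<^bsub>G\<^esub> t)"
  have "delta t = ?R (delta \<one>\<^bsub>G\<^esub>)"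
  proof
    fix x
    have "x \<otimes>\<^bsub>G\<^esub> inv\<^bsub>G\<^esub> t = \<one>\<^bsub>G\<^esub> \<longleftrightarrow> x = t" if "x \<in> carrier G"
      using that t inv_equality inv_inv by fastforce
    then show "delta t x = ?R (delta \<one>\<^bsub>G\<^esub>) x"
      using t by (auto simp: delta_def[of t] perm_op_def) (auto simp: delta_def)
  qed
  moreover have "T (?R f) = ?R (T f)" for f
    by (intro commutantD(2)[OF T[unfolded group_vN_def]] right_translation_in_commutant inv_in_carrier t)
  ultimately have "T (delta t) s = ?R (T (delta \<one>\<^bsub>G\<^esub>)) s" by simp
  also have "\<dots> = T (delta \<one>\<^bsub>G\<^esub>) (s \<otimes>\<^bsub>G\<^esub> inv\<^bsub>G\<^esub> t)"
    using s bounded_ops_ell2[OF group_vN_bounded[OF T]] by (simp add: perm_op_def)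
  finally show ?thesis .
qed

end

section \<open>Matrices of operators\<close>

definition block :: "nat \<Rightarrow> (nat \<times> 'x) vec \<Rightarrow> 'x vec" where
  "block j \<xi> = (\<lambda>y. \<xi> (j, y))"

definition embed_block :: "nat \<Rightarrow> 'x vec \<Rightarrow> (nat \<times> 'x) vec" where
  "embed_block i f = (\<lambda>(i', x). if i' = i then f x else 0)"

lemma block_ell2:
  assumes \<xi>: "\<xi> \<in> ell2 ({..<n} \<times> X)" and j: "j < n"
  shows "block j \<xi> \<in> ell2 X" "l2_norm X (block j \<xi>) \<le> l2_norm ({..<n} \<times> X) \<xi>"
proof -
  have "L2_set (\<lambda>x. cmod (block j \<xi> x)) F \<le> l2_norm ({..<n} \<times> X) \<xi>" if F: "finite F" "F \<subseteq> X" for F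
  proof -
    have "bij_betw (Pair j) F (Pair j ` F)" by (auto simp: bij_betw_def inj_on_def)
    then have "L2_set (\<lambda>x. cmod (block j \<xi> x)) F = L2_set (\<lambda>p. cmod (\<xi> p)) (Pair j ` F)"
      by (simp add: L2_set_reindex block_def o_def)
    also have "\<dots> \<le> l2_norm ({..<n} \<times> X) \<xi>"
      using F j by (intro L2_set_le_l2_norm \<xi>) auto
    finally show ?thesis .
  qed
  note * = ell2_L2_bound[of X "block j \<xi>", OF _ this]
  show "block j \<xi> \<in> ell2 X" "l2_norm X (block j \<xi>) \<le> l2_norm ({..<n} \<times> X) \<xi>"
    by (rule *; simp add: block_def ell2_outside[OF \<xi>])+
qed

lemma embed_block_ell2:
  assumes f: "f \<in> ell2 X" and i: "i < n"
  shows "embed_block i f \<in> ell2 ({..<n} \<times> X)" "l2_norm ({..<n} \<times> X) (embed_block i f) \<le> l2_norm X f"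
proof -
  have "L2_set (\<lambda>p. cmod (embed_block i f p)) F \<le> l2_norm X f" if F: "finite F" "F \<subseteq> {..<n} \<times> X" for F
  proof -
    let ?F = "{x. (i, x) \<in> F}"
    have fin: "finite ?F"
      by (rule finite_subset[of _ "snd ` F"]) (use F in force)+
    have bij: "bij_betw (Pair i) ?F (Pair i ` ?F)" by (auto simp: bij_betw_def inj_on_def)
    have "L2_set (\<lambda>p. cmod (embed_block i f p)) F = L2_set (\<lambda>p. cmod (embed_block i f p)) (Pair i ` ?F)"
      unfolding L2_set_def
      by (rule arg_cong[of _ _ sqrt], rule sum.mono_neutral_right) (use F in \<open>auto simp: embed_block_def image_iff\<close>)
    also have "\<dots> = L2_set (\<lambda>x. cmod (f x)) ?F"
      by (simp add: L2_set_reindex[OF bij] embed_block_def o_def)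
    also have "\<dots> \<le> l2_norm X f"
      using F by (intro L2_set_le_l2_norm f fin) auto
    finally show ?thesis .
  qed
  note * = ell2_L2_bound[of "{..<n} \<times> X" "embed_block i f", OF _ this]
  have "embed_block i f p = 0" if "p \<notin> {..<n} \<times> X" for p
    using that i ell2_outside[OF f] by (cases p) (auto simp: embed_block_def)
  note out = this
  show "embed_block i f \<in> ell2 ({..<n} \<times> X)"
    by (rule *(1)) (rule out)
  show "l2_norm ({..<n} \<times> X) (embed_block i f) \<le> l2_norm X f"
    by (rule *(2)) (rule out)
qed

text \<open>The decomposition into \<open>E_i m_ij P_j\<close> with coordinate embeddings
  \<open>E_i\<close> and projections \<open>P_j\<close>; boundedness then follows from the triangle
  inequality.\<close>

lemma matrix_op_embed:
  "matrix_op n m \<xi> = (\<lambda>p. \<Sum>(i, j)\<in>{..<n} \<times> {..<n}. embed_block i (m i j (block j \<xi>)) p)"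
proof
  fix p :: "nat \<times> 'a"
  obtain i x where p: "p = (i, x)" by (cases p)
  have "(\<Sum>(i', j)\<in>{..<n} \<times> {..<n}. embed_block i' (m i' j (block j \<xi>)) p)
      = (\<Sum>i'<n. if i' = i then \<Sum>j<n. m i' j (block j \<xi>) x else 0)"
    unfolding sum.cartesian_product[symmetric] by (intro sum.cong refl) (simp add: embed_block_def p)
  also have "\<dots> = matrix_op n m \<xi> p"
    by (simp add: matrix_op_def p block_def)
  finally show "matrix_op n m \<xi> p = (\<Sum>(i, j)\<in>{..<n} \<times> {..<n}. embed_block i (m i j (block j \<xi>)) p)" ..
qed

lemma matrix_op_bounded:
  assumes m: "\<And>i j. i < n \<Longrightarrow> j < n \<Longrightarrow> bounded_linear_l2 X (m i j)"
  shows "bounded_linear_l2 ({..<n} \<times> X) (matrix_op n m)"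
proof -
  have "\<exists>C. 0 < C \<and> (\<forall>f\<in>ell2 X. l2_norm X (m i j f) \<le> C * l2_norm X f)" if "i < n" "j < n" for i j
    using bounded_linear_l2_bound[OF m[OF that]] by metis
  then obtain C where C: "\<And>i j. i < n \<Longrightarrow> j < n \<Longrightarrow> 0 < C i j"
    "\<And>i j f. i < n \<Longrightarrow> j < n \<Longrightarrow> f \<in> ell2 X \<Longrightarrow> l2_norm X (m i j f) \<le> C i j * l2_norm X f"
    by metis
  let ?n = "{..<n} \<times> {..<n}"
  show ?thesis
  \<comment> \<open>Adding up all entry bounds is crude, but only finiteness matters here; sharp
    norms come from \<open>op_norm_le_form_bound\<close>.\<close>
  proof (rule bounded_linear_l2I[where C = "\<Sum>(i, j)\<in>?n. C i j"])
    fix \<xi> assume \<xi>: "\<xi> \<in> ell2 ({..<n} \<times> X)"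
    have e: "embed_block i (m i j (block j \<xi>)) \<in> ell2 ({..<n} \<times> X)" if "i < n" "j < n" for i j
      by (intro embed_block_ell2 bounded_linear_l2D(1)[OF m] block_ell2[OF \<xi>] that)
    show "matrix_op n m \<xi> \<in> ell2 ({..<n} \<times> X)"
      unfolding matrix_op_embed case_prod_unfold by (intro ell2_sum) (auto intro: e)
    have "l2_norm ({..<n} \<times> X) (matrix_op n m \<xi>)
        \<le> (\<Sum>ij\<in>?n. l2_norm ({..<n} \<times> X) (embed_block (fst ij) (m (fst ij) (snd ij) (block (snd ij) \<xi>))))"
      unfolding matrix_op_embed case_prod_unfold by (intro l2_norm_sum_le) (auto intro: e)
    also have "\<dots> \<le> (\<Sum>ij\<in>?n. C (fst ij) (snd ij) * l2_norm ({..<n} \<times> X) \<xi>)"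
    proof (rule sum_mono)
      fix ij assume "ij \<in> ?n"
      then have ij: "fst ij < n" "snd ij < n" by auto
      have "l2_norm ({..<n} \<times> X) (embed_block (fst ij) (m (fst ij) (snd ij) (block (snd ij) \<xi>)))
          \<le> l2_norm X (m (fst ij) (snd ij) (block (snd ij) \<xi>))"
        by (intro embed_block_ell2 bounded_linear_l2D(1)[OF m] block_ell2[OF \<xi>] ij)
      also have "\<dots> \<le> C (fst ij) (snd ij) * l2_norm X (block (snd ij) \<xi>)"
        by (intro C block_ell2[OF \<xi>] ij)
      also have "\<dots> \<le> C (fst ij) (snd ij) * l2_norm ({..<n} \<times> X) \<xi>"
        using C(1)[OF ij] by (intro mult_left_mono block_ell2[OF \<xi>] ij) simp
      finally show "l2_norm ({..<n} \<times> X) (embed_block (fst ij) (m (fst ij) (snd ij) (block (snd ij) \<xi>)))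
          \<le> C (fst ij) (snd ij) * l2_norm ({..<n} \<times> X) \<xi>" .
    qed
    finally show "l2_norm ({..<n} \<times> X) (matrix_op n m \<xi>) \<le> (\<Sum>(i, j)\<in>?n. C i j) * l2_norm ({..<n} \<times> X) \<xi>"
      by (simp add: sum_distrib_right case_prod_unfold)
    have "m i j (\<lambda>y. c * \<xi> (j, y)) x = c * m i j (\<lambda>y. \<xi> (j, y)) x" if "i < n" "j < n" for i j c x
      using bounded_linear_l2D(3)[OF m[OF that] block_ell2(1)[OF \<xi> that(2)], of c]
      by (simp add: block_def)
    then show "matrix_op n m (\<lambda>p. c * \<xi> p) = (\<lambda>p. c * matrix_op n m \<xi> p)" for c
      by (auto simp: matrix_op_def fun_eq_iff sum_distrib_left)
    fix \<eta> assume \<eta>: "\<eta> \<in> ell2 ({..<n} \<times> X)"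
    have "m i j (\<lambda>y. \<xi> (j, y) + \<eta> (j, y)) x = m i j (\<lambda>y. \<xi> (j, y)) x + m i j (\<lambda>y. \<eta> (j, y)) x"
      if "i < n" "j < n" for i j x
      using bounded_linear_l2D(2)[OF m[OF that] block_ell2(1)[OF \<xi> that(2)] block_ell2(1)[OF \<eta> that(2)]]
      by (simp add: block_def)
    then show "matrix_op n m (\<lambda>p. \<xi> p + \<eta> p) = (\<lambda>p. matrix_op n m \<xi> p + matrix_op n m \<eta> p)"
      by (auto simp: matrix_op_def fun_eq_iff sum.distrib)
  qed
qed

lemma matrix_op_delta:
  assumes m: "\<And>i j. i < n \<Longrightarrow> j < n \<Longrightarrow> bounded_linear_l2 X (m i j)" and ij: "i < n" "j < n"
  shows "matrix_op n m (delta (j, t)) (i, s) = m i j (delta t) s"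
proof -
  have "m i j' (\<lambda>y. delta (j, t) (j', y)) s = (if j' = j then m i j (delta t) s else 0)" if "j' < n" for j'
  proof (cases "j' = j")
    case True
    then show ?thesis by (simp add: delta_def)
  next
    case False
    then have "(\<lambda>y. delta (j, t) (j', y)) = (\<lambda>y. 0)" by (simp add: delta_def)
    then show ?thesis using False l2_op_zero[OF m[OF ij(1) that]] by simp
  qed
  then show ?thesis using ij by (simp add: matrix_op_def)
qed

section \<open>Fourier multipliers\<close>

lemma summable_inner:
  assumes \<xi>: "square_summable_seq X \<xi>" and \<eta>: "square_summable_seq X \<eta>"
    and T: "\<And>f. f \<in> ell2 X \<Longrightarrow> T f \<in> ell2 X" "\<And>f. f \<in> ell2 X \<Longrightarrow> l2_norm X (T f) \<le> l2_norm X f"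
  shows "summable (\<lambda>n. l2_inner X (T (\<xi> n)) (\<eta> n))"
proof (rule summable_comparison_test')
  show "summable (\<lambda>n. (l2_norm X (\<xi> n))\<^sup>2 + (l2_norm X (\<eta> n))\<^sup>2)"
    using \<xi> \<eta> by (intro summable_add) (simp_all add: square_summable_seq_def)
  fix n
  have e: "\<xi> n \<in> ell2 X" "\<eta> n \<in> ell2 X" using \<xi> \<eta> by (simp_all add: square_summable_seq_def)
  have "cmod (l2_inner X (T (\<xi> n)) (\<eta> n)) \<le> l2_norm X (T (\<xi> n)) * l2_norm X (\<eta> n)"
    by (intro l2_inner_summable T e)
  also have "\<dots> \<le> l2_norm X (\<xi> n) * l2_norm X (\<eta> n)"
    by (intro mult_right_mono T e) simp
  also have "\<dots> \<le> (l2_norm X (\<xi> n))\<^sup>2 + (l2_norm X (\<eta> n))\<^sup>2"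
  proof -
    have "2 * (l2_norm X (\<xi> n) * l2_norm X (\<eta> n)) \<le> (l2_norm X (\<xi> n))\<^sup>2 + (l2_norm X (\<eta> n))\<^sup>2"
      using sum_squares_bound[of "l2_norm X (\<xi> n)" "l2_norm X (\<eta> n)"] by (simp add: mult.assoc)
    moreover have "0 \<le> l2_norm X (\<xi> n) * l2_norm X (\<eta> n)" by simp
    ultimately show ?thesis by linarith
  qed
  finally show "norm (l2_inner X (T (\<xi> n)) (\<eta> n)) \<le> (l2_norm X (\<xi> n))\<^sup>2 + (l2_norm X (\<eta> n))\<^sup>2" .
qed

lemma square_summable_delta:
  assumes "y \<in> X"
  shows "square_summable_seq X (\<lambda>n. if n = 0 then delta y else (\<lambda>x. 0))"
proof -
  have "summable (\<lambda>n. (l2_norm X (if n = 0 then delta y else (\<lambda>x. 0)))\<^sup>2)"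
    by (rule summable_finite[of "{0}"]) auto
  then show ?thesis using assms by (simp add: square_summable_seq_def)
qed

lemma openin_sigma_weak:
  assumes "square_summable_seq X \<xi>" "square_summable_seq X \<eta>" "open U"
  shows "openin (sigma_weak_topology X) {T \<in> bounded_ops X. (\<Sum>n. l2_inner X (T (\<xi> n)) (\<eta> n)) \<in> U}"
  unfolding sigma_weak_topology_def by (rule topology_generated_by_Basis) (use assms in blast)

lemma topspace_sigma_weak: "topspace (sigma_weak_topology X) = bounded_ops X"
proof
  show "topspace (sigma_weak_topology X) \<subseteq> bounded_ops X"
    unfolding sigma_weak_topology_def by auto
  \<comment> \<open>For zero sequences and \<open>U = UNIV\<close> the condition is void, so all of
    \<open>bounded_ops X\<close> is one of the generating open sets.\<close>
  have "square_summable_seq X (\<lambda>n x. 0)" by (simp add: square_summable_seq_def)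
  from openin_subset[OF openin_sigma_weak[OF this this open_UNIV]]
  show "bounded_ops X \<subseteq> topspace (sigma_weak_topology X)" by simp
qed

text \<open>Sequences with a single nonzero term turn the defining functionals of the topology into
  matrix coefficients.\<close>

lemma continuous_map_coefficient:
  assumes "x \<in> X" "y \<in> X"
  shows "continuous_map (sigma_weak_topology X) euclidean (\<lambda>T. T (delta y) x)"
  unfolding continuous_map
proof (intro conjI allI impI)
  fix U :: "complex set" assume "openin euclidean U"
  then have U: "open U" by simp
  let ?\<xi> = "\<lambda>y n. if n = (0::nat) then delta y else (\<lambda>x. 0)"
  have "(\<Sum>n. l2_inner X (T (?\<xi> y n)) (?\<xi> x n)) = T (delta y) x" for T
  proof -
    have "(\<Sum>n. l2_inner X (T (?\<xi> y n)) (?\<xi> x n)) = (\<Sum>n\<in>{0}. l2_inner X (T (?\<xi> y n)) (?\<xi> x n))"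
      by (rule suminf_finite) (auto simp: l2_inner_def)
    then show ?thesis using assms(1) by (simp add: l2_inner_delta)
  qed
  then show "openin (sigma_weak_topology X) {T \<in> topspace (sigma_weak_topology X). T (delta y) x \<in> U}"
    using openin_sigma_weak[OF square_summable_delta[OF assms(2)] square_summable_delta[OF assms(1)] U]
    by (simp add: topspace_sigma_weak)
qed simp

text \<open>\<open>T (delta \<one>) g\<close> is the Fourier coefficient of \<open>T\<close> at
  \<open>g\<close>. Since \<phi> will have finite support, the finite sum defines the multiplier on
  the whole von Neumann algebra at once, with no extension from the group ring.\<close>

definition fourier_multiplier ::
    "('a, 'b) monoid_scheme \<Rightarrow> ('a \<Rightarrow> complex) \<Rightarrow> 'a operator \<Rightarrow> 'a operator" where
  "fourier_multiplier G \<phi> T = (\<lambda>f x. \<Sum>g | g \<in> carrier G \<and> \<phi> g \<noteq> 0.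
     \<phi> g * T (delta \<one>\<^bsub>G\<^esub>) g * left_regular G g f x)"

context
  fixes G :: "('a, 'b) monoid_scheme" and \<phi> :: "'a \<Rightarrow> complex"
  assumes G: "group G" and fin: "finite {g \<in> carrier G. \<phi> g \<noteq> 0}"
begin

text \<open>Only \<open>g = s t^-1\<close> contributes to the entry at \<open>s\<close> and
  \<open>t\<close>; this is how a Fourier multiplier becomes a Schur multiplier.\<close>

lemma fourier_multiplier_coefficient:
  assumes T: "T \<in> group_vN G" and s: "s \<in> carrier G" and t: "t \<in> carrier G"
  shows "fourier_multiplier G \<phi> T (delta t) s = multiplier_kernel G \<phi> s t * T (delta t) s"
proof -
  interpret group G by (rule G)
  let ?K = "{g \<in> carrier G. \<phi> g \<noteq> 0}"
  let ?d = "\<lambda>g. \<phi> g * T (delta \<one>\<^bsub>G\<^esub>) g"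
  have st: "s \<otimes>\<^bsub>G\<^esub> inv\<^bsub>G\<^esub> t \<in> carrier G" using s t by simp
  have "fourier_multiplier G \<phi> T (delta t) s = (\<Sum>g\<in>?K. if s \<otimes>\<^bsub>G\<^esub> inv\<^bsub>G\<^esub> t = g then ?d g else 0)"
    unfolding fourier_multiplier_def using s t
    by (intro sum.cong refl) (auto simp: left_regular_delta[OF G])
  also have "\<dots> = (if s \<otimes>\<^bsub>G\<^esub> inv\<^bsub>G\<^esub> t \<in> ?K then ?d (s \<otimes>\<^bsub>G\<^esub> inv\<^bsub>G\<^esub> t) else 0)"
    by (rule sum.delta'[OF fin])
  also have "\<dots> = multiplier_kernel G \<phi> s t * T (delta t) s"
    using st by (auto simp: multiplier_kernel_def group_vN_coefficient[OF G T t s])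
  finally show ?thesis .
qed

lemma fourier_multiplier_group_vN: "fourier_multiplier G \<phi> T \<in> group_vN G"
  unfolding fourier_multiplier_def
  by (rule group_vN_sum[OF G]) (auto intro: left_regular_in_group_vN[OF G])

lemma fourier_multiplier_linear: "linear_map_on (group_vN G) (fourier_multiplier G \<phi>)"
  unfolding linear_map_on_def
  by (simp add: fourier_multiplier_group_vN)
    (simp add: fourier_multiplier_def algebra_simps sum.distrib sum_distrib_left)

lemma fourier_multiplier_finite_rank: "finite_rank_on (group_vN G) (fourier_multiplier G \<phi>)"
  unfolding finite_rank_on_def
proof (intro exI[of _ "left_regular G ` {g \<in> carrier G. \<phi> g \<noteq> 0}"] conjI ballI)
  let ?K = "{g \<in> carrier G. \<phi> g \<noteq> 0}"
  show "finite (left_regular G ` ?K)" using fin by simp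
  show "left_regular G ` ?K \<subseteq> group_vN G" by (auto intro: left_regular_in_group_vN[OF G])
  fix T
  \<comment> \<open>The span is indexed by operators, so the coefficients of all group elements with
    the same translation operator are added.\<close>
  let ?c = "\<lambda>S. \<Sum>g | g \<in> ?K \<and> left_regular G g = S. \<phi> g * T (delta \<one>\<^bsub>G\<^esub>) g"
  have "fourier_multiplier G \<phi> T f x = (\<Sum>S\<in>left_regular G ` ?K. ?c S * S f x)" for f x
    unfolding fourier_multiplier_def sum_distrib_right
    by (subst sum.image_gen[OF fin, where g = "left_regular G"]) (auto intro!: sum.cong)
  then show "\<exists>c :: 'a operator \<Rightarrow> complex. fourier_multiplier G \<phi> T
      = (\<lambda>f x. \<Sum>S\<in>left_regular G ` ?K. c S * S f x)"
    by (intro exI[of _ ?c] ext)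
qed

lemma fourier_multiplier_continuous: "sigma_weakly_continuous (carrier G) (group_vN G) (fourier_multiplier G \<phi>)"
proof -
  interpret group G by (rule G)
  let ?X = "carrier G" and ?A = "group_vN G" and ?K = "{g \<in> carrier G. \<phi> g \<noteq> 0}"
  let ?top = "subtopology (sigma_weak_topology ?X) ?A"
  have A: "?A \<subseteq> bounded_ops ?X" using group_vN_bounded by blast
  then have top: "topspace ?top = ?A" by (auto simp: topspace_sigma_weak)
  have "continuous_map ?top (sigma_weak_topology ?X) (fourier_multiplier G \<phi>)"
    unfolding sigma_weak_topology_def[of ?X]
  proof (rule continuous_on_generated_topo, unfold sigma_weak_topology_def[of ?X, symmetric])
    have "fourier_multiplier G \<phi> T \<in> topspace (sigma_weak_topology ?X)" for T
      using fourier_multiplier_group_vN A by (auto simp: topspace_sigma_weak)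
    then show "fourier_multiplier G \<phi> ` topspace ?top \<subseteq>
      \<Union> {{T \<in> bounded_ops ?X. (\<Sum>n. l2_inner ?X (T (\<xi> n)) (\<eta> n)) \<in> U} | \<xi> \<eta> U.
        square_summable_seq ?X \<xi> \<and> square_summable_seq ?X \<eta> \<and> open U}"
      unfolding sigma_weak_topology_def by auto
    fix V
    assume "V \<in> {{T \<in> bounded_ops ?X. (\<Sum>n. l2_inner ?X (T (\<xi> n)) (\<eta> n)) \<in> U} | \<xi> \<eta> U.
        square_summable_seq ?X \<xi> \<and> square_summable_seq ?X \<eta> \<and> open U}"
    then obtain \<xi> \<eta> U where V: "V = {T \<in> bounded_ops ?X. (\<Sum>n. l2_inner ?X (T (\<xi> n)) (\<eta> n)) \<in> U}"
      and \<xi>: "square_summable_seq ?X \<xi>" and \<eta>: "square_summable_seq ?X \<eta>" and U: "open U"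
      by blast
    \<comment> \<open>The value of the functional at \<open>left_regular G g\<close>. Composed with
      the multiplier, the functional becomes a finite combination of Fourier coefficients of
      \<open>T\<close>, each of which is continuous.\<close>
    define c where "c g = (\<Sum>n. l2_inner ?X (left_regular G g (\<xi> n)) (\<eta> n))" for g
    have eq: "(\<Sum>n. l2_inner ?X (fourier_multiplier G \<phi> T (\<xi> n)) (\<eta> n)) = (\<Sum>g\<in>?K. \<phi> g * c g * T (delta \<one>\<^bsub>G\<^esub>) g)"
      for T
    proof -
      let ?d = "\<lambda>g. \<phi> g * T (delta \<one>\<^bsub>G\<^esub>) g"
      have ell2: "left_regular G g f \<in> ell2 ?X" if "g \<in> ?X" for g f
        using that by (intro bounded_ops_ell2 left_regular_bounded[OF G])
      have "l2_inner ?X (fourier_multiplier G \<phi> T (\<xi> n)) (\<eta> n)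
          = (\<Sum>g\<in>?K. ?d g * l2_inner ?X (left_regular G g (\<xi> n)) (\<eta> n))" for n
        unfolding fourier_multiplier_def using \<eta>
        by (subst l2_inner_sum) (auto simp: l2_inner_cmult square_summable_seq_def intro!: ell2_cmult ell2)
      moreover have s: "summable (\<lambda>n. l2_inner ?X (left_regular G g (\<xi> n)) (\<eta> n))" if "g \<in> ?K" for g
        using that by (intro summable_inner[OF \<xi> \<eta>] ell2 l2_norm_left_regular[OF G]) auto
      ultimately have "(\<Sum>n. l2_inner ?X (fourier_multiplier G \<phi> T (\<xi> n)) (\<eta> n))
          = (\<Sum>g\<in>?K. \<Sum>n. ?d g * l2_inner ?X (left_regular G g (\<xi> n)) (\<eta> n))"
        by (simp only:) (intro suminf_sum summable_mult)
      also have "\<dots> = (\<Sum>g\<in>?K. ?d g * c g)"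
        unfolding c_def by (intro sum.cong refl suminf_mult s)
      finally show ?thesis by (simp only: mult_ac)
    qed
    have "continuous_map ?top euclidean (\<lambda>T. T (delta \<one>\<^bsub>G\<^esub>) g)" if "g \<in> ?K" for g
      using that by (intro continuous_map_from_subtopology continuous_map_coefficient) auto
    then have "continuous_map ?top euclidean (\<lambda>T. \<phi> g * c g * T (delta \<one>\<^bsub>G\<^esub>) g)" if "g \<in> ?K" for g
      using that by (simp add: continuous_map_atin tendsto_mult_left)
    then have "continuous_map ?top euclidean (\<lambda>T. \<Sum>g\<in>?K. \<phi> g * c g * T (delta \<one>\<^bsub>G\<^esub>) g)"
      by (intro continuous_map_sum fin)
    then have "openin ?top (topspace ?top \<inter> (\<lambda>T. \<Sum>g\<in>?K. \<phi> g * c g * T (delta \<one>\<^bsub>G\<^esub>) g) -` U)"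
      unfolding continuous_map_openin_preimage_eq using U by simp
    also have "topspace ?top \<inter> (\<lambda>T. \<Sum>g\<in>?K. \<phi> g * c g * T (delta \<one>\<^bsub>G\<^esub>) g) -` U
        = fourier_multiplier G \<phi> -` V \<inter> topspace ?top"
      using fourier_multiplier_group_vN A by (auto simp: V eq)
    finally show "openin ?top (fourier_multiplier G \<phi> -` V \<inter> topspace ?top)" .
  qed
  then show ?thesis
    unfolding sigma_weakly_continuous_def continuous_map_in_subtopology
    using fourier_multiplier_group_vN by auto
qed

text \<open>Entries of an amplified operator are indexed by pairs \<open>(i, s)\<close>, and the
  multiplier sees only the group coordinate \<open>s\<close>. This is \<open>schur_bound\<close> for
  the family \<open>snd\<close>, whose repetitions account for the matrix size.\<close>

lemma fourier_multiplier_cb_norm: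
  assumes C: "0 \<le> C" and schur: "schur_bound (carrier G) (multiplier_kernel G \<phi>) C"
  shows "cb_norm (carrier G) (group_vN G) (fourier_multiplier G \<phi>) \<le> ennreal C"
  unfolding cb_norm_def
proof (intro SUP_least ennreal_leI)
  fix n and m :: "nat \<Rightarrow> nat \<Rightarrow> 'a operator"
  let ?X = "carrier G" and ?\<Phi> = "fourier_multiplier G \<phi>"
  assume m: "m \<in> {m. (\<forall>i<n. \<forall>j<n. m i j \<in> group_vN G) \<and> matrix_norm ?X n m \<le> 1}"
  have mvN: "m i j \<in> group_vN G" if "i < n" "j < n" for i j
    using m that by simp
  have lin: "bounded_linear_l2 ?X (m i j)" if "i < n" "j < n" for i j
    by (intro bounded_opsD group_vN_bounded mvN that)
  have lin': "bounded_linear_l2 ?X (?\<Phi> (m i j))" if "i < n" "j < n" for i j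
    by (intro bounded_opsD group_vN_bounded fourier_multiplier_group_vN)
  have "op_norm ({..<n} \<times> ?X) (matrix_op n (\<lambda>i j. ?\<Phi> (m i j))) \<le> C"
  proof (rule op_norm_le_form_bound[OF matrix_op_bounded[OF lin'] C])
    fix I assume I: "finite I" "I \<subseteq> {..<n} \<times> ?X"
    have p: "snd p \<in> ?X" if "p \<in> I" for p using I(2) that by auto
    have le: "op_norm ({..<n} \<times> ?X) (matrix_op n m) \<le> 1" using m by (simp add: matrix_norm_def)
    show "form_bound I (\<lambda>x y. matrix_op n (\<lambda>i j. ?\<Phi> (m i j)) (delta y) x) C"
    proof (rule form_bound_cong[OF schur_boundD1[OF schur I(1) p form_bound_op_norm[OF matrix_op_bounded[OF lin] I le]]])
      fix p q assume pq: "p \<in> I" "q \<in> I"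
      obtain i s j t where [simp]: "p = (i, s)" "q = (j, t)" by (cases p, cases q)
      have ij: "i < n" "j < n" and st: "s \<in> ?X" "t \<in> ?X" using pq I(2) by auto
      show "multiplier_kernel G \<phi> (snd p) (snd q) * matrix_op n m (delta q) p
          = matrix_op n (\<lambda>i j. ?\<Phi> (m i j)) (delta q) p"
        using matrix_op_delta[OF lin ij, where t = t and s = s] matrix_op_delta[OF lin' ij, where t = t and s = s]
          fourier_multiplier_coefficient[OF mvN[OF ij] st] by simp
    qed
  qed
  then show "matrix_norm ?X n (\<lambda>i j. ?\<Phi> (m i j)) \<le> C" by (simp add: matrix_norm_def)
qed

end

text \<open>On the column at the identity, the multiplier minus the identity map is multiplication
  by \<open>\<phi> - 1\<close>. This factor is small on a finite set \<open>K\<close>; off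
  \<open>K\<close> it is bounded by \<open>C + 1\<close>, while the column itself has small norm
  there.\<close>

lemma Lambda_cb_le:
  assumes G: "group G" and C: "0 < C" and approx: "multiplier_approx G C"
  shows "Lambda_cb G \<le> ennreal C"
  unfolding Lambda_cb_def Lambda_cb_vN_def
proof (rule Inf_lower, rule CollectI, intro exI[of _ C] conjI refl C allI impI, elim conjE)
  interpret group G by (rule G)
  let ?X = "carrier G" and ?e = "delta \<one>\<^bsub>G\<^esub> :: 'a vec"
  fix F :: "'a operator set" and \<epsilon> :: real
  assume F: "finite F" "F \<subseteq> {T \<in> group_vN G. op_norm ?X T \<le> 1}" and \<epsilon>: "0 < \<epsilon>"
  have ell2: "T ?e \<in> ell2 ?X" if "T \<in> F" for T
    using F(2) that by (intro bounded_ops_ell2 group_vN_bounded) auto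
  \<comment> \<open>Half of \<epsilon> goes to the part off \<open>K\<close>, where the factor
    \<open>C + 1\<close> occurs; the other half is spent through \<delta> on
    \<open>K\<close>.\<close>
  define \<gamma> where "\<gamma> = \<epsilon> / (2 * (C + 1))"
  have \<gamma>: "0 < \<gamma>" using \<epsilon> C by (simp add: \<gamma>_def)
  have "\<forall>\<^sub>F K in finite_subsets_at_top ?X. \<forall>T\<in>F. l2_norm ?X (\<lambda>x. T ?e x - truncate K (T ?e) x) < \<gamma>"
    by (intro eventually_ball_finite[OF F(1)] ballI order_tendstoD(2)[OF tendsto_l2_norm_truncate] ell2 \<gamma>)
  then obtain K where K0: "finite K" "K \<subseteq> ?X"
    and "\<forall>Y. finite Y \<and> K \<subseteq> Y \<and> Y \<subseteq> ?X \<longrightarrow> (\<forall>T\<in>F. l2_norm ?X (\<lambda>x. T ?e x - truncate Y (T ?e) x) < \<gamma>)"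
    unfolding eventually_finite_subsets_at_top by (elim exE conjE) (rule that)
  from this(3)[rule_format, of K] K0
  have K: "finite K" "K \<subseteq> ?X" "\<And>T. T \<in> F \<Longrightarrow> l2_norm ?X (\<lambda>x. T ?e x - truncate K (T ?e) x) < \<gamma>"
    by simp_all
  \<comment> \<open>A strict common bound for the columns; the summand 1 keeps it positive even if
    all columns vanish.\<close>
  define M where "M = (\<Sum>T\<in>F. l2_norm ?X (T ?e)) + 1"
  have M: "0 < M" unfolding M_def by (simp add: add_nonneg_pos sum_nonneg)
  have M_ge: "l2_norm ?X (T ?e) < M" if "T \<in> F" for T
    unfolding M_def using member_le_sum[of T F "\<lambda>T. l2_norm ?X (T ?e)"] F(1) that by simp
  define \<delta> where "\<delta> = \<epsilon> / (2 * M)"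
  have \<delta>: "0 < \<delta>" using \<epsilon> M by (simp add: \<delta>_def)
  obtain \<phi> where fin: "finite {g \<in> ?X. \<phi> g \<noteq> 0}" and near: "\<And>g. g \<in> K \<Longrightarrow> cmod (\<phi> g - 1) < \<delta>"
    and schur: "schur_bound ?X (multiplier_kernel G \<phi>) C"
    by (rule multiplier_approxD[OF approx K(1,2) \<delta>]) (rule that)
  have \<phi>_le: "cmod (\<phi> g - 1) \<le> C + 1" if "g \<in> ?X" for g
    using schur_bound_le[OF schur that one_closed] norm_triangle_ineq4[of "\<phi> g" 1] that
    by (simp add: multiplier_kernel_def)
  let ?\<Phi> = "fourier_multiplier G \<phi>"
  have "norm2 ?X (group_trace G) (\<lambda>f x. ?\<Phi> T f x - T f x) < \<epsilon>" if T: "T \<in> F" for T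
  proof -
    have TvN: "T \<in> group_vN G" using F(2) T by auto
    let ?t = "T ?e" and ?w = "\<lambda>x. \<phi> x - 1"
    have coeff: "?\<Phi> T ?e x - ?t x = ?w x * ?t x" for x
    proof (cases "x \<in> ?X")
      case True
      then show ?thesis
        using fourier_multiplier_coefficient[OF G fin TvN True one_closed]
        by (simp add: multiplier_kernel_def left_diff_distrib)
    next
      case False
      have "?\<Phi> T ?e \<in> ell2 ?X"
        by (intro bounded_ops_ell2 group_vN_bounded fourier_multiplier_group_vN G fin)
      from ell2_outside[OF this False] ell2_outside[OF ell2[OF T] False]
      show ?thesis by simp
    qed
    have "(\<lambda>f x. ?\<Phi> T f x - T f x) \<in> bounded_ops ?X"
      by (intro group_vN_bounded group_vN_diff fourier_multiplier_group_vN G fin TvN)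
    then have "norm2 ?X (group_trace G) (\<lambda>f x. ?\<Phi> T f x - T f x) = l2_norm ?X (\<lambda>x. ?w x * ?t x)"
      using norm2_group_trace[OF G] by (simp only: coeff)
    also have "\<dots> = l2_norm ?X (\<lambda>x. truncate K ?w x * ?t x + ?w x * (?t x - truncate K ?t x))"
      by (rule arg_cong[of _ _ "l2_norm ?X"]) (auto simp: truncate_def)
    also have "\<dots> \<le> l2_norm ?X (\<lambda>x. truncate K ?w x * ?t x) + l2_norm ?X (\<lambda>x. ?w x * (?t x - truncate K ?t x))"
      using \<phi>_le C K near \<delta>
      by (intro ell2_add l2_norm_weight_le[where B = \<delta>] l2_norm_weight_le[where B = "C + 1"] ell2_diff truncate_ell2 ell2[OF T])
        (auto simp: truncate_def less_imp_le)
    also have "\<dots> \<le> \<delta> * l2_norm ?X ?t + (C + 1) * l2_norm ?X (\<lambda>x. ?t x - truncate K ?t x)"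
      using \<phi>_le C K near \<delta>
      by (intro add_mono l2_norm_weight_le ell2_diff truncate_ell2 ell2[OF T]) (auto simp: truncate_def less_imp_le)
    also have "\<dots> < \<delta> * M + (C + 1) * \<gamma>"
      using M_ge[OF T] K(3)[OF T] \<delta> C by (intro add_strict_mono mult_strict_left_mono) auto
    also have "\<dots> = \<epsilon>" using M C by (simp add: \<delta>_def \<gamma>_def field_simps)
    finally show ?thesis .
  qed
  then show "\<exists>\<Phi>. linear_map_on (group_vN G) \<Phi> \<and> sigma_weakly_continuous ?X (group_vN G) \<Phi> \<and>
      finite_rank_on (group_vN G) \<Phi> \<and>
      (\<forall>T\<in>F. norm2 ?X (group_trace G) (\<lambda>f x. \<Phi> T f x - T f x) < \<epsilon>) \<and>
      cb_norm ?X (group_vN G) \<Phi> \<le> ennreal C"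
    using C by (intro exI[of _ ?\<Phi>] conjI ballI fourier_multiplier_linear[OF G fin]
        fourier_multiplier_continuous[OF G fin] fourier_multiplier_finite_rank[OF G fin]
        fourier_multiplier_cb_norm[OF G fin _ schur]) auto
qed

section \<open>From finite rank maps to multipliers\<close>

text \<open>Gram-Schmidt. A vector already in the span adds nothing, so \<open>d\<close> may be
  smaller than the cardinality of \<open>B\<close>.\<close>

lemma orthonormal_basis:
  assumes "finite B" "B \<subseteq> ell2 X"
  shows "\<exists>(d :: nat) e. (\<forall>k<d. e k \<in> ell2 X) \<and>
    (\<forall>k<d. \<forall>l<d. l2_inner X (e k) (e l) = (if k = l then 1 else 0)) \<and>
    (\<forall>b\<in>B. \<exists>a. b = (\<lambda>x. \<Sum>k<d. a k * e k x))"
  using assms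
proof (induction B rule: finite_induct)
  case empty
  show ?case by (rule exI[of _ 0]) simp
next
  case (insert b B)
  have B_sub: "B \<subseteq> ell2 X" using insert.prems by simp
  obtain d :: nat and e where e: "\<And>k. k < d \<Longrightarrow> e k \<in> ell2 X"
    and on: "\<And>k l. k < d \<Longrightarrow> l < d \<Longrightarrow> l2_inner X (e k) (e l) = (if k = l then 1 else 0)"
    and B: "\<forall>b\<in>B. \<exists>a. b = (\<lambda>x. \<Sum>k<d. a k * e k x)"
    using insert.IH[OF B_sub] by (elim exE conjE) (rule that; simp)
  have b: "b \<in> ell2 X" using insert.prems by simp
  define p where "p = (\<lambda>x. \<Sum>k<d. l2_inner X b (e k) * e k x)"
  define c where "c = (\<lambda>x. b x - p x)"
  have p: "p \<in> ell2 X" unfolding p_def by (intro ell2_sum ell2_cmult e) simp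
  have c: "c \<in> ell2 X" unfolding c_def by (intro ell2_diff b p)
  have orth: "l2_inner X c (e l) = 0" if l: "l < d" for l
  proof -
    have "l2_inner X p (e l) = (\<Sum>k<d. l2_inner X (\<lambda>x. l2_inner X b (e k) * e k x) (e l))"
      unfolding p_def by (intro l2_inner_sum ell2_cmult e l) simp
    also have "\<dots> = (\<Sum>k<d. if k = l then l2_inner X b (e k) else 0)"
      by (intro sum.cong refl) (simp add: l2_inner_cmult on l)
    also have "\<dots> = l2_inner X b (e l)" using l by simp
    finally show ?thesis unfolding c_def by (simp add: l2_inner_diff b p e l)
  qed
  show ?case
  proof (cases "l2_norm X c = 0")
    case True
    then have "c x = 0" for x using cmod_le_l2_norm[OF c, of x] by simp
    then have "b = p" by (simp add: c_def fun_eq_iff)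
    then have "\<exists>a. b = (\<lambda>x. \<Sum>k<d. a k * e k x)"
      unfolding p_def by (intro exI[of _ "\<lambda>k. l2_inner X b (e k)"])
    then show ?thesis using e on B by (intro exI[of _ d] exI[of _ e]) auto
  next
    case False
    let ?n = "of_real (l2_norm X c) :: complex"
    define u where "u = (\<lambda>x. (1 / ?n) * c x)"
    let ?e = "e(d := u)"
    have n0: "?n \<noteq> 0" using False by simp
    have u: "u \<in> ell2 X" unfolding u_def by (intro ell2_cmult c)
    have uu: "l2_inner X u u = 1"
    proof -
      have "l2_norm X u = 1"
        unfolding u_def l2_norm_cmult using False by (simp add: norm_divide)
      then show ?thesis by (simp add: l2_inner_self[OF u])
    qed
    have ue: "l2_inner X u (e l) = 0" if "l < d" for l
      unfolding u_def l2_inner_cmult by (simp add: orth that)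
    have eu: "l2_inner X (e l) u = 0" if "l < d" for l
      using ue[OF that] l2_inner_commute[of X "e l" u] by simp
    have sum_upd: "(\<Sum>k<Suc d. a k * ?e k x) = (\<Sum>k<d. a k * e k x) + a d * u x" for a x
      by simp
    show ?thesis
    proof (intro exI[of _ "Suc d"] exI[of _ ?e] conjI allI impI ballI)
      show "?e k \<in> ell2 X" if "k < Suc d" for k
        using that e u by (cases "k = d") auto
      show "l2_inner X (?e k) (?e l) = (if k = l then 1 else 0)" if "k < Suc d" "l < Suc d" for k l
        using that on uu ue eu by (cases "k = d"; cases "l = d") auto
      fix b' assume "b' \<in> insert b B"
      then show "\<exists>a. b' = (\<lambda>x. \<Sum>k<Suc d. a k * ?e k x)"
      proof
        assume "b' = b"
        have "b = (\<lambda>x. \<Sum>k<Suc d. (if k = d then ?n else l2_inner X b (e k)) * ?e k x)"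
        proof
          fix x
          have "b x = p x + ?n * u x" using n0 by (simp add: u_def c_def)
          then show "b x = (\<Sum>k<Suc d. (if k = d then ?n else l2_inner X b (e k)) * ?e k x)"
            unfolding sum_upd by (simp add: p_def)
        qed
        then show ?thesis unfolding \<open>b' = b\<close> by (intro exI)
      next
        assume "b' \<in> B"
        then obtain a where a: "b' = (\<lambda>x. \<Sum>k<d. a k * e k x)" using B by blast
        have "b' = (\<lambda>x. \<Sum>k<Suc d. (if k = d then 0 else a k) * ?e k x)"
          unfolding sum_upd by (simp add: a)
        then show ?thesis by (intro exI)
      qed
    qed
  qed
qed

text \<open>Evaluation at \<open>x\<close> on a finite-dimensional space, estimated by
  Cauchy-Schwarz in an orthonormal basis. The point is the last factor: it does not depend on
  \<open>c\<close> and is square summable in \<open>x\<close>.\<close>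

lemma finite_span_pointwise_bound:
  assumes "finite B" "B \<subseteq> ell2 X"
  obtains d :: nat and e where "\<And>k. k < d \<Longrightarrow> e k \<in> ell2 X"
    "\<And>c x. cmod (\<Sum>b\<in>B. c b * b x) \<le> l2_norm X (\<lambda>x. \<Sum>b\<in>B. c b * b x) * L2_set (\<lambda>k. cmod (e k x)) {..<d}"
proof -
  obtain d :: nat and e where e: "\<And>k. k < d \<Longrightarrow> e k \<in> ell2 X"
    and on: "\<And>k l. k < d \<Longrightarrow> l < d \<Longrightarrow> l2_inner X (e k) (e l) = (if k = l then 1 else 0)"
    and B: "\<forall>b\<in>B. \<exists>a. b = (\<lambda>x. \<Sum>k<d. a k * e k x)"
    using orthonormal_basis[OF assms] by (elim exE conjE) (rule that; simp)
  obtain a where a: "\<And>b. b \<in> B \<Longrightarrow> b = (\<lambda>x. \<Sum>k<d. a b k * e k x)"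
    using bchoice[OF B] by blast
  show thesis
  proof (rule that[OF e])
    fix c x
    define s where "s k = (\<Sum>b\<in>B. c b * a b k)" for k
    define v where "v = (\<lambda>x. \<Sum>k<d. s k * e k x)"
    have v: "v \<in> ell2 X" unfolding v_def by (intro ell2_sum ell2_cmult e) simp
    have eq: "(\<Sum>b\<in>B. c b * b y) = v y" for y
    proof -
      have "(\<Sum>b\<in>B. c b * b y) = (\<Sum>b\<in>B. c b * (\<Sum>k<d. a b k * e k y))"
        using a by (intro sum.cong refl arg_cong2[of _ _ _ _ "(*)"]) (auto dest: fun_cong)
      also have "\<dots> = v y"
        unfolding v_def s_def sum_distrib_left sum_distrib_right
        by (subst sum.swap) (simp only: mult.assoc)
      finally show ?thesis .
    qed
    have "l2_inner X v (e l) = s l" if l: "l < d" for l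
    proof -
      have "l2_inner X v (e l) = (\<Sum>k<d. l2_inner X (\<lambda>x. s k * e k x) (e l))"
        unfolding v_def by (intro l2_inner_sum ell2_cmult e l) simp
      also have "\<dots> = (\<Sum>k<d. if k = l then s k else 0)"
        by (intro sum.cong refl) (simp add: l2_inner_cmult on l)
      finally show ?thesis using l by simp
    qed
    then have ev: "l2_inner X (e l) v = cnj (s l)" if "l < d" for l
      using that l2_inner_commute[of X "e l" v] by simp
    have "l2_inner X v v = (\<Sum>k<d. l2_inner X (\<lambda>x. s k * e k x) v)"
      by (subst (1) v_def, intro l2_inner_sum ell2_cmult e v) simp
    also have "\<dots> = (\<Sum>k<d. of_real ((cmod (s k))\<^sup>2))"
      by (intro sum.cong refl, unfold complex_norm_square) (simp add: l2_inner_cmult ev)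
    also have "\<dots> = of_real ((L2_set (\<lambda>k. cmod (s k)) {..<d})\<^sup>2)"
      unfolding L2_set_sq by simp
    finally have "(l2_norm X v)\<^sup>2 = (L2_set (\<lambda>k. cmod (s k)) {..<d})\<^sup>2"
      unfolding l2_inner_self[OF v] of_real_eq_iff .
    then have norm: "l2_norm X v = L2_set (\<lambda>k. cmod (s k)) {..<d}"
      by (simp add: power2_eq_iff_nonneg)
    show "cmod (\<Sum>b\<in>B. c b * b x) \<le> l2_norm X (\<lambda>x. \<Sum>b\<in>B. c b * b x) * L2_set (\<lambda>k. cmod (e k x)) {..<d}"
      unfolding eq norm[unfolded v_def] using cmod_sum_mult_le[of s "\<lambda>k. e k x" "{..<d}"]
      by (simp add: v_def norm[unfolded v_def])
  qed
qed

text \<open>\<open>a(s t^-1)\<close> pairs the row \<open>r \<mapsto> a(s r)\<close> with the unit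
  vector at \<open>r = t^-1\<close>. The rows have norm at most that of \<open>a\<close>, so the
  kernel factors through bounded vectors.\<close>

lemma schur_bound_ell2:
  assumes G: "group G" and a: "a \<in> ell2 (carrier G)"
  shows "schur_bound (carrier G) (multiplier_kernel G a) (l2_norm (carrier G) a)"
proof (rule schur_boundI)
  interpret group G by (rule G)
  fix I :: "nat set" and p x
  assume I: "finite I" and p: "\<And>i. i \<in> I \<Longrightarrow> p i \<in> carrier G" and x: "form_bound I x 1"
  let ?N = "l2_norm (carrier G) a"
  \<comment> \<open>Only the columns \<open>p j\<close> occur, so these finitely many values of
    \<open>r\<close> suffice.\<close>
  define R where "R = (\<lambda>j. inv\<^bsub>G\<^esub> p j) ` I"
  have R: "finite R" "R \<subseteq> carrier G" using I p by (auto simp: R_def)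
  show "form_bound I (\<lambda>i j. multiplier_kernel G a (p i) (p j) * x i j) ?N"
    unfolding form_bound_def
  proof (intro allI)
    fix u v :: "nat \<Rightarrow> complex"
    let ?U = "\<lambda>i r. u i * a (p i \<otimes>\<^bsub>G\<^esub> r)" and ?V = "\<lambda>j r. if inv\<^bsub>G\<^esub> p j = r then v j else 0"
    have "(\<Sum>r\<in>R. x i j * ?U i r * ?V j r) = multiplier_kernel G a (p i) (p j) * x i j * u i * v j" if "j \<in> I" for i j
    proof -
      have "(\<Sum>r\<in>R. x i j * ?U i r * ?V j r) = (\<Sum>r\<in>R. if inv\<^bsub>G\<^esub> p j = r then x i j * ?U i r * v j else 0)"
        by (intro sum.cong refl) simp
      also have "\<dots> = x i j * ?U i (inv\<^bsub>G\<^esub> p j) * v j"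
        unfolding sum.delta'[OF R(1)] using that by (simp add: R_def)
      finally show ?thesis by (simp add: multiplier_kernel_def mult_ac)
    qed
    then have "(\<Sum>i\<in>I. \<Sum>j\<in>I. multiplier_kernel G a (p i) (p j) * x i j * u i * v j)
        = (\<Sum>i\<in>I. \<Sum>j\<in>I. \<Sum>r\<in>R. x i j * ?U i r * ?V j r)"
      by (intro sum.cong refl) simp
    also have "\<dots> = (\<Sum>i\<in>I. \<Sum>r\<in>R. \<Sum>j\<in>I. x i j * ?U i r * ?V j r)"
      by (intro sum.cong refl sum.swap)
    also have "\<dots> = (\<Sum>r\<in>R. \<Sum>i\<in>I. \<Sum>j\<in>I. x i j * ?U i r * ?V j r)"
      by (rule sum.swap)
    also have "cmod \<dots> \<le> 1 * sqrt (\<Sum>r\<in>R. \<Sum>i\<in>I. (cmod (?U i r))\<^sup>2) * sqrt (\<Sum>r\<in>R. \<Sum>j\<in>I. (cmod (?V j r))\<^sup>2)"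
      by (rule form_bound_amplify[OF x]) simp
    also have "\<dots> \<le> 1 * (?N * L2_set (\<lambda>i. cmod (u i)) I) * L2_set (\<lambda>j. cmod (v j)) I"
    proof (intro mult_mono order_refl)
      have "(\<Sum>r\<in>R. \<Sum>i\<in>I. (cmod (?U i r))\<^sup>2) = (\<Sum>i\<in>I. (cmod (u i))\<^sup>2 * (\<Sum>r\<in>R. (cmod (a (p i \<otimes>\<^bsub>G\<^esub> r)))\<^sup>2))"
        by (subst sum.swap) (simp only: norm_mult power_mult_distrib sum_distrib_left)
      also have "\<dots> \<le> (\<Sum>i\<in>I. (cmod (u i))\<^sup>2 * ?N\<^sup>2)"
      proof (intro sum_mono mult_left_mono)
        fix i assume i: "i \<in> I"
        have "bij_betw (\<lambda>r. p i \<otimes>\<^bsub>G\<^esub> r) R ((\<lambda>r. p i \<otimes>\<^bsub>G\<^esub> r) ` R)"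
          using inj_on_subset[OF left_mult_perm(1)[OF G p[OF i]] R(2)] by (simp add: bij_betw_def)
        then have "L2_set (\<lambda>r. cmod (a (p i \<otimes>\<^bsub>G\<^esub> r))) R = L2_set (\<lambda>r. cmod (a r)) ((\<lambda>r. p i \<otimes>\<^bsub>G\<^esub> r) ` R)"
          by (simp add: L2_set_reindex o_def)
        also have "\<dots> \<le> ?N"
          using R p[OF i] by (intro L2_set_le_l2_norm a) auto
        finally have "(L2_set (\<lambda>r. cmod (a (p i \<otimes>\<^bsub>G\<^esub> r))) R)\<^sup>2 \<le> ?N\<^sup>2"
          by (rule power_mono) simp
        then show "(\<Sum>r\<in>R. (cmod (a (p i \<otimes>\<^bsub>G\<^esub> r)))\<^sup>2) \<le> ?N\<^sup>2"
          by (simp add: L2_set_sq)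
      qed simp
      also have "\<dots> = (?N * L2_set (\<lambda>i. cmod (u i)) I)\<^sup>2"
        by (simp add: power_mult_distrib L2_set_sq sum_distrib_right[symmetric])
      finally show "sqrt (\<Sum>r\<in>R. \<Sum>i\<in>I. (cmod (?U i r))\<^sup>2) \<le> ?N * L2_set (\<lambda>i. cmod (u i)) I"
        by (simp add: real_le_lsqrt)
      have "(\<Sum>r\<in>R. \<Sum>j\<in>I. (cmod (?V j r))\<^sup>2) = (\<Sum>j\<in>I. \<Sum>r\<in>R. if inv\<^bsub>G\<^esub> p j = r then (cmod (v j))\<^sup>2 else 0)"
        by (subst sum.swap) (intro sum.cong refl, simp)
      also have "\<dots> = (\<Sum>j\<in>I. (cmod (v j))\<^sup>2)"
        unfolding sum.delta'[OF R(1)] by (intro sum.cong refl) (simp add: R_def)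
      finally show "sqrt (\<Sum>r\<in>R. \<Sum>j\<in>I. (cmod (?V j r))\<^sup>2) \<le> L2_set (\<lambda>j. cmod (v j)) I"
        by (simp add: L2_set_def)
    qed (simp_all add: sum_nonneg)
    finally show "cmod (\<Sum>i\<in>I. \<Sum>j\<in>I. multiplier_kernel G a (p i) (p j) * x i j * u i * v j)
        \<le> ?N * L2_set (\<lambda>i. cmod (u i)) I * L2_set (\<lambda>j. cmod (v j)) I"
      by simp
  qed
qed

section \<open>Consequences of a bound on the completely bounded norm\<close>

lemma cb_normD:
  assumes cb: "cb_norm X A \<Phi> \<le> ennreal C" and C: "0 \<le> C" and n: "1 \<le> n"
    and m: "\<And>i j. i < n \<Longrightarrow> j < n \<Longrightarrow> m i j \<in> A" "matrix_norm X n m \<le> 1"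
  shows "matrix_norm X n (\<lambda>i j. \<Phi> (m i j)) \<le> C"
proof -
  have "ennreal (matrix_norm X n (\<lambda>i j. \<Phi> (m i j))) \<le> cb_norm X A \<Phi>"
    unfolding cb_norm_def by (intro SUP_upper2[of n] SUP_upper2[of m]) (use n m in auto)
  then show ?thesis
    using cb C by (metis ennreal_le_iff order_trans)
qed

text \<open>The case of matrix size 1, with the contractions \<open>block 0\<close> and
  \<open>embed_block 0\<close> relating \<open>X\<close> to the one-block space.\<close>

lemma cb_norm_bound:
  assumes cb: "cb_norm X A \<Phi> \<le> ennreal C" and C: "0 \<le> C"
    and A: "A \<subseteq> bounded_ops X" "\<Phi> T \<in> A"
    and T: "T \<in> A" "\<And>f. f \<in> ell2 X \<Longrightarrow> l2_norm X (T f) \<le> l2_norm X f" and f: "f \<in> ell2 X"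
  shows "l2_norm X (\<Phi> T f) \<le> C * l2_norm X f"
proof -
  let ?X = "{..<1::nat} \<times> X"
  have mat: "matrix_op 1 (\<lambda>i j. S) \<xi> = embed_block 0 (S (block 0 \<xi>))" for S :: "'a operator" and \<xi>
    by (auto simp: matrix_op_def embed_block_def block_def fun_eq_iff)
  have lin: "bounded_linear_l2 X S" if "S \<in> A" for S
    using A that by (blast intro: bounded_opsD)
  have "op_norm ?X (matrix_op 1 (\<lambda>i j. T)) \<le> 1"
  proof (rule op_norm_leI)
    fix \<xi> assume \<xi>: "\<xi> \<in> ell2 ?X"
    note sl = block_ell2[OF \<xi> zero_less_one]
    have "l2_norm ?X (embed_block 0 (T (block 0 \<xi>))) \<le> l2_norm X (T (block 0 \<xi>))"
      by (intro embed_block_ell2 bounded_linear_l2D(1)[OF lin[OF T(1)]] sl) simp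
    also have "\<dots> \<le> l2_norm X (block 0 \<xi>)" by (intro T sl)
    also have "\<dots> \<le> l2_norm ?X \<xi>" by (rule sl)
    finally show "l2_norm ?X (matrix_op 1 (\<lambda>i j. T) \<xi>) \<le> 1 * l2_norm ?X \<xi>" by (simp only: mat mult_1)
  qed simp
  then have "matrix_norm X 1 (\<lambda>i j. \<Phi> T) \<le> C"
    by (intro cb_normD[OF cb C, where m = "\<lambda>i j. T"] T) (simp_all add: matrix_norm_def)
  then have le: "op_norm ?X (matrix_op 1 (\<lambda>i j. \<Phi> T)) \<le> C" by (simp add: matrix_norm_def)
  let ?\<xi> = "embed_block 0 f"
  have \<xi>: "?\<xi> \<in> ell2 ?X" "l2_norm ?X ?\<xi> \<le> l2_norm X f"
    by (rule embed_block_ell2[OF f], simp)+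
  have sl: "block 0 (embed_block 0 g) = g" for g :: "'a vec" by (simp add: block_def embed_block_def)
  have M: "bounded_linear_l2 ?X (matrix_op 1 (\<lambda>i j. \<Phi> T))"
    by (intro matrix_op_bounded lin A)
  have "l2_norm X (\<Phi> T f) = l2_norm X (block 0 (matrix_op 1 (\<lambda>i j. \<Phi> T) ?\<xi>))"
    by (simp only: mat sl)
  also have "\<dots> \<le> l2_norm ?X (matrix_op 1 (\<lambda>i j. \<Phi> T) ?\<xi>)"
    by (rule block_ell2[OF bounded_linear_l2D(1)[OF M \<xi>(1)]]) simp
  also have "\<dots> \<le> op_norm ?X (matrix_op 1 (\<lambda>i j. \<Phi> T)) * l2_norm ?X ?\<xi>"
    by (rule l2_norm_op_le[OF M \<xi>(1)])
  also have "\<dots> \<le> C * l2_norm X f"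
    by (intro mult_mono le \<xi> C) simp
  finally show ?thesis .
qed

text \<open>
  The matrix is \<open>D (x \<otimes> 1) D\<^sup>*\<close> for the diagonal unitary \<open>D\<close> with entries \<open>\<lambda>(p i)\<close>.
\<close>

lemma twisted_matrix_norm:
  assumes G: "group G" and I: "I \<subseteq> {..<n}" and p: "\<And>i. p i \<in> carrier G" and x: "form_bound I x 1"
  shows "matrix_norm (carrier G) n (\<lambda>i j f s. (if i \<in> I \<and> j \<in> I then x i j else 0)
    * left_regular G (p i \<otimes>\<^bsub>G\<^esub> inv\<^bsub>G\<^esub> p j) f s) \<le> 1"
  unfolding matrix_norm_def
proof (rule op_norm_leI)
  interpret group G by (rule G)
  let ?X = "carrier G"
  let ?m = "\<lambda>i j f s. (if i \<in> I \<and> j \<in> I then x i j else 0)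
    * left_regular G (p i \<otimes>\<^bsub>G\<^esub> inv\<^bsub>G\<^esub> p j) f s"
  have I_fin: "finite I" using I finite_subset by blast
  fix \<xi> assume \<xi>: "\<xi> \<in> ell2 ({..<n} \<times> ?X)"
  have entry: "matrix_op n ?m \<xi> (i, s)
    = (if i \<in> I then \<Sum>j\<in>I. x i j * \<xi> (j, p j \<otimes>\<^bsub>G\<^esub> (inv\<^bsub>G\<^esub> p i \<otimes>\<^bsub>G\<^esub> s)) else 0)" if s: "s \<in> ?X" for i s
  proof (cases "i \<in> I")
    case True
    then have "matrix_op n ?m \<xi> (i, s)
      = (\<Sum>j<n. if j \<in> I then x i j * left_regular G (p i \<otimes>\<^bsub>G\<^esub> inv\<^bsub>G\<^esub> p j) (\<lambda>y. \<xi> (j, y)) s else 0)"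
      using I by (auto simp: matrix_op_def intro!: sum.cong)
    also have "\<dots> = (\<Sum>j\<in>I. x i j * left_regular G (p i \<otimes>\<^bsub>G\<^esub> inv\<^bsub>G\<^esub> p j) (\<lambda>y. \<xi> (j, y)) s)"
      using I by (simp add: sum.inter_restrict[symmetric] Int_absorb1)
    also have "\<dots> = (\<Sum>j\<in>I. x i j * \<xi> (j, p j \<otimes>\<^bsub>G\<^esub> (inv\<^bsub>G\<^esub> p i \<otimes>\<^bsub>G\<^esub> s)))"
    proof (intro sum.cong refl)
      fix j assume "j \<in> I"
      then have "(\<lambda>y. \<xi> (j, y)) \<in> ell2 ?X"
        using block_ell2(1)[OF \<xi>, of j] I by (auto simp: block_def)
      then show "x i j * left_regular G (p i \<otimes>\<^bsub>G\<^esub> inv\<^bsub>G\<^esub> p j) (\<lambda>y. \<xi> (j, y)) s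
          = x i j * \<xi> (j, p j \<otimes>\<^bsub>G\<^esub> (inv\<^bsub>G\<^esub> p i \<otimes>\<^bsub>G\<^esub> s))"
        using s p by (simp add: left_regular_def inv_mult_group m_assoc)
    qed
    finally show ?thesis using True by simp
  next
    case False
    then show ?thesis by (simp add: matrix_op_def)
  qed
  show "l2_norm ({..<n} \<times> ?X) (matrix_op n ?m \<xi>) \<le> 1 * l2_norm ({..<n} \<times> ?X) \<xi>"
  proof (rule ell2_L2_bound(2))
    fix a assume "a \<notin> {..<n} \<times> ?X"
    then show "matrix_op n ?m \<xi> a = 0"
      by (cases a) (auto simp: matrix_op_def left_regular_def)
  next
    fix K assume K: "finite K" "K \<subseteq> {..<n} \<times> ?X"
    \<comment> \<open>The coordinate \<open>r = p_i^-1 s\<close> undoes the diagonal unitary: at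
      \<open>(i, p_i r)\<close> the result is the sum over \<open>j\<close> of \<open>x i j\<close>
      times the value of \<xi> at \<open>(j, p_j r)\<close>, so \<open>x\<close> acts separately for
      each \<open>r\<close>.\<close>
    define R where "R = (\<lambda>(i, s). inv\<^bsub>G\<^esub> p i \<otimes>\<^bsub>G\<^esub> s) ` K"
    have R: "finite R" "R \<subseteq> ?X" using K p by (auto simp: R_def)
    define W where "W = (\<lambda>(r, i). (i, p i \<otimes>\<^bsub>G\<^esub> r))"
    have W: "bij_betw W (R \<times> I) (W ` (R \<times> I))"
      unfolding bij_betw_def using R p by (auto simp: W_def inj_on_def subset_eq)
    have "(L2_set (\<lambda>a. cmod (matrix_op n ?m \<xi> a)) K)\<^sup>2 = (\<Sum>a\<in>K. (cmod (matrix_op n ?m \<xi> a))\<^sup>2)"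
      by (rule L2_set_sq)
    also have "\<dots> = (\<Sum>a | a \<in> K \<and> fst a \<in> I. (cmod (matrix_op n ?m \<xi> a))\<^sup>2)"
    proof (rule sum.mono_neutral_right[OF K(1)])
      show "\<forall>a\<in>K - {a \<in> K. fst a \<in> I}. (cmod (matrix_op n ?m \<xi> a))\<^sup>2 = 0"
      proof
        fix a assume a: "a \<in> K - {a \<in> K. fst a \<in> I}"
        then have "snd a \<in> ?X" "fst a \<notin> I" using K(2) by auto
        with entry[of "snd a" "fst a"] show "(cmod (matrix_op n ?m \<xi> a))\<^sup>2 = 0" by simp
      qed
    qed auto
    also have "\<dots> \<le> (\<Sum>a\<in>W ` (R \<times> I). (cmod (matrix_op n ?m \<xi> a))\<^sup>2)"
    proof (rule sum_mono2)
      show "{a \<in> K. fst a \<in> I} \<subseteq> W ` (R \<times> I)"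
      proof
        fix a assume a: "a \<in> {a \<in> K. fst a \<in> I}"
        obtain i s where [simp]: "a = (i, s)" by (cases a)
        have "s \<in> ?X" "i \<in> I" using a K by auto
        then have "a = W (inv\<^bsub>G\<^esub> p i \<otimes>\<^bsub>G\<^esub> s, i)"
          using p by (simp add: W_def m_assoc[symmetric])
        moreover have "inv\<^bsub>G\<^esub> p i \<otimes>\<^bsub>G\<^esub> s \<in> R"
          unfolding R_def using a by (intro image_eqI[of _ _ a]) auto
        ultimately show "a \<in> W ` (R \<times> I)" using \<open>i \<in> I\<close> by blast
      qed
    qed (use R I_fin in auto)
    also have "\<dots> = (\<Sum>b\<in>R \<times> I. (cmod (matrix_op n ?m \<xi> (W b)))\<^sup>2)"
      by (rule sum.reindex_bij_betw[OF W, symmetric])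
    also have "\<dots> = (\<Sum>r\<in>R. (L2_set (\<lambda>i. cmod (\<Sum>j\<in>I. x i j * \<xi> (j, p j \<otimes>\<^bsub>G\<^esub> r))) I)\<^sup>2)"
      unfolding L2_set_sq sum.cartesian_product'
    proof (intro sum.cong refl)
      fix r i assume r: "r \<in> R" and i: "i \<in> I"
      have "r \<in> ?X" "p i \<otimes>\<^bsub>G\<^esub> r \<in> ?X" using r R p by auto
      moreover from this have "inv\<^bsub>G\<^esub> p i \<otimes>\<^bsub>G\<^esub> (p i \<otimes>\<^bsub>G\<^esub> r) = r"
        using p by (simp add: m_assoc[symmetric])
      ultimately show "(cmod (matrix_op n ?m \<xi> (W (r, i))))\<^sup>2 = (cmod (\<Sum>j\<in>I. x i j * \<xi> (j, p j \<otimes>\<^bsub>G\<^esub> r)))\<^sup>2"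
        using i by (simp add: W_def entry)
    qed
    also have "\<dots> \<le> (\<Sum>r\<in>R. (1 * L2_set (\<lambda>j. cmod (\<xi> (j, p j \<otimes>\<^bsub>G\<^esub> r))) I)\<^sup>2)"
      by (intro sum_mono power_mono form_bound_op[OF x]) auto
    also have "\<dots> = (\<Sum>b\<in>R \<times> I. (cmod (\<xi> (W b)))\<^sup>2)"
      unfolding L2_set_sq sum.cartesian_product' by (simp add: W_def L2_set_sq)
    also have "\<dots> = (L2_set (\<lambda>a. cmod (\<xi> a)) (W ` (R \<times> I)))\<^sup>2"
      unfolding L2_set_sq by (rule sum.reindex_bij_betw[OF W])
    also have "\<dots> \<le> (l2_norm ({..<n} \<times> ?X) \<xi>)\<^sup>2"
      using R I I_fin p by (intro power_mono L2_set_le_l2_norm \<xi>) (auto simp: W_def)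
    finally show "L2_set (\<lambda>a. cmod (matrix_op n ?m \<xi> a)) K \<le> 1 * l2_norm ({..<n} \<times> ?X) \<xi>"
      unfolding mult_1 by (rule power2_le_imp_le) simp
  qed
qed simp

text \<open>The coefficient function \<phi> of \<Phi> is close to 1 by the 2-norm estimate, has a
  Schur bound by the cb-norm at twisted matrices, and is square summable by finite rank. The gap
  between \<open>Lambda_cb G\<close> and \<open>C\<close> pays for truncating it.\<close>

lemma multiplier_approx_of_Lambda_cb:
  assumes G: "group G" and less: "Lambda_cb G < ennreal C"
  shows "multiplier_approx G C"
proof (rule multiplier_approxI)
  interpret group G by (rule G)
  let ?X = "carrier G" and ?e = "delta \<one>\<^bsub>G\<^esub> :: 'a vec" and ?A = "group_vN G" and ?L = "left_regular G"
  fix F and \<epsilon> :: real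
  assume F: "finite F" "F \<subseteq> ?X" and \<epsilon>: "0 < \<epsilon>"
  obtain c where c: "c < ennreal C" and "c \<in> {ennreal C | C :: real. C > 0 \<and>
     (\<forall>F. finite F \<and> F \<subseteq> {T \<in> ?A. op_norm ?X T \<le> 1} \<longrightarrow>
       (\<forall>\<epsilon>>0. \<exists>\<Phi>. linear_map_on ?A \<Phi> \<and> sigma_weakly_continuous ?X ?A \<Phi> \<and> finite_rank_on ?A \<Phi> \<and>
          (\<forall>T\<in>F. norm2 ?X (group_trace G) (\<lambda>f x. \<Phi> T f x - T f x) < \<epsilon>) \<and> cb_norm ?X ?A \<Phi> \<le> ennreal C))}"
    using less unfolding Lambda_cb_def Lambda_cb_vN_def Inf_less_iff by (elim bexE) (rule that)
  then obtain D where D: "0 < D" "ennreal D < ennreal C"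
    and D_approx: "\<forall>F. finite F \<and> F \<subseteq> {T \<in> ?A. op_norm ?X T \<le> 1} \<longrightarrow>
       (\<forall>\<epsilon>>0. \<exists>\<Phi>. linear_map_on ?A \<Phi> \<and> sigma_weakly_continuous ?X ?A \<Phi> \<and> finite_rank_on ?A \<Phi> \<and>
          (\<forall>T\<in>F. norm2 ?X (group_trace G) (\<lambda>f x. \<Phi> T f x - T f x) < \<epsilon>) \<and> cb_norm ?X ?A \<Phi> \<le> ennreal D)"
    unfolding mem_Collect_eq by (elim exE conjE) (rule that; simp)
  have DC: "D < C" using D by (simp add: ennreal_less_iff)
  have L_bounded: "?L g \<in> ?A" "op_norm ?X (?L g) \<le> 1" if "g \<in> ?X" for g
    using left_regular_in_group_vN[OF G that] l2_norm_left_regular[OF G that] by (auto intro: op_norm_leI)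
  have "finite (?L ` F)" "?L ` F \<subseteq> {T \<in> ?A. op_norm ?X T \<le> 1}"
    using F L_bounded by auto
  \<comment> \<open>The other half of \<epsilon> is reserved for the truncation.\<close>
  with D_approx[rule_format, of "?L ` F" "\<epsilon> / 2"] \<epsilon>
  obtain \<Phi> where lin: "linear_map_on ?A \<Phi>" and rank: "finite_rank_on ?A \<Phi>"
    and near: "\<forall>T\<in>?L ` F. norm2 ?X (group_trace G) (\<lambda>f x. \<Phi> T f x - T f x) < \<epsilon> / 2"
    and cb: "cb_norm ?X ?A \<Phi> \<le> ennreal D"
    by (elim exE conjE meta_impE) (simp, simp, rule that)
  have \<Phi>A: "\<Phi> T \<in> ?A" if "T \<in> ?A" for T
    using lin that by (simp add: linear_map_on_def)
  define \<phi> where "\<phi> g = (if g \<in> ?X then \<Phi> (?L g) ?e g else 0)" for g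

  have e: "?e \<in> ell2 ?X" by simp
  have \<Phi>_ell2: "\<Phi> (?L g) ?e \<in> ell2 ?X" if "g \<in> ?X" for g
    by (intro bounded_ops_ell2 group_vN_bounded \<Phi>A L_bounded that)

  have \<phi>_near: "cmod (\<phi> g - 1) < \<epsilon> / 2" if g: "g \<in> F" for g
  proof -
    have gX: "g \<in> ?X" using F g by blast
    have "\<phi> g - 1 = \<Phi> (?L g) ?e g - ?L g ?e g"
      using gX left_regular_delta[OF G gX one_closed, of g] by (simp add: \<phi>_def)
    also have "cmod \<dots> \<le> l2_norm ?X (\<lambda>x. \<Phi> (?L g) ?e x - ?L g ?e x)"
      by (rule cmod_le_l2_norm, intro ell2_diff \<Phi>_ell2 gX bounded_ops_ell2[OF left_regular_bounded[OF G gX]])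
    also have "\<dots> = norm2 ?X (group_trace G) (\<lambda>f x. \<Phi> (?L g) f x - ?L g f x)"
      by (rule norm2_group_trace[OF G, symmetric])
        (intro group_vN_bounded group_vN_diff[OF G] \<Phi>A L_bounded gX)
    also have "\<dots> < \<epsilon> / 2" using near g by blast
    finally show ?thesis .
  qed

  have \<phi>_schur: "schur_bound ?X (multiplier_kernel G \<phi>) D"
  proof (rule schur_boundI)
    fix I :: "nat set" and p x
    assume I: "finite I" and p: "\<And>i. i \<in> I \<Longrightarrow> p i \<in> ?X" and x: "form_bound I x 1"
    \<comment> \<open>\<open>insert 0\<close> gives the maximum a meaning for empty
      \<open>I\<close>. The successor makes \<open>I\<close> fit below \<open>n\<close> and keeps
      \<open>n\<close> positive, as the cb-norm takes sizes from 1 on.\<close>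
    define n where "n = Suc (Max (insert 0 I))"
    have In: "I \<subseteq> {..<n}" "1 \<le> n" using I by (auto simp: n_def less_Suc_eq_le)
    \<comment> \<open>\<open>twisted_matrix_norm\<close> asks for group elements at all indices; the
      identity is a default outside \<open>I\<close>, where the matrix vanishes.\<close>
    define q where "q i = (if i \<in> I then p i else \<one>\<^bsub>G\<^esub>)" for i
    have q: "q i \<in> ?X" for i using p by (simp add: q_def)
    let ?c = "\<lambda>i j. if i \<in> I \<and> j \<in> I then x i j else 0"
    let ?L' = "\<lambda>i j. ?L (q i \<otimes>\<^bsub>G\<^esub> inv\<^bsub>G\<^esub> q j)"
    have L': "?L' i j \<in> ?A" for i j by (intro L_bounded) (simp add: q)
    define m where "m i j = (\<lambda>f s. ?c i j * ?L' i j f s)" for i j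
    have m: "m i j \<in> ?A" for i j
      using group_vN_sum[OF G, of "{()}" "\<lambda>_. ?L' i j" "\<lambda>_. ?c i j"] L' by (simp add: m_def)
    have \<Phi>m: "\<Phi> (m i j) = (\<lambda>f s. ?c i j * \<Phi> (?L' i j) f s)" for i j
      using lin L' unfolding m_def linear_map_on_def by blast
    have "matrix_norm ?X n m \<le> 1"
      unfolding m_def by (rule twisted_matrix_norm[OF G In(1) q x])
    then have "matrix_norm ?X n (\<lambda>i j. \<Phi> (m i j)) \<le> D"
      by (intro cb_normD[OF cb _ In(2)] m) (use D in auto)
    then have le: "op_norm ({..<n} \<times> ?X) (matrix_op n (\<lambda>i j. \<Phi> (m i j))) \<le> D"
      by (simp add: matrix_norm_def)
    have lin_m: "bounded_linear_l2 ?X (\<Phi> (m i j))" for i j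
      by (intro bounded_opsD group_vN_bounded \<Phi>A m)
    \<comment> \<open>Compression to the coordinates \<open>(i, q i)\<close> picks one entry from
      each block \<open>\<Phi> (m i j)\<close>, namely \<open>x i j\<close> times \<phi> at
      \<open>q_i q_j^-1\<close>.\<close>
    let ?J = "(\<lambda>i. (i, q i)) ` I"
    have J: "finite ?J" "?J \<subseteq> {..<n} \<times> ?X" using I In q by auto
    have bij: "bij_betw fst ?J I" by (auto simp: bij_betw_def inj_on_def image_image)
    have "form_bound ?J (\<lambda>a b. multiplier_kernel G \<phi> (p (fst a)) (p (fst b)) * x (fst a) (fst b)) D"
    proof (rule form_bound_cong[OF form_bound_op_norm[OF matrix_op_bounded[OF lin_m] J le]])
      fix a b assume "a \<in> ?J" "b \<in> ?J"
      then obtain i j where ij: "i \<in> I" "j \<in> I" and [simp]: "a = (i, q i)" "b = (j, q j)" by blast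
      have lt: "i < n" "j < n" using ij In by auto
      have "matrix_op n (\<lambda>i j. \<Phi> (m i j)) (delta b) a = \<Phi> (m i j) (delta (q j)) (q i)"
        using matrix_op_delta[where m = "\<lambda>i j. \<Phi> (m i j)", OF lin_m lt] by simp
      also have "\<dots> = x i j * \<Phi> (?L' i j) (delta (q j)) (q i)"
        unfolding \<Phi>m using ij by simp
      also have "\<Phi> (?L' i j) (delta (q j)) (q i) = \<Phi> (?L' i j) ?e (q i \<otimes>\<^bsub>G\<^esub> inv\<^bsub>G\<^esub> q j)"
        by (intro group_vN_coefficient[OF G] \<Phi>A L' q)
      also have "\<dots> = multiplier_kernel G \<phi> (p i) (p j)"
        using ij p by (simp add: multiplier_kernel_def \<phi>_def q_def)
      finally show "matrix_op n (\<lambda>i j. \<Phi> (m i j)) (delta b) a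
          = multiplier_kernel G \<phi> (p (fst a)) (p (fst b)) * x (fst a) (fst b)"
        by simp
    qed
    then show "form_bound I (\<lambda>i j. multiplier_kernel G \<phi> (p i) (p j) * x i j) D"
      by (rule form_bound_reindex[OF bij])
  qed

  have \<phi>_ell2: "\<phi> \<in> ell2 ?X"
  proof -
    obtain B where B: "finite B" "B \<subseteq> ?A"
      and span: "\<forall>T\<in>?A. \<exists>c :: 'a operator \<Rightarrow> complex. \<Phi> T = (\<lambda>f x. \<Sum>S\<in>B. c S * S f x)"
      using rank unfolding finite_rank_on_def by (elim exE conjE) (rule that)
    \<comment> \<open>The columns at the identity of all operators in the range of \<Phi> lie in the
      span of these finitely many vectors.\<close>
    let ?B = "(\<lambda>S. S ?e) ` B"
    have fB: "finite ?B" "?B \<subseteq> ell2 ?X"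
      using B by (auto intro: bounded_ops_ell2 group_vN_bounded)
    obtain d :: nat and u where u: "\<And>k. k < d \<Longrightarrow> u k \<in> ell2 ?X"
      and bound: "\<And>c x. cmod (\<Sum>b\<in>?B. c b * b x) \<le> l2_norm ?X (\<lambda>x. \<Sum>b\<in>?B. c b * b x) * L2_set (\<lambda>k. cmod (u k x)) {..<d}"
      by (rule finite_span_pointwise_bound[OF fB]) (rule that)
    have \<phi>_le: "cmod (\<phi> g) \<le> D * L2_set (\<lambda>k. cmod (u k g)) {..<d}" if g: "g \<in> ?X" for g
    proof -
      obtain c :: "'a operator \<Rightarrow> complex" where c: "\<Phi> (?L g) = (\<lambda>f x. \<Sum>S\<in>B. c S * S f x)"
        using span L_bounded(1)[OF g] by blast
      \<comment> \<open>Different \<open>S\<close> may share the same column, so coefficients are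
        added over each fibre.\<close>
      let ?c = "\<lambda>b. \<Sum>S | S \<in> B \<and> S ?e = b. c S"
      have eq: "\<Phi> (?L g) ?e x = (\<Sum>b\<in>?B. ?c b * b x)" for x
        unfolding c sum_distrib_right
        by (subst sum.image_gen[OF B(1), where g = "\<lambda>S. S ?e"]) (auto intro!: sum.cong)
      have "cmod (\<phi> g) \<le> l2_norm ?X (\<Phi> (?L g) ?e) * L2_set (\<lambda>k. cmod (u k g)) {..<d}"
        using bound[of ?c g] g by (simp only: \<phi>_def if_True eq[symmetric])
      also have "\<dots> \<le> (D * l2_norm ?X ?e) * L2_set (\<lambda>k. cmod (u k g)) {..<d}"
        using group_vN_bounded D
        by (intro mult_right_mono cb_norm_bound[OF cb] \<Phi>A L_bounded(1)[OF g] l2_norm_left_regular[OF G g] e) auto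
      finally show ?thesis by (simp add: l2_norm_delta)
    qed
    show ?thesis
    proof (rule ell2_L2_bound(1))
      fix K assume K: "finite K" "K \<subseteq> ?X"
      have "L2_set (\<lambda>g. cmod (\<phi> g)) K \<le> L2_set (\<lambda>g. D * L2_set (\<lambda>k. cmod (u k g)) {..<d}) K"
        using \<phi>_le K by (intro L2_set_mono) auto
      also have "\<dots> = D * L2_set (\<lambda>g. L2_set (\<lambda>k. cmod (u k g)) {..<d}) K"
        using D by (simp add: L2_set_right_distrib)
      also have "L2_set (\<lambda>g. L2_set (\<lambda>k. cmod (u k g)) {..<d}) K = sqrt (\<Sum>k<d. (L2_set (\<lambda>g. cmod (u k g)) K)\<^sup>2)"
        unfolding L2_set_def[of _ K] L2_set_sq by (subst sum.swap) (simp add: L2_set_sq sum_nonneg)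
      also have "\<dots> \<le> sqrt (\<Sum>k<d. (l2_norm ?X (u k))\<^sup>2)"
        using K u by (intro real_sqrt_le_mono sum_mono power_mono L2_set_le_l2_norm) auto
      finally show "L2_set (\<lambda>g. cmod (\<phi> g)) K \<le> D * sqrt (\<Sum>k<d. (l2_norm ?X (u k))\<^sup>2)"
        using D by (simp add: mult_left_mono)
    qed (simp add: \<phi>_def)
  qed

  \<comment> \<open>\<open>C - D\<close> is the room for the Schur norm of the tail and
    \<open>\<epsilon> / 2\<close> the room for its values; both are dominated by its
    l^2-norm.\<close>
  define \<eta> where "\<eta> = min (C - D) (\<epsilon> / 2)"
  have \<eta>: "0 < \<eta>" "\<eta> \<le> C - D" "\<eta> \<le> \<epsilon> / 2" using DC \<epsilon> by (simp_all only: \<eta>_def min_less_iff_conj min.cobounded1 min.cobounded2) simp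
  have "\<forall>\<^sub>F K in finite_subsets_at_top ?X. l2_norm ?X (\<lambda>x. \<phi> x - truncate K \<phi> x) < \<eta>"
    by (rule order_tendstoD(2)[OF tendsto_l2_norm_truncate[OF \<phi>_ell2] \<eta>(1)])
  then obtain K where K: "finite K" "K \<subseteq> ?X"
    and K_all: "\<forall>Y. finite Y \<and> K \<subseteq> Y \<and> Y \<subseteq> ?X \<longrightarrow> l2_norm ?X (\<lambda>x. \<phi> x - truncate Y \<phi> x) < \<eta>"
    unfolding eventually_finite_subsets_at_top by (elim exE conjE) (rule that)
  define \<tau> where "\<tau> = (\<lambda>x. truncate K \<phi> x - \<phi> x)"
  have \<tau>_ell2: "\<tau> \<in> ell2 ?X" unfolding \<tau>_def by (intro ell2_diff truncate_ell2 K \<phi>_ell2)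
  have \<tau>_norm: "l2_norm ?X \<tau> < \<eta>"
    using K_all[rule_format, of K] K l2_norm_cmult[of ?X "-1" "\<lambda>x. \<phi> x - truncate K \<phi> x"] by (simp add: \<tau>_def)
  have "schur_bound ?X (\<lambda>s t. multiplier_kernel G \<phi> s t + multiplier_kernel G \<tau> s t) (D + l2_norm ?X \<tau>)"
    by (intro schur_bound_add \<phi>_schur schur_bound_ell2 G \<tau>_ell2)
  then have "schur_bound ?X (multiplier_kernel G (truncate K \<phi>)) (D + l2_norm ?X \<tau>)"
    by (rule schur_bound_cong) (simp add: multiplier_kernel_def \<tau>_def)
  then have "schur_bound ?X (multiplier_kernel G (truncate K \<phi>)) C"
    by (rule schur_bound_mono) (use \<tau>_norm \<eta> in simp)
  moreover have "finite {g \<in> ?X. truncate K \<phi> g \<noteq> 0}"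
    by (rule finite_subset[OF _ K(1)]) (auto simp: truncate_def)
  moreover have "cmod (truncate K \<phi> g - 1) < \<epsilon>" if g: "g \<in> F" for g
  proof -
    have "truncate K \<phi> g - 1 = \<tau> g + (\<phi> g - 1)" by (simp add: \<tau>_def)
    then have "cmod (truncate K \<phi> g - 1) \<le> cmod (\<tau> g) + cmod (\<phi> g - 1)"
      by (simp only: norm_triangle_ineq)
    also have "\<dots> < \<epsilon> / 2 + \<epsilon> / 2"
      using cmod_le_l2_norm[OF \<tau>_ell2, of g] \<tau>_norm \<eta> \<phi>_near[OF g] by (intro add_strict_mono) auto
    finally show ?thesis by simp
  qed
  ultimately show "\<exists>\<phi>. finite {g \<in> ?X. \<phi> g \<noteq> 0} \<and> (\<forall>g\<in>F. cmod (\<phi> g - 1) < \<epsilon>) \<and>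
       schur_bound ?X (multiplier_kernel G \<phi>) C"
    by (intro exI[of _ "truncate K \<phi>"]) simp
qed

section \<open>Subgroups of direct sums\<close>

text \<open>The coordinates are discrete, so convergence of indicator functions means that each
  coordinate is eventually constant.\<close>

lemma limitin_Sub_topology:
  assumes sub: "\<And>n. subgroup (H n) G" "subgroup K G"
    and ev: "\<And>g. g \<in> carrier G \<Longrightarrow> \<forall>\<^sub>F n in sequentially. g \<in> H n \<longleftrightarrow> g \<in> K"
  shows "limitin (Sub_topology G) H K sequentially"
proof -
  let ?P = "product_topology (\<lambda>_. discrete_topology (UNIV :: bool set)) (carrier G)"
  define indic where "indic H = (\<lambda>g\<in>carrier G. g \<in> H)" for H
  have indic_top: "indic A \<in> topspace ?P" for A by (simp add: indic_def)
  have lim: "limitin ?P (\<lambda>n. indic (H n)) (indic K) sequentially"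
    unfolding limitin_componentwise
  proof (intro conjI ballI)
    show "indic K \<in> extensional (carrier G)" by (simp add: indic_def)
    show "\<forall>\<^sub>F n in sequentially. indic (H n) \<in> topspace ?P" by (simp only: indic_top eventually_True)
    fix g assume g: "g \<in> carrier G"
    show "limitin (discrete_topology UNIV) (\<lambda>n. indic (H n) g) (indic K g) sequentially"
      unfolding limitin_def
    proof (intro conjI allI impI)
      fix U assume U: "openin (discrete_topology UNIV) U \<and> indic K g \<in> U"
      show "\<forall>\<^sub>F n in sequentially. indic (H n) g \<in> U"
        using ev[OF g]
      proof (rule eventually_mono)
        fix n assume "(g \<in> H n) = (g \<in> K)"
        then have "indic (H n) g = indic K g" using g by (simp add: indic_def)
        then show "indic (H n) g \<in> U" using U by simp
      qed
    qed simp
  qed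
  have Sub: "Sub_topology G = pullback_topology {H. subgroup H G} indic ?P"
    unfolding Sub_topology_def indic_def[abs_def] ..
  show ?thesis
    unfolding limitin_def Sub
  proof (intro conjI allI impI)
    show "K \<in> topspace (pullback_topology {H. subgroup H G} indic ?P)"
      using sub indic_top by (simp only: topspace_pullback_topology) auto
    fix U assume U: "openin (pullback_topology {H. subgroup H G} indic ?P) U \<and> K \<in> U"
    then obtain V where V: "openin ?P V" "U = indic -` V \<inter> {H. subgroup H G}"
      unfolding openin_pullback_topology by blast
    then have "\<forall>\<^sub>F n in sequentially. indic (H n) \<in> V"
      using lim U unfolding limitin_def by blast
    then show "\<forall>\<^sub>F n in sequentially. H n \<in> U"
      by (rule eventually_mono) (simp add: V sub)
  qed
qed

lemma multiplier_approx_finite: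
  assumes "finite (carrier G)"
  shows "multiplier_approx G 1"
proof (rule multiplier_approxI)
  fix F and \<epsilon> :: real assume "0 < \<epsilon>"
  have "finite {g \<in> carrier G. (1 :: complex) \<noteq> 0}" using assms by simp
  moreover have "schur_bound (carrier G) (multiplier_kernel G (\<lambda>g. 1)) 1"
    using schur_bound_const[of "carrier G" 1] by (simp add: multiplier_kernel_def[abs_def])
  ultimately show "\<exists>\<phi>. finite {g \<in> carrier G. \<phi> g \<noteq> 0} \<and> (\<forall>g\<in>F. cmod (\<phi> g - 1) < \<epsilon>) \<and>
       schur_bound (carrier G) (multiplier_kernel G \<phi>) 1"
    using \<open>0 < \<epsilon>\<close> by (intro exI[of _ "\<lambda>g. 1"]) simp
qed

lemma weakly_amenable_multiplier_approx:
  assumes G: "group G" and wa: "weakly_amenable G"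
  obtains C where "0 < C" "multiplier_approx G C"
proof -
  obtain r where r: "Lambda_cb G = ennreal r" "0 \<le> r"
    using wa unfolding weakly_amenable_def by (cases "Lambda_cb G") auto
  \<comment> \<open>The passage to multipliers asks for a strict inequality, and
    \<open>r + 1\<close> is positive even for \<open>r = 0\<close>.\<close>
  have "Lambda_cb G < ennreal (r + 1)"
    using r by (simp add: ennreal_less_iff)
  from multiplier_approx_of_Lambda_cb[OF G this] show thesis
    using r by (intro that[of "r + 1"]) auto
qed

lemma weakly_amenableI:
  assumes "group G" "0 < C" "multiplier_approx G C"
  shows "weakly_amenable G"
proof -
  have "Lambda_cb G \<le> ennreal C" by (rule Lambda_cb_le[OF assms])
  also have "\<dots> < \<infinity>" by simp
  finally show ?thesis by (simp add: weakly_amenable_def)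
qed

section \<open>Partial sums of a sequence of groups\<close>

context
  fixes \<Gamma> :: "nat \<Rightarrow> ('a, 'b) monoid_scheme"
  assumes \<Gamma>: "\<And>k. group (\<Gamma> k)"
begin

text \<open>Covers all subgroups that occur: \<open>{k}\<close> gives a summand, \<open>{}\<close>
  the trivial group, \<open>{..<n}\<close> a finite partial sum and \<open>UNIV\<close> the full
  sum.\<close>

definition supported :: "nat set \<Rightarrow> (nat \<Rightarrow> 'a) set" where
  "supported J = {x \<in> carrier (sum_group UNIV \<Gamma>). \<forall>k. k \<notin> J \<longrightarrow> x k = \<one>\<^bsub>\<Gamma> k\<^esub>}"

definition partial_sum :: "nat set \<Rightarrow> (nat \<Rightarrow> 'a) monoid" where
  "partial_sum J = (sum_group UNIV \<Gamma>)\<lparr>carrier := supported J\<rparr>"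

lemma carrier_sum: "x \<in> carrier (sum_group UNIV \<Gamma>) \<longleftrightarrow>
    (\<forall>k. x k \<in> carrier (\<Gamma> k)) \<and> finite {k. x k \<noteq> \<one>\<^bsub>\<Gamma> k\<^esub>}"
  by (auto simp: carrier_sum_group \<Gamma> PiE_iff)

lemma supported_iff: "x \<in> supported J \<longleftrightarrow>
    (\<forall>k. x k \<in> carrier (\<Gamma> k)) \<and> finite {k. x k \<noteq> \<one>\<^bsub>\<Gamma> k\<^esub>} \<and> (\<forall>k. k \<notin> J \<longrightarrow> x k = \<one>\<^bsub>\<Gamma> k\<^esub>)"
  by (auto simp: supported_def carrier_sum)

lemma monoid_\<Gamma>: "monoid (\<Gamma> k)"
  by (rule group.is_monoid[OF \<Gamma>])

lemma supported_subgroup: "subgroup (supported J) (sum_group UNIV \<Gamma>)"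
proof (rule group.subgroupI)
  show "group (sum_group UNIV \<Gamma>)" by (simp add: \<Gamma>)
  show "supported J \<subseteq> carrier (sum_group UNIV \<Gamma>)" by (auto simp: supported_def)
  have "\<one>\<^bsub>sum_group UNIV \<Gamma>\<^esub> \<in> supported J"
    by (simp add: supported_iff monoid.one_closed[OF monoid_\<Gamma>])
  then show "supported J \<noteq> {}" by blast
  fix x assume x: "x \<in> supported J"
  then have xc: "x \<in> carrier (sum_group UNIV \<Gamma>)" by (simp add: supported_def)
  have "inv\<^bsub>sum_group UNIV \<Gamma>\<^esub> x \<in> carrier (sum_group UNIV \<Gamma>)"
    by (intro group.inv_closed xc) (simp add: \<Gamma>)
  then show "inv\<^bsub>sum_group UNIV \<Gamma>\<^esub> x \<in> supported J"
    using x xc by (auto simp: supported_def \<Gamma> monoid.inv_one[OF monoid_\<Gamma>])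
  fix y assume y: "y \<in> supported J"
  then have yc: "y \<in> carrier (sum_group UNIV \<Gamma>)" by (simp add: supported_def)
  have "x \<otimes>\<^bsub>sum_group UNIV \<Gamma>\<^esub> y \<in> carrier (sum_group UNIV \<Gamma>)"
    by (intro monoid.m_closed group.is_monoid xc yc) (simp add: \<Gamma>)
  then show "x \<otimes>\<^bsub>sum_group UNIV \<Gamma>\<^esub> y \<in> supported J"
    using x y by (auto simp: supported_def monoid.l_one[OF monoid_\<Gamma>] monoid.one_closed[OF monoid_\<Gamma>])
qed

lemma group_partial_sum: "group (partial_sum J)"
  unfolding partial_sum_def
  by (intro subgroup.subgroup_is_group supported_subgroup) (simp add: \<Gamma>)

lemma carrier_partial_sum [simp]: "carrier (partial_sum J) = supported J"
  by (simp add: partial_sum_def)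

lemma mult_partial_sum [simp]: "x \<otimes>\<^bsub>partial_sum J\<^esub> y = (\<lambda>k. x k \<otimes>\<^bsub>\<Gamma> k\<^esub> y k)"
  by (simp add: partial_sum_def fun_eq_iff)

lemma multiplier_approx_summand:
  assumes k: "k \<in> J" and approx: "multiplier_approx (partial_sum J) C"
  shows "multiplier_approx (\<Gamma> k) C"
proof (rule multiplier_approx_inj_hom[OF \<Gamma> group_partial_sum _ _ approx])
  let ?h = "\<lambda>a i. if i = k then a else \<one>\<^bsub>\<Gamma> i\<^esub>"
  have "finite {i. ?h a i \<noteq> \<one>\<^bsub>\<Gamma> i\<^esub>}" for a
    by (rule finite_subset[of _ "{k}"]) auto
  then have h: "?h a \<in> supported J" if "a \<in> carrier (\<Gamma> k)" for a
    using that k by (auto simp: supported_iff monoid.one_closed[OF monoid_\<Gamma>])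
  show "?h \<in> hom (\<Gamma> k) (partial_sum J)"
    by (rule homI) (auto simp: h monoid.l_one[OF monoid_\<Gamma>] monoid.one_closed[OF monoid_\<Gamma>])
  show "inj_on ?h (carrier (\<Gamma> k))"
    by (rule inj_onI) (metis (full_types))
qed

text \<open>Splitting off the last coordinate is an injective homomorphism into the product. This
  direction builds up approximation for finite sums of weakly amenable groups.\<close>

lemma multiplier_approx_partial_sum_Suc:
  assumes "multiplier_approx (partial_sum {..<n} \<times>\<times> \<Gamma> n) C"
  shows "multiplier_approx (partial_sum {..<Suc n}) C"
proof (rule multiplier_approx_inj_hom[OF group_partial_sum DirProd_group[OF group_partial_sum \<Gamma>] _ _ assms])
  let ?h = "\<lambda>x. (x(n := \<one>\<^bsub>\<Gamma> n\<^esub>), x n)"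
  have h: "x(n := \<one>\<^bsub>\<Gamma> n\<^esub>) \<in> supported {..<n}" if "x \<in> supported {..<Suc n}" for x
  proof -
    have "{k. (x(n := \<one>\<^bsub>\<Gamma> n\<^esub>)) k \<noteq> \<one>\<^bsub>\<Gamma> k\<^esub>} \<subseteq> {k. x k \<noteq> \<one>\<^bsub>\<Gamma> k\<^esub>}" by auto
    then have "finite {k. (x(n := \<one>\<^bsub>\<Gamma> n\<^esub>)) k \<noteq> \<one>\<^bsub>\<Gamma> k\<^esub>}"
      by (rule finite_subset) (use that in \<open>simp add: supported_iff\<close>)
    then show ?thesis
      using that by (auto simp: supported_iff monoid.one_closed[OF monoid_\<Gamma>])
  qed
  have c: "x k \<in> carrier (\<Gamma> k)" if "x \<in> supported J" for x k J
    using that by (simp add: supported_iff)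
  show "?h \<in> hom (partial_sum {..<Suc n}) (partial_sum {..<n} \<times>\<times> \<Gamma> n)"
    by (rule homI) (auto simp: h c monoid.l_one[OF monoid_\<Gamma>] monoid.one_closed[OF monoid_\<Gamma>] fun_eq_iff)
  show "inj_on ?h (carrier (partial_sum {..<Suc n}))"
  proof (rule inj_onI)
    fix x y assume "?h x = ?h y"
    then have "x(n := \<one>\<^bsub>\<Gamma> n\<^esub>, n := x n) = y(n := \<one>\<^bsub>\<Gamma> n\<^esub>, n := y n)" by simp
    then show "x = y" by simp
  qed
qed

text \<open>The inverse map, inserting the last coordinate; through it the failure for a product
  passes to the longer partial sum.\<close>

lemma multiplier_approx_DirProd_partial_sum:
  assumes "multiplier_approx (partial_sum {..<Suc n}) C"
  shows "multiplier_approx (partial_sum {..<n} \<times>\<times> \<Gamma> n) C"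
proof (rule multiplier_approx_inj_hom[OF DirProd_group[OF group_partial_sum \<Gamma>] group_partial_sum _ _ assms])
  let ?h = "\<lambda>(x, a). x(n := a)"
  have h: "x(n := a) \<in> supported {..<Suc n}" if "x \<in> supported {..<n}" "a \<in> carrier (\<Gamma> n)" for x a
  proof -
    have "{k. (x(n := a)) k \<noteq> \<one>\<^bsub>\<Gamma> k\<^esub>} \<subseteq> insert n {k. x k \<noteq> \<one>\<^bsub>\<Gamma> k\<^esub>}" by auto
    then have "finite {k. (x(n := a)) k \<noteq> \<one>\<^bsub>\<Gamma> k\<^esub>}"
      by (rule finite_subset) (use that(1) in \<open>simp add: supported_iff\<close>)
    then show ?thesis
      using that by (auto simp: supported_iff)
  qed
  show "?h \<in> hom (partial_sum {..<n} \<times>\<times> \<Gamma> n) (partial_sum {..<Suc n})"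
    by (rule homI) (auto simp: h fun_eq_iff)
  show "inj_on ?h (carrier (partial_sum {..<n} \<times>\<times> \<Gamma> n))"
  proof (rule inj_onI)
    fix xa yb
    assume "xa \<in> carrier (partial_sum {..<n} \<times>\<times> \<Gamma> n)" "yb \<in> carrier (partial_sum {..<n} \<times>\<times> \<Gamma> n)" "?h xa = ?h yb"
    moreover obtain x a y b where [simp]: "xa = (x, a)" "yb = (y, b)" by (cases xa, cases yb)
    ultimately have supp: "x \<in> supported {..<n}" "y \<in> supported {..<n}" and eq: "x(n := a) = y(n := b)"
      by auto
    have "x k = y k" for k
      using fun_cong[OF eq, of k] supp by (cases "k = n") (auto simp: supported_iff)
    moreover have "a = b" using fun_cong[OF eq, of n] by simp
    ultimately show "xa = yb" by (simp add: fun_eq_iff)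
  qed
qed

lemma multiplier_approx_partial_sum_subset:
  assumes "J \<subseteq> K" "multiplier_approx (partial_sum K) C"
  shows "multiplier_approx (partial_sum J) C"
proof (rule multiplier_approx_inj_hom[OF group_partial_sum group_partial_sum _ _ assms(2)])
  show "(\<lambda>x. x) \<in> hom (partial_sum J) (partial_sum K)"
    by (rule homI) (use assms(1) in \<open>auto simp: supported_def\<close>)
qed simp

lemma partial_sum_empty: "multiplier_approx (partial_sum {}) 1"
proof (rule multiplier_approx_finite)
  have "supported {} \<subseteq> {\<lambda>k. \<one>\<^bsub>\<Gamma> k\<^esub>}" by (auto simp: supported_def)
  then show "finite (carrier (partial_sum {}))" by (simp add: finite_subset)
qed

lemma finite_partial_sum_weakly_amenable:
  assumes "\<And>k. weakly_amenable (\<Gamma> k)"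
  shows "\<exists>C>0. multiplier_approx (partial_sum {..<n}) C"
proof (induction n)
  case 0
  show ?case using partial_sum_empty by (intro exI[of _ 1]) simp
next
  case (Suc n)
  then obtain C where C: "0 < C" "multiplier_approx (partial_sum {..<n}) C" by blast
  obtain D where D: "0 < D" "multiplier_approx (\<Gamma> n) D"
    by (rule weakly_amenable_multiplier_approx[OF \<Gamma> assms])
  have "multiplier_approx (partial_sum {..<Suc n}) (C * D)"
    by (intro multiplier_approx_partial_sum_Suc multiplier_approx_DirProd group_partial_sum \<Gamma> C D)
  then show ?case using C D by (intro exI[of _ "C * D"]) simp
qed

text \<open>The induction starts with one summand: for the empty sum the constant would be
  \<open>c^0 = 1\<close>, which the trivial group does admit.\<close>

lemma not_multiplier_approx_partial_sum:
  assumes c: "0 < c" and not: "\<And>k. \<not> multiplier_approx (\<Gamma> k) c"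
  shows "\<not> multiplier_approx (partial_sum {..<Suc n}) (c ^ Suc n)"
proof (induction n)
  case 0
  show ?case using not[of 0] multiplier_approx_summand[of 0 "{..<Suc 0}"] by auto
next
  case (Suc n)
  have "\<not> multiplier_approx (partial_sum {..<Suc n} \<times>\<times> \<Gamma> (Suc n)) (c ^ Suc n * c)"
    using c by (intro not_multiplier_approx_DirProd group_partial_sum \<Gamma> Suc not) auto
  moreover have "c ^ Suc (Suc n) = c ^ Suc n * c" by (simp add: mult.commute)
  ultimately show ?case
    using multiplier_approx_DirProd_partial_sum[of "Suc n"] by metis
qed

end

theorem proposition5p17:
  fixes \<Gamma> :: "nat \<Rightarrow> ('a, 'b) monoid_scheme"
  assumes "\<And>k. group (\<Gamma> k)"
    and "\<And>k. countable (carrier (\<Gamma> k))"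
    and "(INF k. Lambda_cb (\<Gamma> k)) > 1"
  shows "\<not> continuous_map (Sub_topology (sum_group UNIV \<Gamma>)) (euclidean :: ennreal topology)
             (\<lambda>H. Lambda_cb ((sum_group UNIV \<Gamma>)\<lparr>carrier := H\<rparr>)) \<and>
         ((\<forall>k. weakly_amenable (\<Gamma> k)) \<longrightarrow>
           \<not> closedin (Sub_topology (sum_group UNIV \<Gamma>))
               {H. subgroup H (sum_group UNIV \<Gamma>) \<and>
                   weakly_amenable ((sum_group UNIV \<Gamma>)\<lparr>carrier := H\<rparr>)})"
proof -
  let ?S = "sum_group UNIV \<Gamma>"
  note \<Gamma> = assms(1)
  note sub = supported_subgroup[of \<Gamma>, OF \<Gamma>]
  \<comment> \<open>The infimum may be infinite; a number strictly below it is finite and thus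
    provides a real constant \<open>c\<close>.\<close>
  obtain r where r: "1 < r" "r < (INF k. Lambda_cb (\<Gamma> k))"
    using dense[OF assms(3)] by blast
  then have "r \<noteq> \<infinity>" by auto
  then obtain c where c: "r = ennreal c" "0 \<le> c" by (cases r) auto
  have c1: "1 < c" using r c by (simp add: ennreal_1[symmetric] ennreal_less_iff del: ennreal_1)
  have not: "\<not> multiplier_approx (\<Gamma> k) c" for k
  proof
    assume "multiplier_approx (\<Gamma> k) c"
    then have "Lambda_cb (\<Gamma> k) \<le> ennreal c"
      using c1 by (intro Lambda_cb_le \<Gamma>) auto
    moreover have "(INF k. Lambda_cb (\<Gamma> k)) \<le> Lambda_cb (\<Gamma> k)"
      by (rule INF_lower) simp
    ultimately show False using r c by simp
  qed
  \<comment> \<open>An element of the direct sum has finite support, so its n-th coordinate is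
    eventually trivial; lying in the n-th summand then means being the identity.\<close>
  have lim0: "limitin (Sub_topology ?S) (\<lambda>k. supported \<Gamma> {k}) (supported \<Gamma> {}) sequentially"
  proof (rule limitin_Sub_topology[OF sub sub])
    fix g assume "g \<in> carrier ?S"
    then have "finite {k. g k \<noteq> \<one>\<^bsub>\<Gamma> k\<^esub>}" using carrier_sum[of \<Gamma>, OF \<Gamma>] by blast
    then obtain N where N: "\<And>k. g k \<noteq> \<one>\<^bsub>\<Gamma> k\<^esub> \<Longrightarrow> k < N"
      unfolding finite_nat_set_iff_bounded by blast
    have "(\<forall>k. k \<notin> {n} \<longrightarrow> g k = \<one>\<^bsub>\<Gamma> k\<^esub>) = (\<forall>k. k \<notin> {} \<longrightarrow> g k = \<one>\<^bsub>\<Gamma> k\<^esub>)" if "N \<le> n" for n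
    proof -
      have "g n = \<one>\<^bsub>\<Gamma> n\<^esub>" using N[of n] that by auto
      then show ?thesis by (metis empty_iff singletonD)
    qed
    then show "\<forall>\<^sub>F n in sequentially. (g \<in> supported \<Gamma> {n}) = (g \<in> supported \<Gamma> {})"
      unfolding eventually_sequentially supported_def[of \<Gamma>, OF \<Gamma>] by (intro exI[of _ N]) auto
  qed
  \<comment> \<open>By finiteness of supports, every element lies in all sufficiently long partial
    sums.\<close>
  have lim1: "limitin (Sub_topology ?S) (\<lambda>n. supported \<Gamma> {..<n}) (supported \<Gamma> UNIV) sequentially"
  proof (rule limitin_Sub_topology[OF sub sub])
    fix g assume "g \<in> carrier ?S"
    then have "finite {k. g k \<noteq> \<one>\<^bsub>\<Gamma> k\<^esub>}" using carrier_sum[of \<Gamma>, OF \<Gamma>] by blast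
    then obtain N where N: "\<And>k. g k \<noteq> \<one>\<^bsub>\<Gamma> k\<^esub> \<Longrightarrow> k < N"
      unfolding finite_nat_set_iff_bounded by blast
    have "g k = \<one>\<^bsub>\<Gamma> k\<^esub>" if "N \<le> n" "\<not> k < n" for n k
      using N[of k] that by auto
    then show "\<forall>\<^sub>F n in sequentially. (g \<in> supported \<Gamma> {..<n}) = (g \<in> supported \<Gamma> UNIV)"
      unfolding eventually_sequentially supported_def[of \<Gamma>, OF \<Gamma>] by (intro exI[of _ N]) auto
  qed
  show ?thesis
  proof (intro conjI impI notI)
    assume "continuous_map (Sub_topology ?S) (euclidean :: ennreal topology) (\<lambda>H. Lambda_cb (?S\<lparr>carrier := H\<rparr>))"
    from continuous_map_limit[OF this lim0]
    have "(\<lambda>k. Lambda_cb (partial_sum \<Gamma> {k})) \<longlonglongrightarrow> Lambda_cb (partial_sum \<Gamma> {})"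
      by (simp add: o_def partial_sum_def[of \<Gamma>, OF \<Gamma>])
    \<comment> \<open>Each summand embeds in its copy inside the sum, so the lower bound
      \<open>c > 1\<close> holds along the whole sequence and would survive in the limit.\<close>
    moreover have "ennreal c \<le> Lambda_cb (partial_sum \<Gamma> {k})" for k
    proof (rule ccontr)
      assume "\<not> ennreal c \<le> Lambda_cb (partial_sum \<Gamma> {k})"
      then have "multiplier_approx (partial_sum \<Gamma> {k}) c"
        by (intro multiplier_approx_of_Lambda_cb group_partial_sum \<Gamma>) simp
      with multiplier_approx_summand[of \<Gamma>, OF \<Gamma>, of k "{k}"] not show False by blast
    qed
    ultimately have "ennreal c \<le> Lambda_cb (partial_sum \<Gamma> {})"
      by (intro tendsto_lowerbound[of _ _ sequentially]) auto
    also have "\<dots> \<le> ennreal 1"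
      by (intro Lambda_cb_le group_partial_sum partial_sum_empty \<Gamma>) simp
    finally show False using c1 by (simp add: ennreal_le_iff del: ennreal_1)
  next
    assume wa: "\<forall>k. weakly_amenable (\<Gamma> k)"
      and closed: "closedin (Sub_topology ?S) {H. subgroup H ?S \<and> weakly_amenable (?S\<lparr>carrier := H\<rparr>)}"
    have "weakly_amenable (partial_sum \<Gamma> {..<n})" for n
    proof -
      obtain C where "0 < C" "multiplier_approx (partial_sum \<Gamma> {..<n}) C"
        using finite_partial_sum_weakly_amenable[of \<Gamma>, OF \<Gamma>] wa by blast
      then show ?thesis by (intro weakly_amenableI group_partial_sum \<Gamma>)
    qed
    then have "supported \<Gamma> UNIV \<in> {H. subgroup H ?S \<and> weakly_amenable (?S\<lparr>carrier := H\<rparr>)}"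
      by (intro limitin_closedin[OF lim1 closed])
        (simp_all add: sub partial_sum_def[of \<Gamma>, OF \<Gamma>])
    then have "weakly_amenable (partial_sum \<Gamma> UNIV)"
      by (simp add: partial_sum_def[of \<Gamma>, OF \<Gamma>])
    then obtain C where C: "multiplier_approx (partial_sum \<Gamma> UNIV) C"
      by (rule weakly_amenable_multiplier_approx[OF group_partial_sum[of \<Gamma>, OF \<Gamma>]])
    \<comment> \<open>A constant for the full sum serves all partial sums, while
      \<open>c > 1\<close> makes the failing constants unbounded. The exponent is raised by one
      because the failure is stated for nonempty sums.\<close>
    obtain n where "C < c ^ n" using real_arch_pow[OF c1] by blast
    also have "c ^ n \<le> c ^ Suc n" using c1 by (intro power_increasing) auto
    finally have "C \<le> c ^ Suc n" by simp
    from multiplier_approx_mono[OF multiplier_approx_partial_sum_subset[of \<Gamma>, OF \<Gamma> subset_UNIV C] this]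
    show False
      using not_multiplier_approx_partial_sum[of \<Gamma>, OF \<Gamma> _ not] c1 by auto
  qed
qed

end
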